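(* $\mathcal{W}_{\mathcal{I}_D}\subseteq\mathcal{W}_{\mathcal{I}_d}$. In particular, $\mathrm{id}:\left(\mathrm{Sh}(\mathbb{P},\tau),\mathcal{I}_D\right)\to\left(\mathrm{Sh}(\mathbb{P},\tau),\mathcal{I}_d\right)$ is a left Quillen functor.
   Context: An epo-space is a pair $(U,\preccurlyeq)$ where $U$ is a topological space homeomorphic to an open subset of $\mathbb{H}^n=\{(x_1,\dots,x_n)\in\mathbb{R}^n \mid x_n\geq 0\}$ for some $n\in\mathbb{N}$ and $\preccurlyeq$ is a partial order on $U$ closed in $U\times U$. $\mathbb{P}$ is the category of epo-spaces and dimaps (continuous non-decreasing maps). The open-dicover topology $\tau$ on $\mathbb{P}$ has as covering families of $X$ the families $(X_i)_{i\in I}$ of open subsets of $X$ (with inherited order) with $\bigcup_i X_i=X$. $\Delta_d$ is the unit interval $[0,1]$ with the discrete order and $\Delta_D$ is $[0,1]$ with the natural order, both regarded as epo-spaces (a local epo-space with a one-chart atlas). For $\Delta\in\{\Delta_d,\Delta_D\}$, $h_{\mathbb{P}}(\Delta)\in\mathrm{Sh}(\mathbb{P},\tau)$ is the sheaf sending $P$ to the set of dimaps (continuous non-decreasing maps) $P\to\Delta$. For $s\in\{d,D\}$ let $\mathcal{I}_s=(I_s,\partial^0_s,\partial^1_s,\sigma_s)$ be the interval on $\mathrm{Sh}(\mathbb{P},\tau)$ given by $I_s=(-)\times h_{\mathbb{P}}(\Delta_s)$, $\partial^e_{s,F,P}(x)=(x,k^e_{s,P})$ for $x\in F(P)$, with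 $k^e_{s,P}:P\to\Delta_s$ the constant dimap with value $e\in\{0,1\}$, and $\sigma_{s,F}:F\times h_{\mathbb{P}}(\Delta_s)\to F$ the first projection. General definitions, for a topos $\mathcal{E}$ (here $\mathrm{Sh}(\mathbb{P},\tau)$) with a fixed cellular model $\mathfrak{M}$, i.e. a set of monos such that $\mathfrak{M}\text{-cof}$ is the class of all monos. Here $M\text{-inj}$ is the class of morphisms with the right lifting property with respect to $M$, and $M\text{-cof}$ is the class of morphisms with the left lifting property with respect to $M\text{-inj}$. A cylinder $\mathcal{I}=(I,\partial^0,\partial^1,\sigma)$ consists of an endofunctor $I$ and natural transformations $\partial^0,\partial^1:\mathrm{id}\Rightarrow I$, $\sigma:I\Rightarrow\mathrm{id}$ with $\sigma\circ\partial^0=\sigma\circ\partial^1=\mathrm{id}$. It is cartesian if for every mono $j:A\to B$ and $e\in\{0,1\}$ the naturality square $\partial^e_B\circ j=I(j)\circ\partial^e_A$ is a pullback. An interval is a cartesian cylinder such that $I$ preserves monos and colimits and $[\partial^0_C,\partial^1_C]:C+C\to I(C)$ is mono for every $C$. Morphisms $f_0,f_1:X\to Y$ are $\mathcal{I}$-homotopic if there is $h:I(X)\to Y$ with $h\circ\partial^e_X=f_e$ for $e\in\{0,1\}$. Write $\vee$ for union of subobjects and $\mathrm{sat}(S)=\{I(l)\vee[\partial^0_{\mathrm{cod}(l)},\partial^1_{\mathrm{cod}(l)}]\mid l\in S\}$ for a set $S$ of monos. Set $\Lambda^0_{\mathcal{I}}=\{I(m)\vee\partial^e_{\mathrm{cod}(m)}\mid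 m\in\mathfrak{M},e\in\{0,1\}\}$, $\Lambda^{n+1}_{\mathcal{I}}=\mathrm{sat}(\Lambda^n_{\mathcal{I}})$, $\Lambda_{\mathcal{I}}=\bigcup_{n\ge0}\Lambda^n_{\mathcal{I}}$. An object $T$ is $\mathcal{I}$-naively fibrant if $T\to1$ lies in $\Lambda_{\mathcal{I}}\text{-inj}$; then $\mathcal{I}$-homotopy is an equivalence relation on $\mathcal{E}(X,T)$ (Cisinski). $(\mathcal{E},\mathcal{I})$ denotes $\mathcal{E}$ with the cofibrantly generated model structure (Cisinski) whose cofibrations are the monos and whose weak equivalences, forming the class $\mathcal{W}_{\mathcal{I}}$, are the morphisms $f:X\to Y$ inducing a bijection $f^*:\mathcal{E}(Y,T)/_{\sim}\to\mathcal{E}(X,T)/_{\sim}$ on $\mathcal{I}$-homotopy classes for all $\mathcal{I}$-naively fibrant $T$.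
   Formalization: The presheaf sending P to the dimaps P → Δ is not a sheaf for the open-dicover topology (two disjoint intervals with one extra relation p ≤ q), so h_P(Δ) is taken to be its associated sheaf: functions that are dimaps on each member of some open dicover of P. *)

theory Defs
  imports "HOL-Analysis.Analysis" "HOL-Library.Equipollence"
begin

section \<open>Categories\<close>

record ('o, 'a) category =
  Obj :: "'o set"
  Arr :: "'a set"
  Dom :: "'a \<Rightarrow> 'o"
  Cod :: "'a \<Rightarrow> 'o"
  Idn :: "'o \<Rightarrow> 'a"
  Cmp :: "'a \<Rightarrow> 'a \<Rightarrow> 'a"  \<comment> \<open>\<open>Cmp C g f\<close> is \<open>g\<close> after \<open>f\<close>\<close>

definition Hom :: "('o, 'a, 'm) category_scheme \<Rightarrow> 'o \<Rightarrow> 'o \<Rightarrow> 'a set" where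
  "Hom C X Y = {f \<in> Arr C. Dom C f = X \<and> Cod C f = Y}"

definition Monos :: "('o, 'a, 'm) category_scheme \<Rightarrow> 'a set" where
  "Monos C = {m \<in> Arr C. \<forall>Z. \<forall>f\<in>Hom C Z (Dom C m). \<forall>g\<in>Hom C Z (Dom C m).
     Cmp C m f = Cmp C m g \<longrightarrow> f = g}"

definition terminal :: "('o, 'a, 'm) category_scheme \<Rightarrow> 'o \<Rightarrow> bool" where
  "terminal C t \<longleftrightarrow> t \<in> Obj C \<and> (\<forall>X\<in>Obj C. \<exists>!f. f \<in> Hom C X t)"

definition is_coproduct ::
    "('o, 'a, 'm) category_scheme \<Rightarrow> 'o \<Rightarrow> 'o \<Rightarrow> 'o \<Rightarrow> 'a \<Rightarrow> 'a \<Rightarrow> bool" where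
  "is_coproduct C A B S i j \<longleftrightarrow> S \<in> Obj C \<and> i \<in> Hom C A S \<and> j \<in> Hom C B S \<and>
     (\<forall>Z\<in>Obj C. \<forall>p\<in>Hom C A Z. \<forall>q\<in>Hom C B Z.
        \<exists>!r. r \<in> Hom C S Z \<and> Cmp C r i = p \<and> Cmp C r j = q)"

text \<open>\<open>c\<close> is the arrow \<open>[f, g]\<close> out of some coproduct of the domains of \<open>f\<close> and \<open>g\<close>.\<close>

definition is_copairing :: "('o, 'a, 'm) category_scheme \<Rightarrow> 'a \<Rightarrow> 'a \<Rightarrow> 'a \<Rightarrow> bool" where
  "is_copairing C c f g \<longleftrightarrow> c \<in> Arr C \<and>
     (\<exists>i j. is_coproduct C (Dom C f) (Dom C g) (Dom C c) i j \<and> Cmp C c i = f \<and> Cmp C c j = g)"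

definition sub_le :: "('o, 'a, 'm) category_scheme \<Rightarrow> 'a \<Rightarrow> 'a \<Rightarrow> bool" where
  "sub_le C a b \<longleftrightarrow> (\<exists>k\<in>Hom C (Dom C a) (Dom C b). Cmp C b k = a)"

text \<open>A subobject is an isomorphism class of monos, and \<open>is_union C u a b\<close> says that the mono
  \<open>u\<close> represents the union (the join) of the subobjects \<open>a\<close> and \<open>b\<close>. The sets
  of unions below contain all representatives, which does not affect lifting properties.\<close>

definition is_union :: "('o, 'a, 'm) category_scheme \<Rightarrow> 'a \<Rightarrow> 'a \<Rightarrow> 'a \<Rightarrow> bool" where
  "is_union C u a b \<longleftrightarrow> u \<in> Monos C \<and> Cod C a = Cod C u \<and> Cod C b = Cod C u \<and>
     sub_le C a u \<and> sub_le C b u \<and>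
     (\<forall>w\<in>Monos C. Cod C w = Cod C u \<and> sub_le C a w \<and> sub_le C b w \<longrightarrow> sub_le C u w)"

subsection \<open>Lifting properties\<close>

definition lifts :: "('o, 'a, 'm) category_scheme \<Rightarrow> 'a \<Rightarrow> 'a \<Rightarrow> bool" where
  "lifts C l r \<longleftrightarrow>
     (\<forall>u\<in>Hom C (Dom C l) (Dom C r). \<forall>v\<in>Hom C (Cod C l) (Cod C r).
        Cmp C r u = Cmp C v l \<longrightarrow>
        (\<exists>d\<in>Hom C (Cod C l) (Dom C r). Cmp C d l = u \<and> Cmp C r d = v))"

definition inj_class :: "('o, 'a, 'm) category_scheme \<Rightarrow> 'a set \<Rightarrow> 'a set" where
  "inj_class C M = {r \<in> Arr C. \<forall>l\<in>M. lifts C l r}"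

definition cof_class :: "('o, 'a, 'm) category_scheme \<Rightarrow> 'a set \<Rightarrow> 'a set" where
  "cof_class C M = {l \<in> Arr C. \<forall>r\<in>inj_class C M. lifts C l r}"

definition cellular_model :: "('o, 'a, 'm) category_scheme \<Rightarrow> 'a set \<Rightarrow> bool" where
  "cellular_model C M \<longleftrightarrow> M \<subseteq> Monos C \<and> cof_class C M = Monos C"

subsection \<open>Cylinders and the induced weak equivalences\<close>

text \<open>The two end inclusions of a cylinder are \<open>face I 0\<close> and \<open>face I 1\<close>.\<close>

record ('o, 'a) cylinder =
  cylO :: "'o \<Rightarrow> 'o"
  cylA :: "'a \<Rightarrow> 'a"
  face :: "nat \<Rightarrow> 'o \<Rightarrow> 'a"
  collapse :: "'o \<Rightarrow> 'a"

definition sat :: "('o, 'a, 'm) category_scheme \<Rightarrow> ('o, 'a) cylinder \<Rightarrow> 'a set \<Rightarrow> 'a set" where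
  "sat C I S = {u. \<exists>l\<in>S. \<exists>c. is_copairing C c (face I 0 (Cod C l)) (face I 1 (Cod C l)) \<and>
     is_union C u (cylA I l) c}"

definition Lambda0 ::
    "('o, 'a, 'm) category_scheme \<Rightarrow> 'a set \<Rightarrow> ('o, 'a) cylinder \<Rightarrow> 'a set" where
  "Lambda0 C M I = {u. \<exists>m\<in>M. \<exists>e\<in>{0, 1}. is_union C u (cylA I m) (face I e (Cod C m))}"

definition Lambda ::
    "('o, 'a, 'm) category_scheme \<Rightarrow> 'a set \<Rightarrow> ('o, 'a) cylinder \<Rightarrow> 'a set" where
  "Lambda C M I = (\<Union>n. (sat C I ^^ n) (Lambda0 C M I))"

definition naively_fibrant ::
    "('o, 'a, 'm) category_scheme \<Rightarrow> 'a set \<Rightarrow> ('o, 'a) cylinder \<Rightarrow> 'o \<Rightarrow> bool" where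
  "naively_fibrant C M I T \<longleftrightarrow> T \<in> Obj C \<and>
     (\<exists>t. terminal C t \<and> (\<exists>f\<in>Hom C T t. f \<in> inj_class C (Lambda C M I)))"

definition homotopic ::
    "('o, 'a, 'm) category_scheme \<Rightarrow> ('o, 'a) cylinder \<Rightarrow> 'o \<Rightarrow> 'o \<Rightarrow> ('a \<times> 'a) set" where
  "homotopic C I X Y = {(f0, f1). f0 \<in> Hom C X Y \<and> f1 \<in> Hom C X Y \<and>
     (\<exists>h\<in>Hom C (cylO I X) Y. Cmp C h (face I 0 X) = f0 \<and> Cmp C h (face I 1 X) = f1)}"

text \<open>The map \<open>f\<^sup>*\<close> sends the homotopy class of \<open>g\<close> to that of \<open>g \<circ> f\<close>.\<close>

definition weak_equivalences ::
    "('o, 'a, 'm) category_scheme \<Rightarrow> 'a set \<Rightarrow> ('o, 'a) cylinder \<Rightarrow> 'a set" where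
  "weak_equivalences C M I = {f \<in> Arr C. \<forall>T. naively_fibrant C M I T \<longrightarrow>
     bij_betw (\<lambda>c. homotopic C I (Dom C f) T `` ((\<lambda>g. Cmp C g f) ` c))
       (Hom C (Cod C f) T // homotopic C I (Cod C f) T)
       (Hom C (Dom C f) T // homotopic C I (Dom C f) T)}"

subsection \<open>Model categories and left Quillen functors\<close>

record ('o, 'a) model_category = "('o, 'a) category" +
  Cofib :: "'a set"
  Fib :: "'a set"
  Weq :: "'a set"

definition cisinski_model ::
    "('o, 'a) category \<Rightarrow> 'a set \<Rightarrow> ('o, 'a) cylinder \<Rightarrow> ('o, 'a) model_category" where
  "cisinski_model C M I = category.extend C
     \<lparr>Cofib = Monos C,
      Fib = inj_class C (Monos C \<inter> weak_equivalences C M I),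
      Weq = weak_equivalences C M I\<rparr>"

record ('o, 'a, 'p, 'b) functr =
  fobj :: "'o \<Rightarrow> 'p"
  farr :: "'a \<Rightarrow> 'b"

definition is_functor ::
    "('o, 'a, 'm) category_scheme \<Rightarrow> ('p, 'b, 'n) category_scheme \<Rightarrow> ('o, 'a, 'p, 'b) functr
     \<Rightarrow> bool" where
  "is_functor C D F \<longleftrightarrow>
     (\<forall>X\<in>Obj C. fobj F X \<in> Obj D \<and> farr F (Idn C X) = Idn D (fobj F X)) \<and>
     (\<forall>f\<in>Arr C. farr F f \<in> Hom D (fobj F (Dom C f)) (fobj F (Cod C f))) \<and>
     (\<forall>f\<in>Arr C. \<forall>g\<in>Arr C. Cod C f = Dom C g \<longrightarrow>
        farr F (Cmp C g f) = Cmp D (farr F g) (farr F f))"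

definition id_functor :: "('o, 'a, 'o, 'a) functr" where
  "id_functor = \<lparr>fobj = (\<lambda>X. X), farr = (\<lambda>f. f)\<rparr>"

definition comp_functor ::
    "('p, 'b, 'q, 'c) functr \<Rightarrow> ('o, 'a, 'p, 'b) functr \<Rightarrow> ('o, 'a, 'q, 'c) functr" where
  "comp_functor G F = \<lparr>fobj = fobj G \<circ> fobj F, farr = farr G \<circ> farr F\<rparr>"

definition is_nat_trans ::
    "('o, 'a, 'm) category_scheme \<Rightarrow> ('p, 'b, 'n) category_scheme \<Rightarrow> ('o, 'a, 'p, 'b) functr
     \<Rightarrow> ('o, 'a, 'p, 'b) functr \<Rightarrow> ('o \<Rightarrow> 'b) \<Rightarrow> bool" where
  "is_nat_trans C D F G \<eta> \<longleftrightarrow>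
     (\<forall>X\<in>Obj C. \<eta> X \<in> Hom D (fobj F X) (fobj G X)) \<and>
     (\<forall>f\<in>Arr C. Cmp D (\<eta> (Cod C f)) (farr F f) = Cmp D (farr G f) (\<eta> (Dom C f)))"

definition is_left_adjoint ::
    "('o, 'a, 'm) category_scheme \<Rightarrow> ('p, 'b, 'n) category_scheme \<Rightarrow> ('o, 'a, 'p, 'b) functr
     \<Rightarrow> bool" where
  "is_left_adjoint C D F \<longleftrightarrow> is_functor C D F \<and>
     (\<exists>G \<eta> \<epsilon>. is_functor D C G \<and>
        is_nat_trans C C id_functor (comp_functor G F) \<eta> \<and>
        is_nat_trans D D (comp_functor F G) id_functor \<epsilon> \<and>
        (\<forall>X\<in>Obj C. Cmp D (\<epsilon> (fobj F X)) (farr F (\<eta> X)) = Idn D (fobj F X)) \<and>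
        (\<forall>Y\<in>Obj D. Cmp C (farr G (\<epsilon> Y)) (\<eta> (fobj G Y)) = Idn C (fobj G Y)))"

definition left_quillen ::
    "('o, 'a) model_category \<Rightarrow> ('p, 'b) model_category \<Rightarrow> ('o, 'a, 'p, 'b) functr \<Rightarrow> bool" where
  "left_quillen M N F \<longleftrightarrow> is_left_adjoint M N F \<and>
     farr F ` Cofib M \<subseteq> Cofib N \<and>
     farr F ` (Cofib M \<inter> Weq M) \<subseteq> Cofib N \<inter> Weq N"

section \<open>The site of epo-spaces\<close>

type_synonym 'a ospace = "'a topology \<times> 'a rel"

definition dimap :: "'a ospace \<Rightarrow> 'b ospace \<Rightarrow> ('a \<Rightarrow> 'b) \<Rightarrow> bool" where
  "dimap X Y f \<longleftrightarrow> continuous_map (fst X) (fst Y) f \<and>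
     (\<forall>(x, y)\<in>snd X. (f x, f y) \<in> snd Y)"

definition sub_ospace :: "'a ospace \<Rightarrow> 'a set \<Rightarrow> 'a ospace" where
  "sub_ospace X U = (subtopology (fst X) U, snd X \<inter> U \<times> U)"

definition open_dicover :: "'a ospace \<Rightarrow> 'a set set \<Rightarrow> bool" where
  "open_dicover X \<C> \<longleftrightarrow> (\<forall>U\<in>\<C>. openin (fst X) U) \<and> \<Union>\<C> = topspace (fst X)"

text \<open>The coordinate \<open>x\<^sub>n\<close> is \<open>x (n - 1)\<close> here, and \<open>half_space 0\<close> is a single point. Every
  space homeomorphic to an open subset of a half-space has at most continuum many points, so
  the points may be taken from the type \<open>nat \<Rightarrow> real\<close>, with an arbitrary topology.\<close>

definition half_space :: "nat \<Rightarrow> (nat \<Rightarrow> real) topology" where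
  "half_space n = subtopology (Euclidean_space n) {x. x (n - 1) \<ge> 0}"

type_synonym epo = "(nat \<Rightarrow> real) ospace"
type_synonym epo_map = "epo \<times> ((nat \<Rightarrow> real) \<Rightarrow> nat \<Rightarrow> real) \<times> epo"

definition epo_space :: "epo \<Rightarrow> bool" where
  "epo_space X \<longleftrightarrow>
     (\<exists>n U. openin (half_space n) U \<and> fst X homeomorphic_space subtopology (half_space n) U) \<and>
     partial_order_on (topspace (fst X)) (snd X) \<and>
     closedin (prod_topology (fst X) (fst X)) (snd X)"

definition epo_cat :: "(epo, epo_map) category" where
  "epo_cat = \<lparr>
     Obj = {X. epo_space X},
     Arr = {(X, f, Y). epo_space X \<and> epo_space Y \<and> f \<in> extensional (topspace (fst X)) \<and> dimap X Y f},
     Dom = (\<lambda>(X, f, Y). X),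
     Cod = (\<lambda>(X, f, Y). Y),
     Idn = (\<lambda>X. (X, \<lambda>x\<in>topspace (fst X). x, X)),
     Cmp = (\<lambda>(Y', g, Z) (X, f, Y). (X, compose (topspace (fst X)) g f, Z))\<rparr>"

definition inclusion :: "epo \<Rightarrow> epo \<Rightarrow> epo_map" where
  "inclusion X Y = (X, \<lambda>x\<in>topspace (fst X). x, Y)"

section \<open>Sheaves of sets\<close>

text \<open>\<open>\<U>\<close> plays the role of the class of (small) sets. Every Grothendieck universe
  containing the site has the closure properties below; closure under power sets is not needed,
  and is left out because HOL cannot exhibit an infinite family of sets that satisfies it.\<close>

definition set_universe :: "'u set set \<Rightarrow> bool" where
  "set_universe \<U> \<longleftrightarrow>
     (\<forall>A\<in>\<U>. \<forall>B::'u set. B \<lesssim> A \<longrightarrow> B \<in> \<U>) \<and>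
     (\<forall>A\<in>\<U>. \<forall>B. (\<forall>a\<in>A. B a \<in> \<U>) \<longrightarrow> (\<Union>a\<in>A. B a) \<in> \<U>) \<and>
     (\<exists>A\<in>\<U>. (UNIV :: epo_map set) \<lesssim> A) \<and>
     (\<forall>A\<in>\<U>. \<exists>B\<in>\<U>. (UNIV :: epo_map set) \<rightarrow>\<^sub>E A \<approx> B)"

lemma infinite_times_self:
  assumes "infinite (UNIV :: 'c set)"
  obtains g :: "'c \<times> 'c \<Rightarrow> 'c" where "inj g"
proof -
  have "(UNIV :: 'c set) \<times> (UNIV :: 'c set) \<approx> (UNIV :: 'c set)"
    unfolding eqpoll_iff_card_of_ordIso using assms by (rule card_of_Times_same_infinite)
  then show thesis using that by (auto simp: eqpoll_def bij_betw_def)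
qed

lemma infinite_UNIV_inj:
  assumes "inj (i :: 'c \<Rightarrow> 'd)" and "infinite (UNIV :: 'c set)"
  shows "infinite (UNIV :: 'd set)"
  using assms finite_imageD[of i UNIV] finite_subset[of "range i" UNIV] by auto

lemma infinite_epo_map: "infinite (UNIV :: epo_map set)"
proof -
  have "inj (\<lambda>n. ((undefined, \<lambda>_ _. real n, undefined) :: epo_map))"
    by (auto simp: inj_def fun_eq_iff)
  then show ?thesis
    using infinite_UNIV_nat by (rule infinite_UNIV_inj)
qed

lemma inj_into_Pow:
  assumes "infinite (UNIV :: 'k set)"
  obtains e :: "('k \<Rightarrow> ('k \<times> 'b) set) \<Rightarrow> ('k \<times> 'b) set" where "inj e"
proof -
  have "inj (\<lambda>k :: 'k. (k, undefined :: 'b))"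
    by (rule injI) simp
  then have "infinite (UNIV :: ('k \<times> 'b) set)"
    using assms by (rule infinite_UNIV_inj)
  then obtain g :: "('k \<times> 'b) \<times> ('k \<times> 'b) \<Rightarrow> 'k \<times> 'b" where g: "inj g"
    by (rule infinite_times_self)
  define e where "e H = g ` {z. snd z \<in> H (fst (fst z))}" for H :: "'k \<Rightarrow> ('k \<times> 'b) set"
  have mem: "x \<in> H k \<longleftrightarrow> g ((k, undefined), x) \<in> e H" for H k x
    unfolding e_def by (simp only: inj_image_mem_iff[OF g] mem_Collect_eq fst_conv snd_conv)
  have "inj e"
    by (rule injI, intro ext set_eqI) (simp only: mem)
  then show thesis by (rule that)
qed

text \<open>All sets over a power set type form such a family, so the notion is not vacuous.\<close>

lemma set_universe_UNIV: "set_universe (UNIV :: (epo_map \<times> 'b) set set set)"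
proof -
  let ?K = "UNIV :: epo_map set"
  obtain e :: "(epo_map \<Rightarrow> (epo_map \<times> 'b) set) \<Rightarrow> (epo_map \<times> 'b) set" where e: "inj e"
    using infinite_epo_map by (rule inj_into_Pow)
  have pow: "\<exists>B\<in>(UNIV :: (epo_map \<times> 'b) set set set). (?K \<rightarrow>\<^sub>E A) \<approx> B"
    for A :: "(epo_map \<times> 'b) set set"
  proof (rule bexI)
    have "inj_on e (?K \<rightarrow>\<^sub>E A)"
      using e subset_UNIV by (rule inj_on_subset)
    then show "(?K \<rightarrow>\<^sub>E A) \<approx> e ` (?K \<rightarrow>\<^sub>E A)"
      by (rule eqpoll_sym[OF inj_on_image_eqpoll_self])
  qed simp
  have "inj (\<lambda>k. {(k :: epo_map, undefined :: 'b)})"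
    by (rule injI) simp
  then have "?K \<lesssim> (UNIV :: (epo_map \<times> 'b) set set)"
    unfolding lepoll_def by (intro exI conjI) (assumption, rule subset_UNIV)
  then have "\<exists>A\<in>UNIV. ?K \<lesssim> (A :: (epo_map \<times> 'b) set set)" by (rule bexI) (rule UNIV_I)
  then show ?thesis
    unfolding set_universe_def using pow by (intro conjI ballI allI impI UNIV_I)
qed

text \<open>Sections of a sheaf have type \<open>'u\<close>; pairs of sections, and maps into the unit interval,
  are represented in \<open>'u\<close> through arbitrary injections, which exist by the lemmas below.\<close>

definition code :: "'b \<Rightarrow> 'u" where
  "code = (SOME c. inj c)"

lemma inj_code_pair:
  assumes "set_universe (\<U> :: 'u set set)"
  shows "inj (code :: 'u \<times> 'u \<Rightarrow> 'u)"
proof -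
  obtain A where A: "A \<in> \<U>" "(UNIV :: epo_map set) \<lesssim> A"
    using assms unfolding set_universe_def by blast
  then obtain i :: "epo_map \<Rightarrow> 'u" where "inj i"
    unfolding lepoll_def by auto
  then have "infinite (UNIV :: 'u set)"
    using infinite_epo_map by (rule infinite_UNIV_inj)
  then have "\<exists>c :: 'u \<times> 'u \<Rightarrow> 'u. inj c"
    using infinite_times_self by blast
  then show ?thesis unfolding code_def by (rule someI_ex)
qed

lemma inj_code_fun:
  assumes "set_universe (\<U> :: 'u set set)"
  shows "inj (code :: ((nat \<Rightarrow> real) \<Rightarrow> real) \<Rightarrow> 'u)"
proof -
  obtain A where A: "A \<in> \<U>" "(UNIV :: epo_map set) \<lesssim> A"
    using assms unfolding set_universe_def by blast
  obtain i :: "epo_map \<Rightarrow> 'u" where i: "inj i" "range i \<subseteq> A"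
    using A(2) unfolding lepoll_def by auto
  have "\<exists>B\<in>\<U>. (UNIV :: epo_map set) \<rightarrow>\<^sub>E A \<approx> B"
    using assms A(1) unfolding set_universe_def by (elim conjE) (rule bspec)
  then obtain B :: "'u set" where "(UNIV :: epo_map set) \<rightarrow>\<^sub>E A \<approx> B"
    by (elim bexE)
  then obtain j :: "(epo_map \<Rightarrow> 'u) \<Rightarrow> 'u" where j: "inj_on j (UNIV \<rightarrow>\<^sub>E A)"
    unfolding eqpoll_def bij_betw_def by (elim exE conjE)
  define r :: "real \<Rightarrow> 'u" where "r t = i (undefined, \<lambda>_ _. t, undefined)" for t
  define q :: "((nat \<Rightarrow> real) \<Rightarrow> real) \<Rightarrow> epo_map \<Rightarrow> 'u"
    where "q f = (\<lambda>(X, g, Y). r (f (g (\<lambda>_. 0))))" for f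
  have r: "inj r"
    by (rule injI) (simp add: r_def inj_eq[OF i(1)] fun_eq_iff)
  have rA: "r t \<in> A" for t using i(2) unfolding r_def by blast
  have qA: "q f \<in> UNIV \<rightarrow>\<^sub>E A" for f
    unfolding q_def PiE_def extensional_def using rA by (simp add: split_def)
  have "inj q"
  proof (rule injI)
    fix f f' assume eq: "q f = q f'"
    show "f = f'"
    proof
      fix p
      have "q f (undefined, \<lambda>_. p, undefined) = q f' (undefined, \<lambda>_. p, undefined)" by (simp only: eq)
      then show "f p = f' p" by (simp add: q_def inj_eq[OF r])
    qed
  qed
  moreover have "inj_on j (range q)"
    using j by (rule inj_on_subset) (use qA in blast)
  ultimately have "inj (j \<circ> q)"
    by (rule comp_inj_on)
  then have "\<exists>c :: ((nat \<Rightarrow> real) \<Rightarrow> real) \<Rightarrow> 'u. inj c" by blast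
  then show ?thesis unfolding code_def by (rule someI_ex)
qed

record 'u presheaf =
  sec :: "epo \<Rightarrow> 'u set"
  res :: "epo_map \<Rightarrow> 'u \<Rightarrow> 'u"

definition is_presheaf :: "'u set set \<Rightarrow> 'u presheaf \<Rightarrow> bool" where
  "is_presheaf \<U> F \<longleftrightarrow>
     (\<forall>X\<in>Obj epo_cat. sec F X \<in> \<U>) \<and>
     (\<forall>a\<in>Arr epo_cat. res F a \<in> sec F (Cod epo_cat a) \<rightarrow> sec F (Dom epo_cat a)) \<and>
     (\<forall>X\<in>Obj epo_cat. \<forall>x\<in>sec F X. res F (Idn epo_cat X) x = x) \<and>
     (\<forall>a\<in>Arr epo_cat. \<forall>b\<in>Arr epo_cat. Cod epo_cat a = Dom epo_cat b \<longrightarrow>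
        (\<forall>x\<in>sec F (Cod epo_cat b). res F (Cmp epo_cat b a) x = res F a (res F b x)))"

definition is_sheaf :: "'u set set \<Rightarrow> 'u presheaf \<Rightarrow> bool" where
  "is_sheaf \<U> F \<longleftrightarrow> is_presheaf \<U> F \<and>
     (\<forall>X\<in>Obj epo_cat. \<forall>\<C>. open_dicover X \<C> \<longrightarrow>
        (\<forall>s. (\<forall>U\<in>\<C>. s U \<in> sec F (sub_ospace X U)) \<and>
             (\<forall>U\<in>\<C>. \<forall>V\<in>\<C>.
                res F (inclusion (sub_ospace X (U \<inter> V)) (sub_ospace X U)) (s U) =
                res F (inclusion (sub_ospace X (U \<inter> V)) (sub_ospace X V)) (s V))
           \<longrightarrow> (\<exists>!x. x \<in> sec F X \<and> (\<forall>U\<in>\<C>. res F (inclusion (sub_ospace X U) X) x = s U))))"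

type_synonym 'u presheaf_map = "'u presheaf \<times> (epo \<Rightarrow> 'u \<Rightarrow> 'u) \<times> 'u presheaf"

definition sheaf_cat :: "'u set set \<Rightarrow> ('u presheaf, 'u presheaf_map) category" where
  "sheaf_cat \<U> = \<lparr>
     Obj = {F. is_sheaf \<U> F},
     Arr = {(F, \<eta>, G). is_sheaf \<U> F \<and> is_sheaf \<U> G \<and>
       \<eta> \<in> (\<Pi>\<^sub>E X\<in>Obj epo_cat. sec F X \<rightarrow>\<^sub>E sec G X) \<and>
       (\<forall>a\<in>Arr epo_cat. \<forall>x\<in>sec F (Cod epo_cat a).
          \<eta> (Dom epo_cat a) (res F a x) = res G a (\<eta> (Cod epo_cat a) x))},
     Dom = (\<lambda>(F, \<eta>, G). F),
     Cod = (\<lambda>(F, \<eta>, G). G),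
     Idn = (\<lambda>F. (F, \<lambda>X\<in>Obj epo_cat. \<lambda>x\<in>sec F X. x, F)),
     Cmp = (\<lambda>(G', \<beta>, H) (F, \<alpha>, G). (F, \<lambda>X\<in>Obj epo_cat. compose (sec F X) (\<beta> X) (\<alpha> X), H))\<rparr>"

section \<open>The two intervals\<close>

definition Delta_d :: "real ospace" where
  "Delta_d = (top_of_set {0..1}, Id_on {0..1})"

definition Delta_D :: "real ospace" where
  "Delta_D = (top_of_set {0..1}, {(x, y). 0 \<le> x \<and> x \<le> y \<and> y \<le> 1})"

text \<open>For the open-dicover topology the presheaf of dimaps into \<open>\<Delta>\<close> is not a sheaf:
  on \<open>X = U \<union> V\<close>, with \<open>U\<close> and \<open>V\<close> disjoint open intervals and an order that
  relates just one \<open>p \<in> U\<close> to one \<open>q \<in> V\<close>, the constants \<open>1\<close> on \<open>U\<close> and \<open>0\<close> on \<open>V\<close>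
  do not glue to a dimap. The object of the sheaf category is its
  associated sheaf: the presheaf is a subpresheaf of the sheaf of continuous maps to \<open>[0, 1]\<close>,
  so the sections over \<open>X\<close> of the associated sheaf are the functions that are dimaps on
  each member of some open dicover of \<open>X\<close> (maps of local epo-spaces).\<close>

definition local_dimaps :: "epo \<Rightarrow> real ospace \<Rightarrow> ((nat \<Rightarrow> real) \<Rightarrow> real) set" where
  "local_dimaps X \<Delta> = {f \<in> extensional (topspace (fst X)).
     \<exists>\<C>. open_dicover X \<C> \<and> (\<forall>U\<in>\<C>. dimap (sub_ospace X U) \<Delta> f)}"

definition h_P :: "real ospace \<Rightarrow> 'u presheaf" where
  "h_P \<Delta> = \<lparr>
     sec = (\<lambda>X. code ` local_dimaps X \<Delta>),
     res = (\<lambda>(X, f, Y) v. code (compose (topspace (fst X)) (inv code v :: (nat \<Rightarrow> real) \<Rightarrow> real) f))\<rparr>"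

definition prod_presheaf :: "'u presheaf \<Rightarrow> 'u presheaf \<Rightarrow> 'u presheaf" where
  "prod_presheaf F G = \<lparr>
     sec = (\<lambda>X. code ` (sec F X \<times> sec G X)),
     res = (\<lambda>a v. case inv code v of (x, y) \<Rightarrow> code (res F a x, res G a y))\<rparr>"

definition const_section :: "epo \<Rightarrow> nat \<Rightarrow> 'u" where
  "const_section X e = code (\<lambda>p\<in>topspace (fst X). real e)"

definition interval_of :: "real ospace \<Rightarrow> ('u presheaf, 'u presheaf_map) cylinder" where
  "interval_of \<Delta> = \<lparr>
     cylO = (\<lambda>F. prod_presheaf F (h_P \<Delta>)),
     cylA = (\<lambda>(F, \<eta>, G). (prod_presheaf F (h_P \<Delta>),
       \<lambda>X\<in>Obj epo_cat. \<lambda>v\<in>sec (prod_presheaf F (h_P \<Delta>)) X.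
         case inv code v of (x, k :: 'u) \<Rightarrow> code (\<eta> X x, k),
       prod_presheaf G (h_P \<Delta>))),
     face = (\<lambda>e F. (F,
       \<lambda>X\<in>Obj epo_cat. \<lambda>x\<in>sec F X. code (x, const_section X e :: 'u),
       prod_presheaf F (h_P \<Delta>))),
     collapse = (\<lambda>F. (prod_presheaf F (h_P \<Delta>),
       \<lambda>X\<in>Obj epo_cat. \<lambda>v\<in>sec (prod_presheaf F (h_P \<Delta>)) X. fst (inv code v :: 'u \<times> 'u),
       F))\<rparr>"

end

theory Submission
  imports Defs
begin

text \<open>It suffices that an \<open>\<I>\<^sub>d\<close>-naively fibrant sheaf \<open>T\<close> is \<open>\<I>\<^sub>D\<close>-naively fibrant and that the two
  homotopy relations on maps into \<open>T\<close> coincide. The tool for both is the homotopy extension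
  property of \<open>T\<close> for the discrete interval along arbitrary monos; it follows from the cellular
  case because it says that monos lift against the evaluation of the exponential
  \<open>T^\<Delta>\<^sub>d \<rightarrow> T\<close> at \<open>0\<close>. The interval \<open>\<Delta>\<^sub>D\<close> contracts to either end by the homotopy
  \<open>(t, s) \<mapsto> t s\<close> (or its mirror image), which is a dimap when \<open>t\<close> ranges over \<open>\<Delta>\<^sub>D\<close> and \<open>s\<close> over
  \<open>\<Delta>\<^sub>d\<close>. Extending along this contraction, a map given on \<open>C \<times> \<Delta>\<^sub>D \<union> D \<times> {0, 1}\<close> extends to
  \<open>D \<times> \<Delta>\<^sub>D\<close> as soon as its restriction to \<open>C \<times> \<Delta>\<^sub>d \<union> D \<times> {0, 1}\<close> extends to \<open>D \<times> \<Delta>\<^sub>d\<close>. For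
  \<open>C = \<emptyset>\<close> this turns discrete homotopies into directed ones; since pushout products commute, it also
  gives the extension property for \<open>\<Lambda>\<close> by induction along its construction.\<close>

section \<open>The site\<close>

text \<open>The hypothesis on \<open>M\<close> transfers lifting from \<open>M\<close> to all monos
  only against a single arrow of the sheaf category. Homotopy extension speaks of maps on products,
  so it must first be transposed, and the exponential must be an object of the category. It has to
  fit into a universe closed only under powers indexed by \<open>epo_map\<close>; this is the origin
  of the encodings into \<open>'u\<close>. Unions of subobjects in a sheaf category are sheaf
  closures of sectionwise unions. Extension problems are therefore posed for arbitrary
  subpresheaves, where unions and products are formed section by section. Since the target is a
  sheaf, solvability is the same for every subpresheaf between a given one and its closure, and the
  closure enters only when arrows of the category are involved. Over a space without points a sheaf
  has at most one section and the constants 0 and 1 coincide; prescriptions at the two ends of the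
  interval have to be reconciled there.\<close>

abbreviation Ob :: "epo set" where "Ob \<equiv> Obj epo_cat"
abbreviation Ar :: "epo_map set" where "Ar \<equiv> Arr epo_cat"
abbreviation dm :: "epo_map \<Rightarrow> epo" where "dm \<equiv> Dom epo_cat"
abbreviation cd :: "epo_map \<Rightarrow> epo" where "cd \<equiv> Cod epo_cat"
abbreviation idm :: "epo \<Rightarrow> epo_map" where "idm \<equiv> Idn epo_cat"
abbreviation cmp :: "epo_map \<Rightarrow> epo_map \<Rightarrow> epo_map"  (infixl "\<odot>" 70)
  where "b \<odot> a \<equiv> Cmp epo_cat b a"
abbreviation carrier :: "'a ospace \<Rightarrow> 'a set" where "carrier X \<equiv> topspace (fst X)"
abbreviation incl :: "epo \<Rightarrow> (nat \<Rightarrow> real) set \<Rightarrow> epo_map"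
  where "incl X U \<equiv> inclusion (sub_ospace X U) X"

lemma Ob_iff: "X \<in> Ob \<longleftrightarrow> epo_space X"
  by (simp add: epo_cat_def)

lemma Ar_iff: "(X, f, Y) \<in> Ar \<longleftrightarrow>
    X \<in> Ob \<and> Y \<in> Ob \<and> f \<in> extensional (carrier X) \<and> dimap X Y f"
  by (simp add: epo_cat_def)

lemma dm_cd [simp]: "dm (X, f, Y) = X" "cd (X, f, Y) = Y"
  by (simp_all add: epo_cat_def)

lemma idm_eq: "idm X = (X, \<lambda>x\<in>carrier X. x, X)"
  by (simp add: epo_cat_def)

lemma cmp_eq: "(Y', g, Z) \<odot> (X, f, Y) = (X, compose (carrier X) g f, Z)"
  by (simp add: epo_cat_def)

lemma Ar_dm [simp]: "a \<in> Ar \<Longrightarrow> dm a \<in> Ob" and Ar_cd [simp]: "a \<in> Ar \<Longrightarrow> cd a \<in> Ob"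
  by (cases a, simp add: Ar_iff)+

lemma dimap_carrier: "dimap X Y f \<Longrightarrow> x \<in> carrier X \<Longrightarrow> f x \<in> carrier Y"
  unfolding dimap_def by (auto simp: continuous_map_def)

lemma dimap_cong:
  assumes "\<And>x. x \<in> carrier X \<Longrightarrow> f x = g x" and "snd X \<subseteq> carrier X \<times> carrier X"
  shows "dimap X Y f \<longleftrightarrow> dimap X Y g"
proof -
  have "continuous_map (fst X) (fst Y) f \<longleftrightarrow> continuous_map (fst X) (fst Y) g"
    using assms(1) by (metis continuous_map_eq)
  moreover have "(\<forall>(x, y)\<in>snd X. (f x, f y) \<in> snd Y) \<longleftrightarrow> (\<forall>(x, y)\<in>snd X. (g x, g y) \<in> snd Y)"
    using assms by (intro ball_cong) auto
  ultimately show ?thesis by (simp add: dimap_def)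
qed

lemma Ob_order: "X \<in> Ob \<Longrightarrow> snd X \<subseteq> carrier X \<times> carrier X"
  unfolding Ob_iff epo_space_def by (metis closedin_subset topspace_prod_topology)

lemma dimap_comp: "dimap X Y f \<Longrightarrow> dimap Y Z g \<Longrightarrow> dimap X Z (g \<circ> f)"
  unfolding dimap_def by (auto intro: continuous_map_compose)

lemma dimap_compose:
  assumes "X \<in> Ob" "dimap X Y f" "dimap Y Z g"
  shows "dimap X Z (compose (carrier X) g f)"
proof -
  have "dimap X Z (compose (carrier X) g f) \<longleftrightarrow> dimap X Z (g \<circ> f)"
    by (rule dimap_cong) (use Ob_order[OF assms(1)] in \<open>auto simp: compose_def\<close>)
  then show ?thesis using dimap_comp[OF assms(2,3)] by simp
qed

lemma dimap_id: "X \<in> Ob \<Longrightarrow> dimap X X (\<lambda>x\<in>carrier X. x)"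
  by (subst dimap_cong[of _ _ "\<lambda>x. x"]) (auto dest: Ob_order simp: dimap_def)

lemma cmp_Ar [simp]:
  assumes "a \<in> Ar" "b \<in> Ar" "cd a = dm b"
  shows "b \<odot> a \<in> Ar" "dm (b \<odot> a) = dm a" "cd (b \<odot> a) = cd b"
  using assms
  by (cases a; cases b; auto simp: Ar_iff cmp_eq intro: dimap_compose)+

lemma idm_Ar [simp]: "X \<in> Ob \<Longrightarrow> idm X \<in> Ar" "dm (idm X) = X" "cd (idm X) = X"
  by (auto simp: idm_eq Ar_iff dimap_id)

lemma cmp_idm [simp]: "a \<in> Ar \<Longrightarrow> dm a = X \<Longrightarrow> a \<odot> idm X = a"
  by (cases a) (auto simp: idm_eq Ar_iff cmp_eq compose_def extensional_def fun_eq_iff)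

lemma idm_cmp [simp]: "a \<in> Ar \<Longrightarrow> cd a = X \<Longrightarrow> idm X \<odot> a = a"
  by (cases a) (auto simp: idm_eq Ar_iff cmp_eq compose_def extensional_def fun_eq_iff dest: dimap_carrier)

lemma cmp_assoc:
  "a \<in> Ar \<Longrightarrow> b \<in> Ar \<Longrightarrow> c \<in> Ar \<Longrightarrow> cd a = dm b \<Longrightarrow> cd b = dm c \<Longrightarrow> c \<odot> (b \<odot> a) = c \<odot> b \<odot> a"
  by (cases a; cases b; cases c) (auto simp: Ar_iff cmp_eq compose_def fun_eq_iff dest: dimap_carrier)

section \<open>Open subspaces of epo-spaces\<close>

lemma carrier_sub: "openin (fst X) U \<Longrightarrow> carrier (sub_ospace X U) = U"
  by (simp add: sub_ospace_def Int_absorb1 openin_subset)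

text \<open>A chart carries \<open>U\<close> to an open subset of its image \<open>W\<close>, which
  is open in the half-space because \<open>W\<close> is. The restricted order stays closed because
  \<open>U \<times> U\<close> carries the subspace topology of the product.\<close>

lemma sub_Ob [simp]:
  assumes "X \<in> Ob" "openin (fst X) U"
  shows "sub_ospace X U \<in> Ob"
proof -
  obtain n W where W: "openin (half_space n) W"
      "fst X homeomorphic_space subtopology (half_space n) W"
    and po: "partial_order_on (carrier X) (snd X)"
    and cl: "closedin (prod_topology (fst X) (fst X)) (snd X)"
    using assms(1) unfolding Ob_iff epo_space_def by blast
  obtain f g where fg: "homeomorphic_maps (fst X) (subtopology (half_space n) W) f g"
    using W(2) unfolding homeomorphic_space_def by blast
  then have hm: "homeomorphic_map (fst X) (subtopology (half_space n) W) f"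
    using homeomorphic_maps_map by blast
  have Usub: "U \<subseteq> carrier X" using assms(2) by (rule openin_subset)
  have op: "openin (subtopology (half_space n) W) (f ` U)"
    using homeomorphic_map_openness_eq[OF hm] assms(2) by blast
  then have fW: "f ` U \<subseteq> W" by (metis openin_imp_subset)
  have h1: "homeomorphic_map (subtopology (fst X) U)
      (subtopology (subtopology (half_space n) W) (f ` U)) f"
    using hm Usub homeomorphic_map_subtopologies by (metis homeomorphic_imp_surjective_map
      image_mono inf.absorb_iff2)
  have h2: "subtopology (subtopology (half_space n) W) (f ` U) = subtopology (half_space n) (f ` U)"
    using fW by (simp add: subtopology_subtopology Int_absorb1)
  have h: "fst (sub_ospace X U) homeomorphic_space subtopology (half_space n) (f ` U)"
    using homeomorphic_map_imp_homeomorphic_space[OF h1] by (simp only: sub_ospace_def h2 fst_conv)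
  have o: "openin (half_space n) (f ` U)"
    using op W(1) by (metis openin_trans_full)
  have p: "partial_order_on U (snd X \<inter> U \<times> U)"
    using po Usub unfolding partial_order_on_def preorder_on_def
    by (auto simp: refl_on_def antisym_on_def intro!: trans_Int trans_onI dest: transD)
  have "closedin (subtopology (prod_topology (fst X) (fst X)) (U \<times> U)) (snd X \<inter> U \<times> U)"
    using cl closedin_subtopology by blast
  then have c: "closedin (prod_topology (subtopology (fst X) U) (subtopology (fst X) U)) (snd X \<inter> U \<times> U)"
    by (simp only: subtopology_Times)
  show ?thesis
    unfolding Ob_iff epo_space_def carrier_sub[OF assms(2)]
    using o h p c by (intro conjI exI[of _ n] exI[of _ "f ` U"]) (simp_all only: sub_ospace_def fst_conv snd_conv)
qed

lemma dimap_sub: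
  assumes "openin (fst Y) V" "openin (fst X) U" "dimap Y X f" "f ` V \<subseteq> U"
  shows "dimap (sub_ospace Y V) (sub_ospace X U) f"
  using assms unfolding dimap_def sub_ospace_def
  by (force simp: continuous_map_in_subtopology continuous_map_from_subtopology)

lemma dimap_into_sub:
  "openin (fst X) U \<Longrightarrow> dimap Y X f \<Longrightarrow> f ` carrier Y \<subseteq> U \<Longrightarrow> snd Y \<subseteq> carrier Y \<times> carrier Y \<Longrightarrow>
    dimap Y (sub_ospace X U) f"
  unfolding dimap_def sub_ospace_def
  by (fastforce simp: continuous_map_in_subtopology)

lemma inclusion_dm_cd [simp]: "dm (inclusion X Y) = X" "cd (inclusion X Y) = Y"
  by (simp_all add: inclusion_def)

lemma incl_Ar [simp]:
  assumes "X \<in> Ob" "openin (fst X) U"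
  shows "incl X U \<in> Ar"
proof -
  have "dimap (sub_ospace X U) X (\<lambda>x. x)"
    by (auto simp: dimap_def sub_ospace_def continuous_map_from_subtopology)
  then have "dimap (sub_ospace X U) X (\<lambda>x\<in>carrier (sub_ospace X U). x)"
    by (subst dimap_cong[of _ _ "\<lambda>x. x"]) (use assms Ob_order sub_Ob in auto)
  then show ?thesis using assms by (simp add: inclusion_def Ar_iff)
qed

lemma sub_sub: "V \<subseteq> U \<Longrightarrow> sub_ospace (sub_ospace X U) V = sub_ospace X V"
  by (auto simp: sub_ospace_def subtopology_subtopology Int_absorb1)

lemma openin_sub: "openin (fst X) U \<Longrightarrow> openin (fst X) V \<Longrightarrow> V \<subseteq> U \<Longrightarrow> openin (fst (sub_ospace X U)) V"
  by (simp add: sub_ospace_def openin_open_subtopology)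

lemma inclusion_Ar [simp]:
  assumes "X \<in> Ob" "openin (fst X) U" "openin (fst X) V" "V \<subseteq> U"
  shows "inclusion (sub_ospace X V) (sub_ospace X U) \<in> Ar"
  using incl_Ar[OF sub_Ob[OF assms(1,2)] openin_sub[OF assms(2-4)]] by (simp add: sub_sub assms)

lemma incl_cmp_inclusion:
  assumes "openin (fst X) U" "openin (fst X) V" "V \<subseteq> U"
  shows "incl X U \<odot> inclusion (sub_ospace X V) (sub_ospace X U) = incl X V"
  using assms by (auto simp: inclusion_def cmp_eq carrier_sub compose_def fun_eq_iff)

section \<open>Base change along open inclusions\<close>

definition pre :: "epo_map \<Rightarrow> (nat \<Rightarrow> real) set \<Rightarrow> (nat \<Rightarrow> real) set" where
  "pre a U = {p \<in> carrier (dm a). fst (snd a) p \<in> U}"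

text \<open>The factorization of \<open>a\<close> through the open subspace \<open>U\<close>; it is
  an arrow of the site when \<open>pre a U\<close> is the whole domain.\<close>

definition corestrict :: "epo_map \<Rightarrow> (nat \<Rightarrow> real) set \<Rightarrow> epo_map" where
  "corestrict a U = (dm a, fst (snd a), sub_ospace (cd a) U)"

lemma corestrict_dm_cd [simp]: "dm (corestrict a U) = dm a" "cd (corestrict a U) = sub_ospace (cd a) U"
  by (simp_all add: corestrict_def)

lemma pre_open [simp]: "a \<in> Ar \<Longrightarrow> openin (fst (cd a)) U \<Longrightarrow> openin (fst (dm a)) (pre a U)"
  by (cases a) (auto simp: Ar_iff dimap_def pre_def continuous_map_def)

lemma pre_UN: "pre a (\<Union>\<C>) = \<Union>(pre a ` \<C>)"
  by (auto simp: pre_def)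

lemma pre_carrier: "a \<in> Ar \<Longrightarrow> pre a (carrier (cd a)) = carrier (dm a)"
  by (cases a) (auto simp: Ar_iff pre_def dest: dimap_carrier)

lemma pre_cover: "a \<in> Ar \<Longrightarrow> open_dicover (cd a) \<C> \<Longrightarrow> open_dicover (dm a) (pre a ` \<C>)"
  unfolding open_dicover_def by (auto simp: pre_UN[symmetric] pre_carrier)

lemma pre_cmp: "a \<in> Ar \<Longrightarrow> b \<in> Ar \<Longrightarrow> cd a = dm b \<Longrightarrow> pre (b \<odot> a) U = pre a (pre b U)"
  by (cases a; cases b) (auto simp: cmp_eq pre_def compose_def Ar_iff dest: dimap_carrier)

lemma pre_incl: "openin (fst X) V \<Longrightarrow> pre (incl X V) U = V \<inter> U"
  by (auto simp: pre_def inclusion_def carrier_sub)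

lemma corestrict_Ar [simp]:
  assumes "a \<in> Ar" "openin (fst (cd a)) U" "pre a U = carrier (dm a)"
  shows "corestrict a U \<in> Ar"
proof -
  obtain X f Y where fields: "a = (X, f, Y)" by (rule prod_cases3)
  have "dimap X (sub_ospace Y U) f"
    by (rule dimap_into_sub) (use assms fields Ob_order in \<open>auto simp: Ar_iff pre_def\<close>)
  then show ?thesis using assms fields by (simp add: Ar_iff corestrict_def)
qed

lemma incl_corestrict:
  assumes "a \<in> Ar" "openin (fst (cd a)) U" "pre a U = carrier (dm a)"
  shows "incl (cd a) U \<odot> corestrict a U = a"
  using assms
  by (cases a) (auto simp: corestrict_def inclusion_def cmp_eq pre_def carrier_sub Ar_iff
      compose_def fun_eq_iff extensional_def)

lemma corestrict_incl_cmp: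
  assumes "X \<in> Ob" "b \<in> Ar" "openin (fst X) U" "cd b = sub_ospace X U"
  shows "corestrict (incl X U \<odot> b) U = b"
  using assms
  by (cases b) (auto simp: corestrict_def inclusion_def cmp_eq carrier_sub Ar_iff
      compose_def fun_eq_iff extensional_def dest: dimap_carrier)

lemma pre_incl_cmp:
  assumes "X \<in> Ob" "b \<in> Ar" "openin (fst X) U" "cd b = sub_ospace X U"
  shows "pre (incl X U \<odot> b) U = carrier (dm b)"
proof -
  have "pre (incl X U \<odot> b) U = pre b (carrier (cd b))"
    using assms by (simp add: pre_cmp pre_incl carrier_sub)
  then show ?thesis using pre_carrier[OF assms(2)] by simp
qed

lemma corestrict_corestrict:
  assumes "openin (fst (cd a)) U" "V \<subseteq> U" "pre a V = carrier (dm a)" "a \<in> Ar" "openin (fst (cd a)) V"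
  shows "inclusion (sub_ospace (cd a) V) (sub_ospace (cd a) U) \<odot> corestrict a V = corestrict a U"
  using assms
  by (cases a) (auto simp: corestrict_def inclusion_def cmp_eq pre_def carrier_sub Ar_iff
      compose_def fun_eq_iff extensional_def)

lemma corestrict_cmp:
  assumes "a \<in> Ar" "b \<in> Ar" "cd a = dm b" "openin (fst (cd b)) U" "pre b U = carrier (dm b)"
  shows "corestrict (b \<odot> a) U = corestrict b U \<odot> a"
  using assms
  by (cases a; cases b) (auto simp: corestrict_def cmp_eq)

text \<open>The pullback of \<open>a\<close> along the inclusion of \<open>U\<close>, a map from
  \<open>pre a U\<close> to \<open>U\<close>. It lets restriction to members of a cover commute with
  restriction along \<open>a\<close>.\<close>

definition over :: "epo_map \<Rightarrow> (nat \<Rightarrow> real) set \<Rightarrow> epo_map" where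
  "over a U = corestrict (a \<odot> incl (dm a) (pre a U)) U"

lemma over_simps [simp]:
  assumes "a \<in> Ar" "openin (fst (cd a)) U"
  shows "over a U \<in> Ar" "dm (over a U) = sub_ospace (dm a) (pre a U)"
    "cd (over a U) = sub_ospace (cd a) U"
    "incl (cd a) U \<odot> over a U = a \<odot> incl (dm a) (pre a U)"
proof -
  have i: "incl (dm a) (pre a U) \<in> Ar" using assms by simp
  have p: "pre (a \<odot> incl (dm a) (pre a U)) U = carrier (dm (a \<odot> incl (dm a) (pre a U)))"
    using assms i by (simp add: pre_cmp pre_incl carrier_sub)
  have b: "a \<odot> incl (dm a) (pre a U) \<in> Ar" "cd (a \<odot> incl (dm a) (pre a U)) = cd a"
    using assms i by simp_all
  show "over a U \<in> Ar" unfolding over_def by (rule corestrict_Ar) (use assms b p in auto)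
  show "dm (over a U) = sub_ospace (dm a) (pre a U)" using assms i by (simp add: over_def)
  show "cd (over a U) = sub_ospace (cd a) U" using assms b by (simp add: over_def)
  show "incl (cd a) U \<odot> over a U = a \<odot> incl (dm a) (pre a U)"
    using incl_corestrict[OF b(1) _ p] assms b by (simp add: over_def)
qed

section \<open>Sheaves and subpresheaves\<close>

abbreviation presheaf :: "'b presheaf \<Rightarrow> bool" where "presheaf F \<equiv> is_presheaf UNIV F"
abbreviation sheaf :: "'b presheaf \<Rightarrow> bool" where "sheaf F \<equiv> is_sheaf UNIV F"

text \<open>Splits off the size condition: all glueing arguments take place over
  \<open>UNIV\<close>, and \<open>\<U>\<close> only bounds the sets of sections.\<close>

lemma is_sheaf_iff: "is_sheaf \<U> F \<longleftrightarrow> sheaf F \<and> (\<forall>X\<in>Ob. sec F X \<in> \<U>)"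
  unfolding is_sheaf_def is_presheaf_def by auto

lemma sheaf_presheaf: "sheaf F \<Longrightarrow> presheaf F"
  by (simp add: is_sheaf_def)

lemma presheaf_res [simp]: "presheaf F \<Longrightarrow> a \<in> Ar \<Longrightarrow> x \<in> sec F (cd a) \<Longrightarrow> res F a x \<in> sec F (dm a)"
  unfolding is_presheaf_def by blast

lemma presheaf_idm [simp]: "presheaf F \<Longrightarrow> X \<in> Ob \<Longrightarrow> x \<in> sec F X \<Longrightarrow> res F (idm X) x = x"
  unfolding is_presheaf_def by blast

lemma presheaf_cmp: "presheaf F \<Longrightarrow> a \<in> Ar \<Longrightarrow> b \<in> Ar \<Longrightarrow> cd a = dm b \<Longrightarrow> x \<in> sec F (cd b) \<Longrightarrow>
    res F (b \<odot> a) x = res F a (res F b x)"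
  unfolding is_presheaf_def by blast

lemma presheafI:
  assumes "\<And>a x. a \<in> Ar \<Longrightarrow> x \<in> sec F (cd a) \<Longrightarrow> res F a x \<in> sec F (dm a)"
    and "\<And>X x. X \<in> Ob \<Longrightarrow> x \<in> sec F X \<Longrightarrow> res F (idm X) x = x"
    and "\<And>a b x. a \<in> Ar \<Longrightarrow> b \<in> Ar \<Longrightarrow> cd a = dm b \<Longrightarrow> x \<in> sec F (cd b) \<Longrightarrow>
      res F (b \<odot> a) x = res F a (res F b x)"
  shows "presheaf F"
  using assms unfolding is_presheaf_def by auto

abbreviation rst :: "'b presheaf \<Rightarrow> epo \<Rightarrow> (nat \<Rightarrow> real) set \<Rightarrow> 'b \<Rightarrow> 'b" where
  "rst F X U x \<equiv> res F (incl X U) x"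

abbreviation matching :: "'b presheaf \<Rightarrow> epo \<Rightarrow> (nat \<Rightarrow> real) set set \<Rightarrow> ((nat \<Rightarrow> real) set \<Rightarrow> 'b) \<Rightarrow> bool"
  where "matching F X \<C> s \<equiv> (\<forall>U\<in>\<C>. s U \<in> sec F (sub_ospace X U)) \<and>
    (\<forall>U\<in>\<C>. \<forall>V\<in>\<C>. res F (inclusion (sub_ospace X (U \<inter> V)) (sub_ospace X U)) (s U) =
                res F (inclusion (sub_ospace X (U \<inter> V)) (sub_ospace X V)) (s V))"

lemma sheaf_glue:
  assumes "sheaf F" "X \<in> Ob" "open_dicover X \<C>" "matching F X \<C> s"
  shows "\<exists>!x. x \<in> sec F X \<and> (\<forall>U\<in>\<C>. rst F X U x = s U)"
  using assms unfolding is_sheaf_def by blast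

lemma sheafI:
  assumes "presheaf F"
    and "\<And>X \<C> x y. X \<in> Ob \<Longrightarrow> open_dicover X \<C> \<Longrightarrow> x \<in> sec F X \<Longrightarrow> y \<in> sec F X \<Longrightarrow>
       (\<And>U. U \<in> \<C> \<Longrightarrow> rst F X U x = rst F X U y) \<Longrightarrow> x = y"
    and "\<And>X \<C> s. X \<in> Ob \<Longrightarrow> open_dicover X \<C> \<Longrightarrow> matching F X \<C> s \<Longrightarrow>
       \<exists>x\<in>sec F X. \<forall>U\<in>\<C>. rst F X U x = s U"
  shows "sheaf F"
  unfolding is_sheaf_def
proof (intro conjI ballI allI impI assms(1))
  fix X \<C> s
  assume h: "X \<in> Ob" "open_dicover X \<C>" "matching F X \<C> s"
  obtain x where x: "x \<in> sec F X" "\<forall>U\<in>\<C>. rst F X U x = s U"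
    using assms(3)[OF h] by blast
  show "\<exists>!x. x \<in> sec F X \<and> (\<forall>U\<in>\<C>. rst F X U x = s U)"
  proof (rule ex1I[of _ x])
    fix y assume "y \<in> sec F X \<and> (\<forall>U\<in>\<C>. rst F X U y = s U)"
    then show "y = x" using assms(2)[OF h(1,2), of y x] x by auto
  qed (use x in blast)
qed

lemma cover_open: "open_dicover X \<C> \<Longrightarrow> U \<in> \<C> \<Longrightarrow> openin (fst X) U"
  by (simp add: open_dicover_def)

lemma rst_inclusion:
  assumes "presheaf F" "X \<in> Ob" "openin (fst X) U" "openin (fst X) V" "V \<subseteq> U" "x \<in> sec F X"
  shows "res F (inclusion (sub_ospace X V) (sub_ospace X U)) (rst F X U x) = rst F X V x"
  using presheaf_cmp[of F "inclusion (sub_ospace X V) (sub_ospace X U)" "incl X U" x] assms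
  by (simp add: incl_cmp_inclusion)

lemma rst_matching:
  assumes "presheaf F" "X \<in> Ob" "open_dicover X \<C>" "x \<in> sec F X"
  shows "matching F X \<C> (\<lambda>U. rst F X U x)"
proof (intro conjI ballI)
  fix U assume U: "U \<in> \<C>"
  then show "rst F X U x \<in> sec F (sub_ospace X U)"
    using presheaf_res[OF assms(1), of "incl X U" x] cover_open[OF assms(3) U] assms by simp
  fix V assume V: "V \<in> \<C>"
  show "res F (inclusion (sub_ospace X (U \<inter> V)) (sub_ospace X U)) (rst F X U x) =
        res F (inclusion (sub_ospace X (U \<inter> V)) (sub_ospace X V)) (rst F X V x)"
    using cover_open[OF assms(3)] U V assms by (simp add: rst_inclusion openin_Int)
qed

lemma rst_sec [simp]:
  assumes "presheaf F" "X \<in> Ob" "openin (fst X) U" "x \<in> sec F X"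
  shows "rst F X U x \<in> sec F (sub_ospace X U)"
  using presheaf_res[OF assms(1), of "incl X U" x] assms by simp

lemma separated:
  assumes "sheaf F" "X \<in> Ob" "open_dicover X \<C>" "x \<in> sec F X" "y \<in> sec F X"
    "\<And>U. U \<in> \<C> \<Longrightarrow> rst F X U x = rst F X U y"
  shows "x = y"
proof -
  have "\<exists>!z. z \<in> sec F X \<and> (\<forall>U\<in>\<C>. rst F X U z = rst F X U x)"
    by (rule sheaf_glue[OF assms(1-3) rst_matching[OF sheaf_presheaf[OF assms(1)] assms(2-4)]])
  then show ?thesis using assms(4-6) by metis
qed

lemma empty_cover: "carrier X = {} \<Longrightarrow> open_dicover X {}"
  by (simp add: open_dicover_def)

text \<open>The empty family covers a space without points, so separatedness has nothing to check.
  This settles the degenerate case in which the ends of the interval coincide.\<close>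

lemma sec_empty_eq:
  assumes "sheaf F" "X \<in> Ob" "carrier X = {}" "x \<in> sec F X" "y \<in> sec F X"
  shows "x = y"
  using separated[OF assms(1,2) empty_cover[OF assms(3)] assms(4,5)] by simp

lemma rst_res:
  assumes "presheaf F" "a \<in> Ar" "openin (fst (cd a)) U" "x \<in> sec F (cd a)"
  shows "rst F (dm a) (pre a U) (res F a x) = res F (over a U) (rst F (cd a) U x)"
proof -
  have "rst F (dm a) (pre a U) (res F a x) = res F (a \<odot> incl (dm a) (pre a U)) x"
    using assms by (simp add: presheaf_cmp)
  also have "\<dots> = res F (incl (cd a) U \<odot> over a U) x" using assms by simp
  also have "\<dots> = res F (over a U) (rst F (cd a) U x)" using assms by (intro presheaf_cmp) simp_all
  finally show ?thesis .
qed

section \<open>Subpresheaves and their sheaf closure\<close>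

definition subpsh :: "'b presheaf \<Rightarrow> (epo \<Rightarrow> 'b set) \<Rightarrow> bool" where
  "subpsh F S \<longleftrightarrow> (\<forall>X\<in>Ob. S X \<subseteq> sec F X) \<and> (\<forall>a\<in>Ar. \<forall>x\<in>S (cd a). res F a x \<in> S (dm a))"

lemma subpshD: "subpsh F S \<Longrightarrow> X \<in> Ob \<Longrightarrow> x \<in> S X \<Longrightarrow> x \<in> sec F X"
  and subpsh_res: "subpsh F S \<Longrightarrow> a \<in> Ar \<Longrightarrow> x \<in> S (cd a) \<Longrightarrow> res F a x \<in> S (dm a)"
  unfolding subpsh_def by auto

lemma subpsh_sec [simp]: "presheaf F \<Longrightarrow> subpsh F (sec F)"
  unfolding subpsh_def by auto

text \<open>The sheaf closure of \<open>S\<close> in \<open>F\<close>: if \<open>F\<close> is a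
  sheaf and \<open>S\<close> a subpresheaf, this is the subsheaf generated by
  \<open>S\<close>.\<close>

definition loc :: "'b presheaf \<Rightarrow> (epo \<Rightarrow> 'b set) \<Rightarrow> epo \<Rightarrow> 'b set" where
  "loc F S X = {x \<in> sec F X. \<exists>\<C>. open_dicover X \<C> \<and> (\<forall>U\<in>\<C>. rst F X U x \<in> S (sub_ospace X U))}"

lemma self_cover: "open_dicover X {carrier X}"
  by (simp add: open_dicover_def)

lemma loc_sec: "x \<in> loc F S X \<Longrightarrow> x \<in> sec F X"
  by (simp add: loc_def)

lemma subset_loc: "subpsh F S \<Longrightarrow> X \<in> Ob \<Longrightarrow> S X \<subseteq> loc F S X"
  unfolding loc_def using self_cover[of X] subpsh_res[of F S "incl X (carrier X)"]
  by (auto dest: subpshD)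

text \<open>A cover witnessing membership of \<open>x\<close> pulls back along \<open>a\<close>, and
  the base changes \<open>over a U\<close> carry its pieces to those of
  \<open>res F a x\<close>.\<close>

lemma subpsh_loc:
  assumes "presheaf F" "subpsh F S"
  shows "subpsh F (loc F S)"
  unfolding subpsh_def
proof (intro conjI ballI)
  fix a x assume a: "a \<in> Ar" and x: "x \<in> loc F S (cd a)"
  then obtain \<C> where C: "open_dicover (cd a) \<C>" "\<forall>U\<in>\<C>. rst F (cd a) U x \<in> S (sub_ospace (cd a) U)"
    and xs: "x \<in> sec F (cd a)"
    unfolding loc_def by blast
  have "rst F (dm a) (pre a U) (res F a x) \<in> S (sub_ospace (dm a) (pre a U))" if "U \<in> \<C>" for U
    using subpsh_res[OF assms(2), of "over a U" "rst F (cd a) U x"] cover_open[OF C(1) that] C(2) that a xs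
    by (simp add: rst_res[OF assms(1)])
  then show "res F a x \<in> loc F S (dm a)"
    unfolding loc_def using pre_cover[OF a C(1)] assms(1) a xs by auto
qed (auto simp: loc_def)

lemma cover_refine:
  assumes "open_dicover X \<C>" "\<And>U. U \<in> \<C> \<Longrightarrow> open_dicover (sub_ospace X U) (\<D> U)"
  shows "open_dicover X (\<Union>(\<D> ` \<C>))" "U \<in> \<C> \<Longrightarrow> V \<in> \<D> U \<Longrightarrow> V \<subseteq> U \<and> openin (fst X) V"
proof -
  show *: "V \<subseteq> U \<and> openin (fst X) V" if "U \<in> \<C>" "V \<in> \<D> U" for U V
    using cover_open[OF assms(2)[OF that(1)] that(2)] cover_open[OF assms(1) that(1)]
    by (simp add: sub_ospace_def openin_open_subtopology)
  have eq: "\<Union>(\<D> U) = U" if "U \<in> \<C>" for U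
    using assms(2)[OF that] cover_open[OF assms(1) that]
    by (simp add: open_dicover_def carrier_sub)
  have "\<Union>(\<Union>(\<D> ` \<C>)) = (\<Union>U\<in>\<C>. \<Union>(\<D> U))" by auto
  also have "\<dots> = carrier X" using eq assms(1) by (simp add: open_dicover_def)
  finally show "open_dicover X (\<Union>(\<D> ` \<C>))"
    unfolding open_dicover_def using * by blast
qed

text \<open>Covers of the members of a cover combine to one cover, so a single localization is
  already closed.\<close>

lemma loc_loc:
  assumes "presheaf F" "X \<in> Ob" "x \<in> loc F (loc F S) X"
  shows "x \<in> loc F S X"
proof -
  obtain \<C> where C: "open_dicover X \<C>" "\<And>U. U \<in> \<C> \<Longrightarrow> rst F X U x \<in> loc F S (sub_ospace X U)"
    and x: "x \<in> sec F X"
    using assms(3) unfolding loc_def by blast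
  have "\<forall>U\<in>\<C>. \<exists>D. open_dicover (sub_ospace X U) D \<and>
     (\<forall>V\<in>D. rst F (sub_ospace X U) V (rst F X U x) \<in> S (sub_ospace (sub_ospace X U) V))"
    using C(2) unfolding loc_def by blast
  then obtain \<D> where D: "\<And>U. U \<in> \<C> \<Longrightarrow> open_dicover (sub_ospace X U) (\<D> U)"
     "\<And>U V. U \<in> \<C> \<Longrightarrow> V \<in> \<D> U \<Longrightarrow> rst F (sub_ospace X U) V (rst F X U x) \<in> S (sub_ospace (sub_ospace X U) V)"
    by metis
  have "rst F X V x \<in> S (sub_ospace X V)" if "U \<in> \<C>" "V \<in> \<D> U" for U V
  proof -
    have "V \<subseteq> U" "openin (fst X) V" using cover_refine(2)[OF C(1) D(1)] that by auto
    then show ?thesis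
      using D(2)[OF that] rst_inclusion[OF assms(1,2), of U V x] cover_open[OF C(1)] that x
      by (simp add: sub_sub)
  qed
  then show ?thesis
    unfolding loc_def using cover_refine(1)[OF C(1) D(1)] x by blast
qed

lemma loc_mono:
  assumes "\<And>X. X \<in> Ob \<Longrightarrow> S X \<subseteq> S' X" "X \<in> Ob"
  shows "loc F S X \<subseteq> loc F S' X"
proof
  fix x assume "x \<in> loc F S X"
  then obtain \<C> where C: "open_dicover X \<C>" "\<forall>U\<in>\<C>. rst F X U x \<in> S (sub_ospace X U)"
    and x: "x \<in> sec F X"
    unfolding loc_def by blast
  have "\<forall>U\<in>\<C>. rst F X U x \<in> S' (sub_ospace X U)"
    using C(2) assms(1)[OF sub_Ob[OF assms(2) cover_open[OF C(1)]]] by blast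
  then show "x \<in> loc F S' X" unfolding loc_def using C(1) x by blast
qed

text \<open>The constructions below leave \<open>'u\<close>: sections over real pairs and functions are encoded into
  \<open>'u\<close> only at the interface with \<open>sheaf_cat\<close>, which is why natural maps may join
  presheaves over different types.\<close>

definition natural :: "'b presheaf \<Rightarrow> (epo \<Rightarrow> 'b set) \<Rightarrow> 'c presheaf \<Rightarrow> (epo \<Rightarrow> 'b \<Rightarrow> 'c) \<Rightarrow> bool" where
  "natural F S G \<eta> \<longleftrightarrow> (\<forall>X\<in>Ob. \<forall>x\<in>S X. \<eta> X x \<in> sec G X) \<and>
     (\<forall>a\<in>Ar. \<forall>x\<in>S (cd a). \<eta> (dm a) (res F a x) = res G a (\<eta> (cd a) x))"

lemma naturalD: "natural F S G \<eta> \<Longrightarrow> X \<in> Ob \<Longrightarrow> x \<in> S X \<Longrightarrow> \<eta> X x \<in> sec G X"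
  and natural_res: "natural F S G \<eta> \<Longrightarrow> a \<in> Ar \<Longrightarrow> x \<in> S (cd a) \<Longrightarrow>
    \<eta> (dm a) (res F a x) = res G a (\<eta> (cd a) x)"
  unfolding natural_def by auto

lemma natural_rst: "natural F S G \<eta> \<Longrightarrow> X \<in> Ob \<Longrightarrow> openin (fst X) U \<Longrightarrow> x \<in> S X \<Longrightarrow>
    \<eta> (sub_ospace X U) (rst F X U x) = rst G X U (\<eta> X x)"
  using natural_res[of F S G \<eta> "incl X U" x] by simp

lemma naturalI:
  "(\<And>X x. X \<in> Ob \<Longrightarrow> x \<in> S X \<Longrightarrow> \<eta> X x \<in> sec G X) \<Longrightarrow>
   (\<And>a x. a \<in> Ar \<Longrightarrow> x \<in> S (cd a) \<Longrightarrow> \<eta> (dm a) (res F a x) = res G a (\<eta> (cd a) x)) \<Longrightarrow> natural F S G \<eta>"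
  unfolding natural_def by auto

lemma natural_subset: "natural F S G \<eta> \<Longrightarrow> (\<And>X. X \<in> Ob \<Longrightarrow> S' X \<subseteq> S X) \<Longrightarrow> natural F S' G \<eta>"
  by (rule naturalI) (auto simp: natural_def subset_iff)

lemma natural_cong:
  "natural F S G \<eta> \<Longrightarrow> subpsh F S \<Longrightarrow> (\<And>X x. X \<in> Ob \<Longrightarrow> x \<in> S X \<Longrightarrow> \<eta> X x = \<zeta> X x) \<Longrightarrow> natural F S G \<zeta>"
  using subpsh_res[of F S] naturalD[of F S G \<eta>] natural_res[of F S G \<eta>]
  by (intro naturalI) (metis Ar_cd Ar_dm)+

lemma natural_comp:
  assumes "natural F S G \<eta>" "natural G R H \<zeta>" "\<And>X x. X \<in> Ob \<Longrightarrow> x \<in> S X \<Longrightarrow> \<eta> X x \<in> R X"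
  shows "natural F S H (\<lambda>X x. \<zeta> X (\<eta> X x))"
  using assms by (intro naturalI) (simp_all add: naturalD natural_res)

section \<open>Natural maps on the sheaf closure\<close>

lemma natural_eq_loc:
  assumes "presheaf F" "sheaf G" "natural F S' G \<eta>" "natural F S' G \<zeta>"
    "\<And>X x. X \<in> Ob \<Longrightarrow> x \<in> S X \<Longrightarrow> \<eta> X x = \<zeta> X x" "X \<in> Ob" "x \<in> S' X" "x \<in> loc F S X"
  shows "\<eta> X x = \<zeta> X x"
proof -
  obtain \<C> where C: "open_dicover X \<C>" "\<And>U. U \<in> \<C> \<Longrightarrow> rst F X U x \<in> S (sub_ospace X U)"
    using assms(8) unfolding loc_def by blast
  show ?thesis
  proof (rule separated[OF assms(2,6) C(1)])
    fix U assume U: "U \<in> \<C>"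
    then have o: "openin (fst X) U" using C(1) cover_open by blast
    show "rst G X U (\<eta> X x) = rst G X U (\<zeta> X x)"
      using natural_rst[OF assms(3,6) o assms(7)] natural_rst[OF assms(4,6) o assms(7)]
        assms(5)[OF _ C(2)[OF U]] o assms(6) by simp
  qed (rule naturalD[OF assms(3,6,7)] naturalD[OF assms(4,6,7)])+
qed

text \<open>The universal property of the closure: the value at a section is glued from the values
  of \<open>\<eta>\<close> on those of its pieces that lie in \<open>S\<close>.\<close>

lemma natural_extend_loc:
  assumes F: "presheaf F" and G: "sheaf G" and S: "subpsh F S" and \<eta>: "natural F S G \<eta>"
  obtains \<zeta> where "natural F (loc F S) G \<zeta>" "\<forall>X\<in>Ob. \<forall>x\<in>S X. \<zeta> X x = \<eta> X x"
proof -
  have Gp: "presheaf G" using G by (rule sheaf_presheaf)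
  \<comment> \<open>The largest family of open sets on which \<open>x\<close> restricts into
    \<open>S\<close> replaces a chosen cover, so the glued value depends on \<open>x\<close>
    alone.\<close>
  define D where "D X x = {U. openin (fst X) U \<and> rst F X U x \<in> S (sub_ospace X U)}" for X x
  define P where "P X x y \<longleftrightarrow> y \<in> sec G X \<and>
    (\<forall>U\<in>D X x. rst G X U y = \<eta> (sub_ospace X U) (rst F X U x))" for X x y
  have Dcov: "open_dicover X (D X x)" if x: "x \<in> loc F S X" for X x
  proof -
    obtain \<C> where C: "open_dicover X \<C>" "\<forall>U\<in>\<C>. rst F X U x \<in> S (sub_ospace X U)"
      using x unfolding loc_def by blast
    then have "\<C> \<subseteq> D X x" unfolding D_def using cover_open[OF C(1)] by blast
    moreover have "\<forall>U\<in>D X x. openin (fst X) U" unfolding D_def by blast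
    moreover have "\<Union>\<C> = carrier X" using C(1) unfolding open_dicover_def by blast
    moreover have "\<Union>(D X x) \<subseteq> carrier X" unfolding D_def using openin_subset[of "fst X"] by blast
    ultimately show ?thesis unfolding open_dicover_def by blast
  qed
  have ex: "\<exists>!y. P X x y" if X: "X \<in> Ob" and x: "x \<in> loc F S X" for X x
    unfolding P_def
  proof (rule sheaf_glue[OF G X Dcov[OF x]], intro conjI ballI)
    have xs: "x \<in> sec F X" using x by (rule loc_sec)
    fix U assume "U \<in> D X x"
    then have U: "openin (fst X) U" "rst F X U x \<in> S (sub_ospace X U)" unfolding D_def by auto
    show "\<eta> (sub_ospace X U) (rst F X U x) \<in> sec G (sub_ospace X U)"
      using naturalD[OF \<eta>] U X by simp
    fix V assume "V \<in> D X x"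
    then have V: "openin (fst X) V" "rst F X V x \<in> S (sub_ospace X V)" unfolding D_def by auto
    have *: "res G (inclusion (sub_ospace X (U \<inter> V)) (sub_ospace X W)) (\<eta> (sub_ospace X W) (rst F X W x))
        = \<eta> (sub_ospace X (U \<inter> V)) (rst F X (U \<inter> V) x)"
      if "openin (fst X) W" "rst F X W x \<in> S (sub_ospace X W)" "U \<inter> V \<subseteq> W" for W
      using natural_res[OF \<eta>, of "inclusion (sub_ospace X (U \<inter> V)) (sub_ospace X W)" "rst F X W x"]
        that X U V xs by (simp add: rst_inclusion[OF F] openin_Int)
    show "res G (inclusion (sub_ospace X (U \<inter> V)) (sub_ospace X U)) (\<eta> (sub_ospace X U) (rst F X U x)) =
       res G (inclusion (sub_ospace X (U \<inter> V)) (sub_ospace X V)) (\<eta> (sub_ospace X V) (rst F X V x))"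
      using *[OF U] *[OF V] by simp
  qed
  define \<zeta> where "\<zeta> X x = (THE y. P X x y)" for X x
  have \<zeta>P: "P X x (\<zeta> X x)" if "X \<in> Ob" "x \<in> loc F S X" for X x
    unfolding \<zeta>_def by (rule theI'[OF ex[OF that]])
  have \<zeta>s: "\<zeta> X x \<in> sec G X" if "X \<in> Ob" "x \<in> loc F S X" for X x
    using \<zeta>P[OF that] unfolding P_def by blast
  have \<zeta>r: "rst G X U (\<zeta> X x) = \<eta> (sub_ospace X U) (rst F X U x)"
    if "X \<in> Ob" "x \<in> loc F S X" "openin (fst X) U" "rst F X U x \<in> S (sub_ospace X U)" for X x U
    using \<zeta>P[OF that(1,2)] that(3,4) unfolding P_def D_def by blast
  have "natural F (loc F S) G \<zeta>"
  proof (rule naturalI)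
    fix a x assume a: "a \<in> Ar" and x: "x \<in> loc F S (cd a)"
    have xs: "x \<in> sec F (cd a)" using x by (rule loc_sec)
    have ax: "res F a x \<in> loc F S (dm a)" using subpsh_res[OF subpsh_loc[OF F S] a x] .
    \<comment> \<open>The family is not compared with the largest one for \<open>res F a x\<close>;
      its pullback along \<open>a\<close> consists of members of the latter and already covers the
      domain.\<close>
    show "\<zeta> (dm a) (res F a x) = res G a (\<zeta> (cd a) x)"
    proof (rule separated[OF G _ pre_cover[OF a Dcov[OF x]]])
      fix V assume "V \<in> pre a ` D (cd a) x"
      then obtain U where V: "V = pre a U" and U: "openin (fst (cd a)) U"
          "rst F (cd a) U x \<in> S (sub_ospace (cd a) U)"
        unfolding D_def by blast
      have m: "rst F (dm a) V (res F a x) \<in> S (sub_ospace (dm a) V)"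
        using subpsh_res[OF S, of "over a U" "rst F (cd a) U x"] U a xs
        by (simp add: rst_res[OF F] V)
      have "rst G (dm a) V (res G a (\<zeta> (cd a) x)) = res G (over a U) (rst G (cd a) U (\<zeta> (cd a) x))"
        using a U \<zeta>s[OF _ x] by (simp add: rst_res[OF Gp] V)
      also have "\<dots> = res G (over a U) (\<eta> (sub_ospace (cd a) U) (rst F (cd a) U x))"
        using \<zeta>r[OF _ x U] a by simp
      also have "\<dots> = \<eta> (sub_ospace (dm a) V) (res F (over a U) (rst F (cd a) U x))"
        using natural_res[OF \<eta>, of "over a U" "rst F (cd a) U x"] a U V by simp
      also have "\<dots> = \<eta> (sub_ospace (dm a) V) (rst F (dm a) V (res F a x))"
        using a U xs by (simp add: rst_res[OF F] V)
      also have "\<dots> = rst G (dm a) V (\<zeta> (dm a) (res F a x))"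
        using \<zeta>r[OF _ ax _ m] a U V by simp
      finally show "rst G (dm a) V (\<zeta> (dm a) (res F a x)) = rst G (dm a) V (res G a (\<zeta> (cd a) x))" ..
    qed (use a \<zeta>s[OF _ x] \<zeta>s[OF _ ax] presheaf_res[OF Gp] in auto)
  qed (rule \<zeta>s)
  moreover have "\<zeta> X x = \<eta> X x" if X: "X \<in> Ob" and x: "x \<in> S X" for X x
  proof -
    have l: "x \<in> loc F S X" using subset_loc[OF S X] x by blast
    have "P X x (\<eta> X x)"
      unfolding P_def D_def using naturalD[OF \<eta> X x] natural_rst[OF \<eta> X _ x] by auto
    then show ?thesis using ex[OF X l] \<zeta>P[OF X l] by blast
  qed
  ultimately show ?thesis using that by blast
qed

section \<open>Extension problems\<close>

text \<open>When \<open>S\<close> is the image of a mono into \<open>F\<close>, this is the left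
  lifting property of that mono against the map from \<open>T\<close> to the terminal object. Stated
  for subpresheaves, it applies before any sheaf closure is taken.\<close>

definition ext :: "'b presheaf \<Rightarrow> (epo \<Rightarrow> 'b set) \<Rightarrow> 'c presheaf \<Rightarrow> bool" where
  "ext F S T \<longleftrightarrow> (\<forall>\<eta>. natural F S T \<eta> \<longrightarrow>
     (\<exists>\<zeta>. natural F (sec F) T \<zeta> \<and> (\<forall>X\<in>Ob. \<forall>x\<in>S X. \<zeta> X x = \<eta> X x)))"

lemma extI:
  assumes "\<And>\<eta>. natural F S T \<eta> \<Longrightarrow> \<exists>\<zeta>. natural F (sec F) T \<zeta> \<and> (\<forall>X\<in>Ob. \<forall>x\<in>S X. \<zeta> X x = \<eta> X x)"
  shows "ext F S T"
  using assms unfolding ext_def by blast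

lemma extD:
  assumes "ext F S T" "natural F S T \<eta>"
  obtains \<zeta> where "natural F (sec F) T \<zeta>" "\<forall>X\<in>Ob. \<forall>x\<in>S X. \<zeta> X x = \<eta> X x"
  using assms unfolding ext_def by blast


text \<open>Extend the restriction to \<open>S\<close>; the result agrees with the given map on all
  of \<open>S'\<close> since sections of \<open>T\<close> are determined locally.\<close>

lemma ext_to_loc:
  assumes "presheaf F" "sheaf T" "ext F S T" "subpsh F S'"
    "\<And>X. X \<in> Ob \<Longrightarrow> S X \<subseteq> S' X" "\<And>X. X \<in> Ob \<Longrightarrow> S' X \<subseteq> loc F S X"
  shows "ext F S' T"
proof (rule extI)
  fix \<eta> assume e: "natural F S' T \<eta>"
  then have "natural F S T \<eta>" by (rule natural_subset) (rule assms(5))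
  then obtain \<zeta> where z: "natural F (sec F) T \<zeta>" "\<forall>X\<in>Ob. \<forall>x\<in>S X. \<zeta> X x = \<eta> X x"
    by (rule extD[OF assms(3)])
  have "natural F S' T \<zeta>" using z(1) by (rule natural_subset) (use subpshD[OF assms(4)] in blast)
  then have "\<zeta> X x = \<eta> X x" if "X \<in> Ob" "x \<in> S' X" for X x
    using natural_eq_loc[OF assms(1,2) _ e z(2)[rule_format] that] assms(6) that by blast
  then show "\<exists>\<zeta>. natural F (sec F) T \<zeta> \<and> (\<forall>X\<in>Ob. \<forall>x\<in>S' X. \<zeta> X x = \<eta> X x)"
    using z(1) by blast
qed

text \<open>The datum travels to \<open>S\<close> along \<open>r\<close>, is extended over
  \<open>F\<close>, and returns to \<open>G\<close> along \<open>i\<close>.\<close>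

lemma ext_retract:
  assumes "ext F S T" "natural G (sec G) F i" "natural F S G r"
    "\<And>X x. X \<in> Ob \<Longrightarrow> x \<in> S' X \<Longrightarrow> i X x \<in> S X" "\<And>X x. X \<in> Ob \<Longrightarrow> x \<in> S X \<Longrightarrow> r X x \<in> S' X"
    "\<And>X x. X \<in> Ob \<Longrightarrow> x \<in> S' X \<Longrightarrow> r X (i X x) = x"
  shows "ext G S' T"
proof (rule extI)
  fix \<eta> assume e: "natural G S' T \<eta>"
  have "natural F S T (\<lambda>X x. \<eta> X (r X x))"
    using assms(3) e assms(5) by (rule natural_comp)
  then obtain \<zeta> where z: "natural F (sec F) T \<zeta>" "\<forall>X\<in>Ob. \<forall>x\<in>S X. \<zeta> X x = \<eta> X (r X x)"
    by (rule extD[OF assms(1)])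
  have "natural G (sec G) T (\<lambda>X x. \<zeta> X (i X x))"
    using assms(2) z(1) naturalD[OF assms(2)] by (rule natural_comp)
  moreover have "\<forall>X\<in>Ob. \<forall>x\<in>S' X. \<zeta> X (i X x) = \<eta> X x"
    using z(2) assms(4,6) by simp
  ultimately show "\<exists>\<zeta>. natural G (sec G) T \<zeta> \<and> (\<forall>X\<in>Ob. \<forall>x\<in>S' X. \<zeta> X x = \<eta> X x)" by blast
qed

declare split_paired_All [simp del] split_paired_Ex [simp del]

section \<open>Constructions of sheaves\<close>

text \<open>A matching family in \<open>S\<close> glues in \<open>F\<close>, and the cover itself
  witnesses that the glued section lies in the closure of \<open>S\<close>.\<close>

lemma sheaf_subsheaf:
  assumes F: "sheaf F" and S: "subpsh F S" and l: "\<And>X. X \<in> Ob \<Longrightarrow> loc F S X \<subseteq> S X"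
  shows "sheaf (F\<lparr>sec := S\<rparr>)"
proof (rule sheafI)
  have p: "presheaf F" using F by (rule sheaf_presheaf)
  show "presheaf (F\<lparr>sec := S\<rparr>)"
    using subpsh_res[OF S] subpshD[OF S] p
    by (intro presheafI) (simp_all add: presheaf_cmp)
next
  fix X \<C> x y
  assume h: "X \<in> Ob" "open_dicover X \<C>" "x \<in> sec (F\<lparr>sec := S\<rparr>) X" "y \<in> sec (F\<lparr>sec := S\<rparr>) X"
    and e: "\<And>U. U \<in> \<C> \<Longrightarrow> rst (F\<lparr>sec := S\<rparr>) X U x = rst (F\<lparr>sec := S\<rparr>) X U y"
  show "x = y"
    by (rule separated[OF F h(1,2)]) (use h subpshD[OF S] e in auto)
next
  fix X \<C> s
  assume X: "X \<in> Ob" and C: "open_dicover X \<C>" and m: "matching (F\<lparr>sec := S\<rparr>) X \<C> s"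
  have sU: "s U \<in> S (sub_ospace X U)" "s U \<in> sec F (sub_ospace X U)" if "U \<in> \<C>" for U
    using m that subpshD[OF S sub_Ob[OF X cover_open[OF C that]]] by auto
  have "matching F X \<C> s" using m sU by simp
  then obtain x where x: "x \<in> sec F X" "\<forall>U\<in>\<C>. rst F X U x = s U"
    using sheaf_glue[OF F X C] by blast
  then have "x \<in> loc F S X" unfolding loc_def using C sU by auto
  then show "\<exists>x\<in>sec (F\<lparr>sec := S\<rparr>) X. \<forall>U\<in>\<C>. rst (F\<lparr>sec := S\<rparr>) X U x = s U"
    using l[OF X] x by auto
qed

definition pair :: "'b presheaf \<Rightarrow> 'c presheaf \<Rightarrow> ('b \<times> 'c) presheaf" where
  "pair F G = \<lparr>sec = \<lambda>X. sec F X \<times> sec G X, res = \<lambda>a z. (res F a (fst z), res G a (snd z))\<rparr>"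

lemma sec_pair [simp]: "sec (pair F G) X = sec F X \<times> sec G X"
  and res_pair [simp]: "res (pair F G) a (x, y) = (res F a x, res G a y)"
  by (simp_all add: pair_def)

lemma mem_pair_secE: "z \<in> sec (pair F G) X \<Longrightarrow> (\<And>x y. z = (x, y) \<Longrightarrow> x \<in> sec F X \<Longrightarrow> y \<in> sec G X \<Longrightarrow> P) \<Longrightarrow> P"
  by auto

lemma presheaf_pair [simp]:
  assumes "presheaf F" "presheaf G"
  shows "presheaf (pair F G)"
  by (rule presheafI; elim mem_pair_secE) (simp_all add: assms presheaf_cmp)

lemma sheaf_pair:
  assumes F: "sheaf F" and G: "sheaf G"
  shows "sheaf (pair F G)"
proof (rule sheafI)
  show "presheaf (pair F G)" using F G by (simp add: sheaf_presheaf)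
next
  fix X \<C> x y
  assume h: "X \<in> Ob" "open_dicover X \<C>" and xy: "x \<in> sec (pair F G) X" "y \<in> sec (pair F G) X"
    and e: "\<And>U. U \<in> \<C> \<Longrightarrow> rst (pair F G) X U x = rst (pair F G) X U y"
  obtain x1 x2 where x: "x = (x1, x2)" by (cases x)
  obtain y1 y2 where y: "y = (y1, y2)" by (cases y)
  have "x1 = y1" by (rule separated[OF F h]) (use xy e in \<open>auto simp: x y\<close>)
  moreover have "x2 = y2" by (rule separated[OF G h]) (use xy e in \<open>auto simp: x y\<close>)
  ultimately show "x = y" by (simp add: x y)
next
  fix X \<C> s
  assume X: "X \<in> Ob" and C: "open_dicover X \<C>" and m: "matching (pair F G) X \<C> s"
  have "matching F X \<C> (\<lambda>U. fst (s U))" using m by (auto simp: pair_def)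
  from ex1_implies_ex[OF sheaf_glue[OF F X C this]]
  obtain x where x: "x \<in> sec F X" "\<forall>U\<in>\<C>. rst F X U x = fst (s U)" by blast
  have "matching G X \<C> (\<lambda>U. snd (s U))" using m by (auto simp: pair_def)
  from ex1_implies_ex[OF sheaf_glue[OF G X C this]]
  obtain y where y: "y \<in> sec G X" "\<forall>U\<in>\<C>. rst G X U y = snd (s U)" by blast
  show "\<exists>x\<in>sec (pair F G) X. \<forall>U\<in>\<C>. rst (pair F G) X U x = s U"
    using x y by (intro bexI[of _ "(x, y)"]) simp_all
qed

section \<open>Transport of presheaves along encodings\<close>

definition pres_enc :: "('b \<Rightarrow> 'c) \<Rightarrow> ('c \<Rightarrow> 'b) \<Rightarrow> 'b presheaf \<Rightarrow> 'c presheaf" where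
  "pres_enc e d F = \<lparr>sec = \<lambda>X. e ` sec F X, res = \<lambda>a v. e (res F a (d v))\<rparr>"

lemma sec_enc [simp]: "sec (pres_enc e d F) X = e ` sec F X"
  and res_enc [simp]: "res (pres_enc e d F) a v = e (res F a (d v))"
  by (simp_all add: pres_enc_def)

text \<open>Inverse on sections only: the encoding of an exponential is injective just on functions
  with values in a fixed set of the universe.\<close>

definition decodes :: "('b \<Rightarrow> 'c) \<Rightarrow> ('c \<Rightarrow> 'b) \<Rightarrow> 'b presheaf \<Rightarrow> bool" where
  "decodes e d F \<longleftrightarrow> (\<forall>X\<in>Ob. \<forall>x\<in>sec F X. d (e x) = x)"

lemma decodesD [simp]: "decodes e d F \<Longrightarrow> X \<in> Ob \<Longrightarrow> x \<in> sec F X \<Longrightarrow> d (e x) = x"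
  by (simp add: decodes_def)

lemma decodes_inv: "inj e \<Longrightarrow> decodes e (inv e) F"
  by (simp add: decodes_def)

lemma mem_encE: "v \<in> sec (pres_enc e d F) X \<Longrightarrow> (\<And>x. v = e x \<Longrightarrow> x \<in> sec F X \<Longrightarrow> P) \<Longrightarrow> P"
  by auto

lemma presheaf_enc:
  assumes "presheaf F" "decodes e d F"
  shows "presheaf (pres_enc e d F)"
proof (rule presheafI; elim mem_encE)
  note de = decodesD[OF assms(2)]
  fix a v x assume "a \<in> Ar" "v = e x" "x \<in> sec F (cd a)"
  then show "res (pres_enc e d F) a v \<in> sec (pres_enc e d F) (dm a)"
    using de[of "cd a" x] assms(1) by simp
next
  note de = decodesD[OF assms(2)]
  fix a b v x assume h: "a \<in> Ar" "b \<in> Ar" "cd a = dm b" "v = e x" "x \<in> sec F (cd b)"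
  show "res (pres_enc e d F) (b \<odot> a) v = res (pres_enc e d F) a (res (pres_enc e d F) b v)"
    using de[of "cd b" x] de[of "dm b" "res F b x"] presheaf_cmp[OF assms(1) h(1-3,5)] h assms(1) by simp
next
  note de = decodesD[OF assms(2)]
  fix X v x assume "X \<in> Ob" "v = e x" "x \<in> sec F X"
  then show "res (pres_enc e d F) (idm X) v = v" using de[of X x] assms(1) by simp
qed

lemma sheaf_enc:
  assumes F: "sheaf F" and ed: "decodes e d F"
  shows "sheaf (pres_enc e d F)"
proof (rule sheafI)
  have p: "presheaf F" using F by (rule sheaf_presheaf)
  note de = decodesD[OF ed]
  show "presheaf (pres_enc e d F)" using p ed by (rule presheaf_enc)
  {
    fix X \<C> x y
    assume h: "X \<in> Ob" "open_dicover X \<C>" and xy: "x \<in> sec (pres_enc e d F) X" "y \<in> sec (pres_enc e d F) X"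
      and eq: "\<And>U. U \<in> \<C> \<Longrightarrow> rst (pres_enc e d F) X U x = rst (pres_enc e d F) X U y"
    obtain x1 y1 where x: "x = e x1" "x1 \<in> sec F X" and y: "y = e y1" "y1 \<in> sec F X"
      using xy by auto
    have "x1 = y1"
    proof (rule separated[OF F h x(2) y(2)])
      fix U assume U: "U \<in> \<C>"
      have o: "openin (fst X) U" using h(2) U by (rule cover_open)
      have "e (rst F X U x1) = e (rst F X U y1)" using eq[OF U] x y h(1) by (simp add: de)
      then have "d (e (rst F X U x1)) = d (e (rst F X U y1))" by simp
      then show "rst F X U x1 = rst F X U y1"
        using p o h(1) x y de[OF sub_Ob[OF h(1) o]] by simp
    qed
    then show "x = y" by (simp add: x y)
  next
    fix X \<C> s
    assume X: "X \<in> Ob" and C: "open_dicover X \<C>" and m: "matching (pres_enc e d F) X \<C> s"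
    have sU: "d (s U) \<in> sec F (sub_ospace X U)" "e (d (s U)) = s U" if U: "U \<in> \<C>" for U
    proof -
      obtain t where "s U = e t" "t \<in> sec F (sub_ospace X U)" using m U by auto
      then show "d (s U) \<in> sec F (sub_ospace X U)" "e (d (s U)) = s U"
        using de[OF sub_Ob[OF X cover_open[OF C U]]] by simp_all
    qed
    have "matching F X \<C> (\<lambda>U. d (s U))"
    proof (intro conjI ballI)
      fix U V assume UV: "U \<in> \<C>" "V \<in> \<C>"
      have o: "openin (fst X) U" "openin (fst X) V" "openin (fst X) (U \<inter> V)"
        using cover_open[OF C UV(1)] cover_open[OF C UV(2)] by (simp_all add: openin_Int)
      have "e (res F (inclusion (sub_ospace X (U \<inter> V)) (sub_ospace X U)) (d (s U))) =
            e (res F (inclusion (sub_ospace X (U \<inter> V)) (sub_ospace X V)) (d (s V)))"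
        using m[THEN conjunct2, rule_format, OF UV] by simp
      then have "d (e (res F (inclusion (sub_ospace X (U \<inter> V)) (sub_ospace X U)) (d (s U)))) =
            d (e (res F (inclusion (sub_ospace X (U \<inter> V)) (sub_ospace X V)) (d (s V))))"
        by simp
      moreover have "res F (inclusion (sub_ospace X (U \<inter> V)) (sub_ospace X W)) (d (s W)) \<in> sec F (sub_ospace X (U \<inter> V))"
        if "W \<in> \<C>" "U \<inter> V \<subseteq> W" for W
        using presheaf_res[OF p, of "inclusion (sub_ospace X (U \<inter> V)) (sub_ospace X W)" "d (s W)"]
          that o X sU(1) cover_open[OF C] by simp
      ultimately show "res F (inclusion (sub_ospace X (U \<inter> V)) (sub_ospace X U)) (d (s U)) =
            res F (inclusion (sub_ospace X (U \<inter> V)) (sub_ospace X V)) (d (s V))"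
        using de[OF sub_Ob[OF X o(3)]] UV by simp
    qed (rule sU)
    from ex1_implies_ex[OF sheaf_glue[OF F X C this]]
    obtain x where x: "x \<in> sec F X" "\<forall>U\<in>\<C>. rst F X U x = d (s U)" by blast
    show "\<exists>x\<in>sec (pres_enc e d F) X. \<forall>U\<in>\<C>. rst (pres_enc e d F) X U x = s U"
      using x sU X by (intro bexI[of _ "e x"]) (simp_all add: de)
  }
qed

subsection \<open>Local dimaps\<close>

text \<open>The restriction maps do not mention \<open>\<Delta>\<close>, so
  \<open>fn Delta_d\<close> is a subsheaf of \<open>fn Delta_D\<close> and maps on the latter
  restrict without change.\<close>

definition fn :: "real ospace \<Rightarrow> ((nat \<Rightarrow> real) \<Rightarrow> real) presheaf" where
  "fn \<Delta> = \<lparr>sec = \<lambda>X. local_dimaps X \<Delta>, res = \<lambda>a k. compose (carrier (dm a)) k (fst (snd a))\<rparr>"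

lemma sec_fn [simp]: "sec (fn \<Delta>) X = local_dimaps X \<Delta>"
  by (simp add: fn_def)

lemma res_fn: "res (fn \<Delta>) a k = compose (carrier (dm a)) k (fst (snd a))"
  by (simp add: fn_def)

lemma local_dimapsI:
  assumes "f \<in> extensional (carrier X)" "open_dicover X \<C>" "\<And>U. U \<in> \<C> \<Longrightarrow> dimap (sub_ospace X U) \<Delta> f"
  shows "f \<in> local_dimaps X \<Delta>"
  using assms unfolding local_dimaps_def by blast

lemma local_dimapsE:
  assumes "f \<in> local_dimaps X \<Delta>"
  obtains \<C> where "open_dicover X \<C>" "\<And>U. U \<in> \<C> \<Longrightarrow> dimap (sub_ospace X U) \<Delta> f"
  using assms unfolding local_dimaps_def by blast

lemma local_dimaps_ext: "f \<in> local_dimaps X \<Delta> \<Longrightarrow> f \<in> extensional (carrier X)"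
  by (simp add: local_dimaps_def)

lemma res_fn_sec:
  assumes a: "a \<in> Ar" and k: "k \<in> local_dimaps (cd a) \<Delta>"
  shows "res (fn \<Delta>) a k \<in> local_dimaps (dm a) \<Delta>"
proof -
  obtain X f Y where af: "a = (X, f, Y)" by (rule prod_cases3)
  obtain \<C> where C: "open_dicover (cd a) \<C>" "\<And>U. U \<in> \<C> \<Longrightarrow> dimap (sub_ospace (cd a) U) \<Delta> k"
    using k by (rule local_dimapsE) blast
  show ?thesis
  proof (rule local_dimapsI[OF _ pre_cover[OF a C(1)]])
    fix V assume "V \<in> pre a ` \<C>"
    then obtain U where U: "U \<in> \<C>" "V = pre a U" by blast
    have o: "openin (fst Y) U" "openin (fst X) V"
      using cover_open[OF C(1) U(1)] a U(2) pre_open[OF a] by (auto simp: af)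
    have "dimap (sub_ospace X V) (sub_ospace Y U) f"
      by (rule dimap_sub[OF o(2,1)]) (use a U(2) in \<open>auto simp: af Ar_iff pre_def\<close>)
    moreover have "dimap (sub_ospace Y U) \<Delta> k" using C(2)[OF U(1)] by (simp add: af)
    ultimately have d: "dimap (sub_ospace X V) \<Delta> (k \<circ> f)" by (rule dimap_comp)
    have X: "X \<in> Ob" using a by (simp add: af Ar_iff)
    have "dimap (sub_ospace X V) \<Delta> (res (fn \<Delta>) a k) \<longleftrightarrow> dimap (sub_ospace X V) \<Delta> (k \<circ> f)"
      by (rule dimap_cong[OF _ Ob_order[OF sub_Ob[OF X o(2)]]])
        (use o(2) U(2) in \<open>auto simp: res_fn af compose_def carrier_sub pre_def\<close>)
    then show "dimap (sub_ospace (dm a) V) \<Delta> (res (fn \<Delta>) a k)" using d by (simp add: af)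
  qed (simp add: res_fn)
qed

lemma rst_fn: "openin (fst X) U \<Longrightarrow> rst (fn \<Delta>) X U k = restrict k U"
  by (auto simp: res_fn inclusion_def compose_def carrier_sub fun_eq_iff)

lemma inclusion_fn: "openin (fst X) V \<Longrightarrow>
    res (fn \<Delta>) (inclusion (sub_ospace X V) (sub_ospace X U)) k = restrict k V"
  by (auto simp: res_fn inclusion_def compose_def carrier_sub fun_eq_iff)

lemma presheaf_fn [simp]: "presheaf (fn \<Delta>)"
proof (rule presheafI)
  fix a k assume "a \<in> Ar" "k \<in> sec (fn \<Delta>) (cd a)"
  then show "res (fn \<Delta>) a k \<in> sec (fn \<Delta>) (dm a)" by (simp add: res_fn_sec)
next
  fix X k assume "X \<in> Ob" "k \<in> sec (fn \<Delta>) X"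
  then show "res (fn \<Delta>) (idm X) k = k"
    using local_dimaps_ext[of k X \<Delta>]
    by (auto simp: res_fn idm_eq compose_def fun_eq_iff extensional_def)
next
  fix a b k assume "a \<in> Ar" "b \<in> Ar" "cd a = dm b"
  then show "res (fn \<Delta>) (b \<odot> a) k = res (fn \<Delta>) a (res (fn \<Delta>) b k)"
    by (cases a; cases b) (auto simp: res_fn cmp_eq compose_def fun_eq_iff Ar_iff dest: dimap_carrier)
qed

text \<open>Monotonicity is demanded only on the members of some cover, and the covers witnessing it
  for the pieces combine to one witnessing it for the glued function.\<close>

lemma sheaf_fn: "sheaf (fn \<Delta>)"
proof (rule sheafI)
  fix X \<C> x y
  assume h: "X \<in> Ob" "open_dicover X \<C>" and xy: "x \<in> sec (fn \<Delta>) X" "y \<in> sec (fn \<Delta>) X"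
    and e: "\<And>U. U \<in> \<C> \<Longrightarrow> rst (fn \<Delta>) X U x = rst (fn \<Delta>) X U y"
  show "x = y"
  proof
    fix p
    show "x p = y p"
    proof (cases "p \<in> carrier X")
      case True
      then obtain U where U: "U \<in> \<C>" "p \<in> U" using h(2) unfolding open_dicover_def by blast
      have "restrict x U = restrict y U"
        using e[OF U(1)] cover_open[OF h(2) U(1)] by (simp add: rst_fn)
      then show ?thesis using U(2) by (metis restrict_apply')
    next
      case False
      then show ?thesis using xy local_dimaps_ext by (metis sec_fn extensional_arb)
    qed
  qed
next
  fix X \<C> s
  assume X: "X \<in> Ob" and C: "open_dicover X \<C>" and m: "matching (fn \<Delta>) X \<C> s"
  have s: "s U \<in> local_dimaps (sub_ospace X U) \<Delta>" if "U \<in> \<C>" for U using m that by simp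
  have agree: "s U p = s V p" if UV: "U \<in> \<C>" "V \<in> \<C>" "p \<in> U" "p \<in> V" for U V p
  proof -
    have "openin (fst X) (U \<inter> V)" using cover_open[OF C] UV by (simp add: openin_Int)
    then have "restrict (s U) (U \<inter> V) = restrict (s V) (U \<inter> V)"
      using m[THEN conjunct2, rule_format, OF UV(1,2)] by (simp add: inclusion_fn)
    then have "restrict (s U) (U \<inter> V) p = restrict (s V) (U \<inter> V) p" by simp
    then show ?thesis using UV by simp
  qed
  \<comment> \<open>The member of the cover used at \<open>p\<close> is arbitrary;
    \<open>agree\<close> makes the value independent of it.\<close>
  define f where "f = (\<lambda>p\<in>carrier X. s (SOME U. U \<in> \<C> \<and> p \<in> U) p)"
  have fU: "f p = s U p" if U: "U \<in> \<C>" "p \<in> U" for U p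
  proof -
    have "p \<in> carrier X" using C U unfolding open_dicover_def by blast
    moreover have "s (SOME U. U \<in> \<C> \<and> p \<in> U) p = s U p"
      using someI[of "\<lambda>U. U \<in> \<C> \<and> p \<in> U" U] U agree by blast
    ultimately show ?thesis by (simp add: f_def)
  qed
  have "\<forall>U\<in>\<C>. \<exists>D. open_dicover (sub_ospace X U) D \<and>
     (\<forall>V\<in>D. dimap (sub_ospace (sub_ospace X U) V) \<Delta> (s U))"
    using s unfolding local_dimaps_def by blast
  then obtain \<D> where D: "\<And>U. U \<in> \<C> \<Longrightarrow> open_dicover (sub_ospace X U) (\<D> U)"
     "\<And>U V. U \<in> \<C> \<Longrightarrow> V \<in> \<D> U \<Longrightarrow> dimap (sub_ospace (sub_ospace X U) V) \<Delta> (s U)"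
    by metis
  have "f \<in> local_dimaps X \<Delta>"
  proof (rule local_dimapsI[OF _ cover_refine(1)[OF C D(1)]])
    show "f \<in> extensional (carrier X)" by (simp add: f_def)
    fix V assume "V \<in> \<Union>(\<D> ` \<C>)"
    then obtain U where U: "U \<in> \<C>" "V \<in> \<D> U" by blast
    have V: "V \<subseteq> U" "openin (fst X) V" using cover_refine(2)[OF C D(1)] U by auto
    have "dimap (sub_ospace X V) \<Delta> f \<longleftrightarrow> dimap (sub_ospace X V) \<Delta> (s U)"
      by (rule dimap_cong[OF _ Ob_order[OF sub_Ob[OF X V(2)]]]) (use V U(1) fU in \<open>auto simp: carrier_sub\<close>)
    then show "dimap (sub_ospace X V) \<Delta> f" using D(2)[OF U] V by (simp add: sub_sub)
  qed
  moreover have "rst (fn \<Delta>) X U f = s U" if U: "U \<in> \<C>" for U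
  proof
    fix p
    show "rst (fn \<Delta>) X U f p = s U p"
      using fU[OF U] local_dimaps_ext[OF s[OF U]] cover_open[OF C U]
      by (auto simp: rst_fn restrict_def carrier_sub extensional_def)
  qed
  ultimately show "\<exists>x\<in>sec (fn \<Delta>) X. \<forall>U\<in>\<C>. rst (fn \<Delta>) X U x = s U" by auto
qed simp

subsection \<open>Exponentials\<close>

definition valid :: "real ospace \<Rightarrow> epo \<Rightarrow> epo_map \<Rightarrow> ((nat \<Rightarrow> real) \<Rightarrow> real) \<Rightarrow> bool" where
  "valid \<Delta> X a k \<longleftrightarrow> a \<in> Ar \<and> cd a = X \<and> k \<in> local_dimaps (dm a) \<Delta>"

text \<open>A section over \<open>X\<close> is a natural map to \<open>T\<close> from the product of the functor represented by \<open>X\<close>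
  with the presheaf of local dimaps, flattened to a single function.\<close>

definition expo :: "real ospace \<Rightarrow> 'b presheaf \<Rightarrow> (epo_map \<times> ((nat \<Rightarrow> real) \<Rightarrow> real) \<Rightarrow> 'b) presheaf" where
  "expo \<Delta> T = \<lparr>
     sec = (\<lambda>X. {\<psi>. (\<forall>a k. if valid \<Delta> X a k then \<psi> (a, k) \<in> sec T (dm a) else \<psi> (a, k) = undefined) \<and>
       (\<forall>a b k. valid \<Delta> X a k \<longrightarrow> b \<in> Ar \<longrightarrow> cd b = dm a \<longrightarrow>
          \<psi> (a \<odot> b, res (fn \<Delta>) b k) = res T b (\<psi> (a, k)))}),
     res = (\<lambda>c \<psi> (a, k). if valid \<Delta> (dm c) a k then \<psi> (c \<odot> a, k) else undefined)\<rparr>"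

lemma res_expo: "res (expo \<Delta> T) c \<psi> (a, k) = (if valid \<Delta> (dm c) a k then \<psi> (c \<odot> a, k) else undefined)"
  by (simp add: expo_def)

lemma sec_expoI:
  assumes "\<And>a k. valid \<Delta> X a k \<Longrightarrow> \<psi> (a, k) \<in> sec T (dm a)"
    "\<And>a k. \<not> valid \<Delta> X a k \<Longrightarrow> \<psi> (a, k) = undefined"
    "\<And>a b k. valid \<Delta> X a k \<Longrightarrow> b \<in> Ar \<Longrightarrow> cd b = dm a \<Longrightarrow>
       \<psi> (a \<odot> b, res (fn \<Delta>) b k) = res T b (\<psi> (a, k))"
  shows "\<psi> \<in> sec (expo \<Delta> T) X"
  unfolding expo_def using assms by auto

lemma expoD:
  assumes "\<psi> \<in> sec (expo \<Delta> T) X"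
  shows "if valid \<Delta> X a k then \<psi> (a, k) \<in> sec T (dm a) else \<psi> (a, k) = undefined"
    and "valid \<Delta> X a k \<longrightarrow> b \<in> Ar \<longrightarrow> cd b = dm a \<longrightarrow> \<psi> (a \<odot> b, res (fn \<Delta>) b k) = res T b (\<psi> (a, k))"
  using assms unfolding expo_def by simp_all

lemma expo_sec: "\<psi> \<in> sec (expo \<Delta> T) X \<Longrightarrow> valid \<Delta> X a k \<Longrightarrow> \<psi> (a, k) \<in> sec T (dm a)"
  and expo_undefined: "\<psi> \<in> sec (expo \<Delta> T) X \<Longrightarrow> \<not> valid \<Delta> X a k \<Longrightarrow> \<psi> (a, k) = undefined"
  and expo_res: "\<psi> \<in> sec (expo \<Delta> T) X \<Longrightarrow> valid \<Delta> X a k \<Longrightarrow> b \<in> Ar \<Longrightarrow> cd b = dm a \<Longrightarrow>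
    \<psi> (a \<odot> b, res (fn \<Delta>) b k) = res T b (\<psi> (a, k))"
  using expoD by (metis+)

lemma valid_cmp: "valid \<Delta> (dm c) a k \<Longrightarrow> c \<in> Ar \<Longrightarrow> valid \<Delta> (cd c) (c \<odot> a) k"
  unfolding valid_def by simp

lemma valid_res: "valid \<Delta> X a k \<Longrightarrow> b \<in> Ar \<Longrightarrow> cd b = dm a \<Longrightarrow> valid \<Delta> X (a \<odot> b) (res (fn \<Delta>) b k)"
  unfolding valid_def using res_fn_sec[of b k \<Delta>] by simp

lemma valid_idm: "X \<in> Ob \<Longrightarrow> k \<in> local_dimaps X \<Delta> \<Longrightarrow> valid \<Delta> X (idm X) k"
  unfolding valid_def by simp

lemma presheaf_expo: "presheaf (expo \<Delta> T)"
proof (rule presheafI)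
  fix c \<psi> assume c: "c \<in> Ar" and \<psi>: "\<psi> \<in> sec (expo \<Delta> T) (cd c)"
  show "res (expo \<Delta> T) c \<psi> \<in> sec (expo \<Delta> T) (dm c)"
  proof (rule sec_expoI)
    fix a k assume v: "valid \<Delta> (dm c) a k"
    then show "res (expo \<Delta> T) c \<psi> (a, k) \<in> sec T (dm a)"
      using expo_sec[OF \<psi> valid_cmp[OF v c]] c by (simp add: res_expo valid_def)
    fix b assume b: "b \<in> Ar" "cd b = dm a"
    have a: "a \<in> Ar" "cd a = dm c" using v by (simp_all add: valid_def)
    show "res (expo \<Delta> T) c \<psi> (a \<odot> b, res (fn \<Delta>) b k) = res T b (res (expo \<Delta> T) c \<psi> (a, k))"
      using expo_res[OF \<psi> valid_cmp[OF v c] b(1)] b c a v valid_res[OF v b]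
      by (simp add: res_expo cmp_assoc)
  qed (simp add: res_expo)
next
  fix X \<psi> assume X: "X \<in> Ob" and \<psi>: "\<psi> \<in> sec (expo \<Delta> T) X"
  show "res (expo \<Delta> T) (idm X) \<psi> = \<psi>"
  proof (rule ext, clarify)
    fix a k
    show "res (expo \<Delta> T) (idm X) \<psi> (a, k) = \<psi> (a, k)"
      using X expo_undefined[OF \<psi>] by (simp add: res_expo) (simp add: valid_def)
  qed
next
  fix c c' \<psi>
  assume c: "c \<in> Ar" "c' \<in> Ar" "cd c = dm c'"
  show "res (expo \<Delta> T) (c' \<odot> c) \<psi> = res (expo \<Delta> T) c (res (expo \<Delta> T) c' \<psi>)"
  proof (rule ext, clarify)
    fix a k
    show "res (expo \<Delta> T) (c' \<odot> c) \<psi> (a, k) = res (expo \<Delta> T) c (res (expo \<Delta> T) c' \<psi>) (a, k)"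
      using c valid_cmp[of \<Delta> c a k] by (auto simp: res_expo cmp_assoc valid_def)
  qed
qed

definition yo :: "epo \<Rightarrow> epo_map presheaf" where
  "yo X = \<lparr>sec = \<lambda>Y. {a \<in> Ar. dm a = Y \<and> cd a = X}, res = \<lambda>b a. a \<odot> b\<rparr>"

lemma sec_yo [simp]: "sec (yo X) Y = {a \<in> Ar. dm a = Y \<and> cd a = X}"
  and res_yo [simp]: "res (yo X) b a = a \<odot> b"
  by (simp_all add: yo_def)

lemma presheaf_yo [simp]: "presheaf (yo X)"
  by (rule presheafI) (auto simp: cmp_assoc)

text \<open>Maps into \<open>X\<close> that factor through a member of the cover, paired with local
  dimaps, form a subpresheaf of a product with the representable functor. A matching family is a
  natural map on it, and its closure contains every valid pair; extension to the closure then
  performs the glueing.\<close>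

lemma sheaf_expo:
  assumes T: "sheaf T"
  shows "sheaf (expo \<Delta> T)"
proof (rule sheafI)
  show "presheaf (expo \<Delta> T)" by (rule presheaf_expo)
next
  fix X \<C> \<psi> \<phi>
  assume X: "X \<in> Ob" and C: "open_dicover X \<C>"
    and \<psi>: "\<psi> \<in> sec (expo \<Delta> T) X" and \<phi>: "\<phi> \<in> sec (expo \<Delta> T) X"
    and e: "\<And>U. U \<in> \<C> \<Longrightarrow> rst (expo \<Delta> T) X U \<psi> = rst (expo \<Delta> T) X U \<phi>"
  show "\<psi> = \<phi>"
  proof (rule ext, clarify)
    fix a k
    show "\<psi> (a, k) = \<phi> (a, k)"
    proof (cases "valid \<Delta> X a k")
      case v: True
      then have a: "a \<in> Ar" "cd a = X" and k: "k \<in> local_dimaps (dm a) \<Delta>" by (simp_all add: valid_def)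
      show ?thesis
      proof (rule separated[OF T _ pre_cover[OF a(1)] expo_sec[OF \<psi> v] expo_sec[OF \<phi> v]])
        show "open_dicover (cd a) \<C>" using C a by simp
        fix V assume "V \<in> pre a ` \<C>"
        then obtain U where U: "U \<in> \<C>" "V = pre a U" by blast
        have o: "openin (fst X) U" using cover_open[OF C U(1)] .
        let ?i = "incl (dm a) V"
        have i: "?i \<in> Ar" "cd ?i = dm a" using a o U(2) by simp_all
        \<comment> \<open>Restricting a value of \<open>\<theta>\<close> to the preimage of
          \<open>U\<close> amounts to evaluating the restriction of \<open>\<theta>\<close> at the
          base change of \<open>a\<close>.\<close>
        have *: "rst T (dm a) V (\<theta> (a, k)) = rst (expo \<Delta> T) X U \<theta> (over a U, res (fn \<Delta>) ?i k)"
          if "\<theta> \<in> sec (expo \<Delta> T) X" for \<theta>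
        proof -
          have "valid \<Delta> (sub_ospace X U) (over a U) (res (fn \<Delta>) ?i k)"
            unfolding valid_def using res_fn_sec[OF i(1), of k] k a o U(2) by simp
          moreover have "incl X U \<odot> over a U = a \<odot> ?i" using over_simps(4)[of a U] a o U(2) by simp
          ultimately show ?thesis using expo_res[OF that v i] by (simp add: res_expo)
        qed
        show "rst T (dm a) V (\<psi> (a, k)) = rst T (dm a) V (\<phi> (a, k))"
          using *[OF \<psi>] *[OF \<phi>] e[OF U(1)] by simp
      qed (use a in simp)
    qed (simp add: expo_undefined[OF \<psi>] expo_undefined[OF \<phi>])
  qed
next
  fix X \<C> s
  assume X: "X \<in> Ob" and C: "open_dicover X \<C>" and m: "matching (expo \<Delta> T) X \<C> s"
  have s: "s U \<in> sec (expo \<Delta> T) (sub_ospace X U)" if "U \<in> \<C>" for U using m that by simp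
  have op: "openin (fst X) U" if "U \<in> \<C>" for U using cover_open[OF C that] .
  let ?P = "pair (yo X) (fn \<Delta>)"
  let ?in = "\<lambda>a U. U \<in> \<C> \<and> pre a U = carrier (dm a)"
  \<comment> \<open>The sieve generated by the cover, times the presheaf of local dimaps.\<close>
  define S where "S Y = {(a, k). a \<in> Ar \<and> dm a = Y \<and> cd a = X \<and> k \<in> local_dimaps Y \<Delta> \<and> (\<exists>U. ?in a U)}" for Y
  \<comment> \<open>A map that factors through both \<open>U\<close> and \<open>V\<close> factors
    through their intersection, where the matching condition compares the two values.\<close>
  have agree: "s U (corestrict a U, k) = s V (corestrict a V, k)"
    if v: "valid \<Delta> X a k" and U: "?in a U" and V: "?in a V" for U V a k
  proof -
    have a: "a \<in> Ar" "cd a = X" using v by (simp_all add: valid_def)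
    let ?W = "U \<inter> V"
    have W: "openin (fst X) ?W" using op U V by (simp add: openin_Int)
    have pW: "pre a ?W = carrier (dm a)" using U V unfolding pre_def by blast
    have vW: "valid \<Delta> (sub_ospace X ?W) (corestrict a ?W) k"
      using v W pW a unfolding valid_def by simp
    have *: "res (expo \<Delta> T) (inclusion (sub_ospace X ?W) (sub_ospace X Z)) (s Z) (corestrict a ?W, k)
      = s Z (corestrict a Z, k)" if "?in a Z" "?W \<subseteq> Z" for Z
      using vW corestrict_corestrict[of a Z ?W] op that a pW W by (simp add: res_expo)
    have "res (expo \<Delta> T) (inclusion (sub_ospace X ?W) (sub_ospace X U)) (s U) =
      res (expo \<Delta> T) (inclusion (sub_ospace X ?W) (sub_ospace X V)) (s V)" using m U V by blast
    then show ?thesis using *[of U] *[of V] U V by simp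
  qed
  define \<eta> where "\<eta> = (\<lambda>Y :: epo. \<lambda>(a, k). let U = (SOME U. ?in a U) in s U (corestrict a U, k))"
  have \<eta>U: "\<eta> Y (a, k) = s U (corestrict a U, k)" if "valid \<Delta> X a k" "?in a U" for Y a k U
  proof -
    have "?in a (SOME U. ?in a U)" using that(2) by (rule someI)
    from agree[OF that(1) this that(2)] show ?thesis by (simp only: \<eta>_def Let_def prod.case)
  qed
  have SE: "\<exists>U. ?in a U \<and> valid \<Delta> X a k \<and> dm a = Y" if "(a, k) \<in> S Y" for a k Y
    using that unfolding S_def valid_def by auto
  have SI: "(a, k) \<in> S (dm a)" if "?in a U" "valid \<Delta> X a k" for a k U
    using that unfolding S_def valid_def by auto
  have vU: "valid \<Delta> (sub_ospace X U) (corestrict a U) k" if "?in a U" "valid \<Delta> X a k" for a k U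
    using that op unfolding valid_def by auto
  have preb: "?in (a \<odot> b) U" if "?in a U" "a \<in> Ar" "b \<in> Ar" "cd b = dm a" for a b U
    using that pre_carrier[of b] by (simp add: pre_cmp)
  have subS: "subpsh ?P S"
    unfolding subpsh_def
  proof (intro conjI ballI)
    fix Y assume "Y \<in> Ob"
    show "S Y \<subseteq> sec ?P Y" unfolding S_def by auto
  next
    fix b z assume b: "b \<in> Ar" and z: "z \<in> S (cd b)"
    obtain a k where ak: "z = (a, k)" by (cases z)
    obtain U where U: "?in a U" "valid \<Delta> X a k" "dm a = cd b" using SE z ak by blast
    have aA: "a \<in> Ar" using U(2) by (simp add: valid_def)
    have ba: "cd b = dm a" using U(3) by simp
    show "res ?P b z \<in> S (dm b)"
      using SI[OF preb[OF U(1) aA b ba] valid_res[OF U(2) b ba]] cmp_Ar(2)[OF b aA ba] by (simp add: ak)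
  qed
  have "natural ?P S T \<eta>"
  proof (rule naturalI)
    fix Y z assume Y: "Y \<in> Ob" and z: "z \<in> S Y"
    obtain a k where ak: "z = (a, k)" by (cases z)
    obtain U where U: "?in a U" "valid \<Delta> X a k" "dm a = Y" using SE z ak by blast
    show "\<eta> Y z \<in> sec T Y"
      using \<eta>U[OF U(2,1)] expo_sec[OF s vU[OF U(1,2)]] U by (simp add: ak)
  next
    fix b z assume b: "b \<in> Ar" and z: "z \<in> S (cd b)"
    obtain a k where ak: "z = (a, k)" by (cases z)
    obtain U where U: "?in a U" "valid \<Delta> X a k" "dm a = cd b" using SE z ak by blast
    have aA: "a \<in> Ar" "cd a = X" using U(2) by (simp_all add: valid_def)
    have ba: "cd b = dm a" using U(3) by simp
    have "\<eta> (dm b) (a \<odot> b, res (fn \<Delta>) b k) = s U (corestrict (a \<odot> b) U, res (fn \<Delta>) b k)"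
      by (rule \<eta>U[OF valid_res[OF U(2) b ba] preb[OF U(1) aA(1) b ba]])
    also have "\<dots> = s U (corestrict a U \<odot> b, res (fn \<Delta>) b k)"
      using corestrict_cmp[OF b aA(1) ba, of U] U(1) op aA(2) by simp
    also have "\<dots> = res T b (s U (corestrict a U, k))"
      using expo_res[OF s vU[OF U(1,2)] b] U(1) ba by simp
    also have "\<dots> = res T b (\<eta> (cd b) (a, k))" using \<eta>U[OF U(2,1)] by simp
    finally show "\<eta> (dm b) (res ?P b z) = res T b (\<eta> (cd b) z)" by (simp add: ak)
  qed
  then obtain \<zeta> where \<zeta>: "natural ?P (loc ?P S) T \<zeta>" "\<forall>Y\<in>Ob. \<forall>z\<in>S Y. \<zeta> Y z = \<eta> Y z"
    by (rule natural_extend_loc[OF presheaf_pair[OF presheaf_yo presheaf_fn] T subS])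
  \<comment> \<open>On the preimage of a member \<open>U\<close> the map \<open>a\<close> factors
    through \<open>U\<close>, and these preimages cover its domain.\<close>
  have locS: "(a, k) \<in> loc ?P S (dm a)" if v: "valid \<Delta> X a k" for a k
  proof -
    have a: "a \<in> Ar" "cd a = X" and k: "k \<in> local_dimaps (dm a) \<Delta>" using v by (simp_all add: valid_def)
    have "rst ?P (dm a) (pre a U) (a, k) \<in> S (sub_ospace (dm a) (pre a U))" if U: "U \<in> \<C>" for U
    proof -
      let ?i = "incl (dm a) (pre a U)"
      have i: "?i \<in> Ar" "cd ?i = dm a" "dm ?i = sub_ospace (dm a) (pre a U)"
        and o: "openin (fst (dm a)) (pre a U)" using a op[OF U] by simp_all
      have "?in (a \<odot> ?i) U" using U a i o by (simp add: pre_cmp pre_incl carrier_sub)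
      then show ?thesis using SI[OF _ valid_res[OF v i(1,2)]] i a by simp
    qed
    moreover have "open_dicover (dm a) (pre a ` \<C>)" using pre_cover[OF a(1)] C a by simp
    ultimately show ?thesis unfolding loc_def using a k by auto
  qed
  define \<psi> where "\<psi> = (\<lambda>(a, k). if valid \<Delta> X a k then \<zeta> (dm a) (a, k) else undefined)"
  have "\<psi> \<in> sec (expo \<Delta> T) X"
  proof (rule sec_expoI)
    fix a k assume v: "valid \<Delta> X a k"
    then have a: "a \<in> Ar" by (simp add: valid_def)
    show "\<psi> (a, k) \<in> sec T (dm a)"
      using naturalD[OF \<zeta>(1) _ locS[OF v]] a v by (simp add: \<psi>_def)
    fix b assume b: "b \<in> Ar" "cd b = dm a"
    show "\<psi> (a \<odot> b, res (fn \<Delta>) b k) = res T b (\<psi> (a, k))"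
      using natural_res[OF \<zeta>(1) b(1), of "(a, k)"] locS[OF v] valid_res[OF v b] v b a by (simp add: \<psi>_def)
  qed (simp add: \<psi>_def)
  moreover have "rst (expo \<Delta> T) X U \<psi> = s U" if U: "U \<in> \<C>" for U
  proof (rule ext, clarify)
    fix b k
    show "rst (expo \<Delta> T) X U \<psi> (b, k) = s U (b, k)"
    proof (cases "valid \<Delta> (sub_ospace X U) b k")
      case v: True
      then have b: "b \<in> Ar" "cd b = sub_ospace X U" by (simp_all add: valid_def)
      have v': "valid \<Delta> X (incl X U \<odot> b) k" using valid_cmp[of \<Delta> "incl X U" b k] v X op[OF U] by simp
      have i: "?in (incl X U \<odot> b) U" using pre_incl_cmp[OF X b(1) op[OF U] b(2)] U b op X by simp
      have d: "dm (incl X U \<odot> b) = dm b" using b X op[OF U] by simp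
      have "rst (expo \<Delta> T) X U \<psi> (b, k) = \<zeta> (dm b) (incl X U \<odot> b, k)"
        using v v' d by (simp add: res_expo \<psi>_def)
      also have "\<dots> = \<eta> (dm b) (incl X U \<odot> b, k)" using \<zeta>(2) SI[OF i v'] d b by simp
      also have "\<dots> = s U (b, k)"
        using \<eta>U[OF v' i] corestrict_incl_cmp[OF X b(1) op[OF U] b(2)] by simp
      finally show ?thesis .
    next
      case False
      then show ?thesis using expo_undefined[OF s[OF U]] by (simp add: res_expo)
    qed
  qed
  ultimately show "\<exists>\<psi>\<in>sec (expo \<Delta> T) X. \<forall>U\<in>\<C>. rst (expo \<Delta> T) X U \<psi> = s U" by blast
qed

section \<open>Pushout products\<close>

text \<open>The sectionwise union of \<open>S \<times> G\<close> and \<open>F \<times> R\<close>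
  inside \<open>F \<times> G\<close>; the pushout product of two monos of sheaves has the closure of
  this as its image.\<close>

definition pp :: "'b presheaf \<Rightarrow> (epo \<Rightarrow> 'b set) \<Rightarrow> 'c presheaf \<Rightarrow> (epo \<Rightarrow> 'c set) \<Rightarrow> epo \<Rightarrow> ('b \<times> 'c) set" where
  "pp F S G R X = {z \<in> sec (pair F G) X. fst z \<in> S X \<or> snd z \<in> R X}"

lemma mem_pp [simp]: "(x, y) \<in> pp F S G R X \<longleftrightarrow> x \<in> sec F X \<and> y \<in> sec G X \<and> (x \<in> S X \<or> y \<in> R X)"
  by (auto simp: pp_def)

lemma mem_ppE:
  assumes "z \<in> pp F S G R X"
  obtains x y where "z = (x, y)" "x \<in> sec F X" "y \<in> sec G X" "x \<in> S X \<or> y \<in> R X"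
  using assms by (auto simp: pp_def)

lemma subpsh_pp:
  assumes F: "presheaf F" and G: "presheaf G" and S: "subpsh F S" and R: "subpsh G R"
  shows "subpsh (pair F G) (pp F S G R)"
  unfolding subpsh_def
proof (intro conjI ballI)
  fix X show "pp F S G R X \<subseteq> sec (pair F G) X" by (auto simp: pp_def)
next
  fix a z assume a: "a \<in> Ar" and "z \<in> pp F S G R (cd a)"
  then obtain x y where "z = (x, y)" "x \<in> sec F (cd a)" "y \<in> sec G (cd a)" "x \<in> S (cd a) \<or> y \<in> R (cd a)"
    by (elim mem_ppE)
  then show "res (pair F G) a z \<in> pp F S G R (dm a)"
    using F G a subpsh_res[OF S a] subpsh_res[OF R a] by auto
qed

section \<open>Retracts of inclusions\<close>

definition retr :: "'b presheaf \<Rightarrow> (epo \<Rightarrow> 'b set) \<Rightarrow> 'c presheaf \<Rightarrow> (epo \<Rightarrow> 'c set) \<Rightarrow> bool" where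
  "retr F S G R \<longleftrightarrow> (\<exists>i r. natural G (sec G) F i \<and> natural F (sec F) G r \<and>
     (\<forall>X\<in>Ob. \<forall>x\<in>R X. i X x \<in> S X) \<and> (\<forall>X\<in>Ob. \<forall>x\<in>S X. r X x \<in> R X) \<and>
     (\<forall>X\<in>Ob. \<forall>x\<in>sec G X. r X (i X x) = x))"

lemma retrI:
  assumes "natural G (sec G) F i" "natural F (sec F) G r"
    "\<And>X x. X \<in> Ob \<Longrightarrow> x \<in> R X \<Longrightarrow> i X x \<in> S X" "\<And>X x. X \<in> Ob \<Longrightarrow> x \<in> S X \<Longrightarrow> r X x \<in> R X"
    "\<And>X x. X \<in> Ob \<Longrightarrow> x \<in> sec G X \<Longrightarrow> r X (i X x) = x"
  shows "retr F S G R"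
  using assms unfolding retr_def by blast

lemma ext_retr:
  assumes "ext F S T" "retr F S G R" "subpsh F S" "subpsh G R"
  shows "ext G R T"
proof -
  obtain i r where ir: "natural G (sec G) F i" "natural F (sec F) G r"
     "\<forall>X\<in>Ob. \<forall>x\<in>R X. i X x \<in> S X" "\<forall>X\<in>Ob. \<forall>x\<in>S X. r X x \<in> R X"
     "\<forall>X\<in>Ob. \<forall>x\<in>sec G X. r X (i X x) = x"
    using assms(2) unfolding retr_def by blast
  have "natural F S G r" using ir(2) by (rule natural_subset) (use subpshD[OF assms(3)] in blast)
  from ext_retract[OF assms(1) ir(1) this] show ?thesis
    using ir(3-5) subpshD[OF assms(4)] by metis
qed

lemma natural_pair:
  assumes "natural F (sec F) F' i" "natural G (sec G) G' j"
  shows "natural (pair F G) (sec (pair F G)) (pair F' G') (\<lambda>X z. (i X (fst z), j X (snd z)))"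
proof (rule naturalI)
  fix X z assume "X \<in> Ob" "z \<in> sec (pair F G) X"
  then show "(i X (fst z), j X (snd z)) \<in> sec (pair F' G') X"
    using naturalD[OF assms(1)] naturalD[OF assms(2)] by (cases z) simp
next
  fix a z assume "a \<in> Ar" "z \<in> sec (pair F G) (cd a)"
  then show "(i (dm a) (fst (res (pair F G) a z)), j (dm a) (snd (res (pair F G) a z))) =
    res (pair F' G') a (i (cd a) (fst z), j (cd a) (snd z))"
    using natural_res[OF assms(1)] natural_res[OF assms(2)] by (cases z) simp
qed

lemma natural_id: "presheaf F \<Longrightarrow> natural F (sec F) F (\<lambda>X x. x)"
  by (rule naturalI) simp_all

lemma retr_pair:
  assumes "retr F S F' S'" "retr G R G' R'"
  shows "retr (pair F G) (pp F S G R) (pair F' G') (pp F' S' G' R')"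
proof -
  obtain i r where ir: "natural F' (sec F') F i" "natural F (sec F) F' r"
     "\<forall>X\<in>Ob. \<forall>x\<in>S' X. i X x \<in> S X" "\<forall>X\<in>Ob. \<forall>x\<in>S X. r X x \<in> S' X"
     "\<forall>X\<in>Ob. \<forall>x\<in>sec F' X. r X (i X x) = x"
    using assms(1) unfolding retr_def by blast
  obtain j q where jq: "natural G' (sec G') G j" "natural G (sec G) G' q"
     "\<forall>X\<in>Ob. \<forall>x\<in>R' X. j X x \<in> R X" "\<forall>X\<in>Ob. \<forall>x\<in>R X. q X x \<in> R' X"
     "\<forall>X\<in>Ob. \<forall>x\<in>sec G' X. q X (j X x) = x"
    using assms(2) unfolding retr_def by blast
  show ?thesis
  proof (rule retrI[OF natural_pair[OF ir(1) jq(1)] natural_pair[OF ir(2) jq(2)]])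
    fix X z assume "X \<in> Ob" "z \<in> pp F' S' G' R' X"
    then show "(i X (fst z), j X (snd z)) \<in> pp F S G R X"
      using ir(3) jq(3) naturalD[OF ir(1)] naturalD[OF jq(1)] by (elim mem_ppE) auto
  next
    fix X z assume "X \<in> Ob" "z \<in> pp F S G R X"
    then show "(r X (fst z), q X (snd z)) \<in> pp F' S' G' R' X"
      using ir(4) jq(4) naturalD[OF ir(2)] naturalD[OF jq(2)] by (elim mem_ppE) auto
  next
    fix X z assume "X \<in> Ob" "z \<in> sec (pair F' G') X"
    then show "(r X (fst (i X (fst z), j X (snd z))), q X (snd (i X (fst z), j X (snd z)))) = z"
      using ir(5) jq(5) by (cases z) simp
  qed
qed

lemma retr_id: "presheaf F \<Longrightarrow> retr F S F S"
  by (rule retrI[OF natural_id natural_id]) simp_all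

lemma enc_natural:
  assumes "presheaf F" "decodes e d F"
  shows "natural F (sec F) (pres_enc e d F) (\<lambda>X. e)" "natural (pres_enc e d F) (sec (pres_enc e d F)) F (\<lambda>X. d)"
proof -
  note de = decodesD[OF assms(2)]
  show "natural F (sec F) (pres_enc e d F) (\<lambda>X. e)"
    by (rule naturalI) (simp_all add: de[OF Ar_cd])
  show "natural (pres_enc e d F) (sec (pres_enc e d F)) F (\<lambda>X. d)"
  proof (rule naturalI; elim mem_encE)
    fix a v x assume h: "a \<in> Ar" "v = e x" "x \<in> sec F (cd a)"
    then show "d (res (pres_enc e d F) a v) = res F a (d v)"
      using de[of "cd a" x] de[of "dm a" "res F a x"] assms(1) by simp
  qed (simp add: de)
qed

lemma retr_enc:
  assumes "presheaf F" "decodes e d F" "\<And>X. X \<in> Ob \<Longrightarrow> S X \<subseteq> sec F X"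
  shows "retr (pres_enc e d F) (\<lambda>X. e ` S X) F S" "retr F S (pres_enc e d F) (\<lambda>X. e ` S X)"
proof -
  have de: "d (e x) = x" if "X \<in> Ob" "x \<in> S X" for X x
    using decodesD[OF assms(2)] assms(3)[OF that(1)] that by blast
  show "retr (pres_enc e d F) (\<lambda>X. e ` S X) F S"
    by (rule retrI[OF enc_natural[OF assms(1,2)]]) (use assms(2) de in auto)
  show "retr F S (pres_enc e d F) (\<lambda>X. e ` S X)"
    by (rule retrI[OF enc_natural(2,1)[OF assms(1,2)]]) (use decodesD[OF assms(2)] de in auto)
qed

lemma subpsh_enc:
  assumes "presheaf F" "decodes e d F" "subpsh F S"
  shows "subpsh (pres_enc e d F) (\<lambda>X. e ` S X)"
  unfolding subpsh_def
proof (intro conjI ballI)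
  fix X assume X: "X \<in> Ob" show "e ` S X \<subseteq> sec (pres_enc e d F) X"
    using subpshD[OF assms(3) X] by auto
next
  fix a v assume a: "a \<in> Ar" and "v \<in> e ` S (cd a)"
  then obtain x where x: "v = e x" "x \<in> S (cd a)" by blast
  show "res (pres_enc e d F) a v \<in> e ` S (dm a)"
    using subpsh_res[OF assms(3) a x(2)] subpshD[OF assms(3) _ x(2)] a
      decodesD[OF assms(2), of "cd a" x] by (simp add: x)
qed

text \<open>Both subpresheaves consist of the triples with at least one coordinate in its own part,
  so permuting the coordinates is an isomorphism of inclusions.\<close>

lemma retr_swap:
  assumes F: "presheaf F" and G: "presheaf G" and H: "presheaf H"
  shows "retr (pair (pair F H) G) (pp (pair F H) (pp F S H Q) G R)
    (pair (pair F G) H) (pp (pair F G) (pp F S G R) H Q)"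
  by (rule retrI[where i = "\<lambda>X z. ((fst (fst z), snd z), snd (fst z))"
        and r = "\<lambda>X z. ((fst (fst z), snd z), snd (fst z))"]; (intro naturalI)?)
    (auto simp: F G H pp_def)

lemma retr_assoc:
  assumes F: "presheaf F" and G: "presheaf G" and H: "presheaf H"
  shows "retr (pair F (pair G H)) (pp F S (pair G H) (pp G R H Q))
    (pair (pair F G) H) (pp (pair F G) (pp F S G R) H Q)"
  by (rule retrI[where i = "\<lambda>X z. (fst (fst z), snd (fst z), snd z)"
        and r = "\<lambda>X z. ((fst z, fst (snd z)), snd (snd z))"]; (intro naturalI)?)
    (auto simp: F G H pp_def)

section \<open>Constants and the contraction of the interval\<close>

definition cst :: "epo \<Rightarrow> real \<Rightarrow> (nat \<Rightarrow> real) \<Rightarrow> real" where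
  "cst X e = (\<lambda>p\<in>carrier X. e)"

abbreviation pt :: "real \<Rightarrow> epo \<Rightarrow> ((nat \<Rightarrow> real) \<Rightarrow> real) set" where
  "pt e X \<equiv> {cst X e}"
abbreviation ends :: "epo \<Rightarrow> ((nat \<Rightarrow> real) \<Rightarrow> real) set" where
  "ends X \<equiv> {cst X 0, cst X 1}"

lemma continuous_map_unit:
  "continuous_map Y (top_of_set {0..1}) f \<longleftrightarrow>
    continuous_map Y euclidean f \<and> (\<forall>p\<in>topspace Y. 0 \<le> f p \<and> f p \<le> (1 :: real))"
  by (auto simp: continuous_map_in_subtopology image_subset_iff)

lemma dimap_d: "dimap Y Delta_d f \<longleftrightarrow> continuous_map (fst Y) euclidean f \<and>
    (\<forall>p\<in>carrier Y. 0 \<le> f p \<and> f p \<le> 1) \<and>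
    (\<forall>(x, y)\<in>snd Y. 0 \<le> f x \<and> f x \<le> 1 \<and> f x = f y)"
  unfolding dimap_def Delta_d_def by (auto simp: continuous_map_unit Id_on_iff)

lemma dimap_D: "dimap Y Delta_D f \<longleftrightarrow> continuous_map (fst Y) euclidean f \<and>
    (\<forall>p\<in>carrier Y. 0 \<le> f p \<and> f p \<le> 1) \<and>
    (\<forall>(x, y)\<in>snd Y. 0 \<le> f x \<and> f x \<le> f y \<and> f y \<le> 1)"
  unfolding dimap_def Delta_D_def by (auto simp: continuous_map_unit)

lemma dimap_d_D: "dimap Y Delta_d f \<Longrightarrow> dimap Y Delta_D f"
  unfolding dimap_d dimap_D by fastforce

lemma local_dimaps_d_D: "f \<in> local_dimaps X Delta_d \<Longrightarrow> f \<in> local_dimaps X Delta_D"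
  unfolding local_dimaps_def using dimap_d_D by fast

lemma cst_d:
  assumes "0 \<le> e" "e \<le> 1" "X \<in> Ob"
  shows "cst X e \<in> local_dimaps X Delta_d"
proof (rule local_dimapsI[OF _ self_cover])
  fix U assume "U \<in> {carrier X}"
  then have U: "openin (fst X) U" by simp
  note o = Ob_order[OF sub_Ob[OF assms(3) U]]
  have "dimap (sub_ospace X U) Delta_d (cst X e) \<longleftrightarrow> dimap (sub_ospace X U) Delta_d (\<lambda>_. e)"
    by (rule dimap_cong[OF _ o]) (use \<open>U \<in> {carrier X}\<close> in \<open>auto simp: cst_def carrier_sub\<close>)
  then show "dimap (sub_ospace X U) Delta_d (cst X e)"
    using assms by (simp add: dimap_d)
qed (simp add: cst_def)

lemma cst_mem [simp]:
  "X \<in> Ob \<Longrightarrow> cst X 0 \<in> local_dimaps X Delta_d" "X \<in> Ob \<Longrightarrow> cst X 1 \<in> local_dimaps X Delta_d"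
  "X \<in> Ob \<Longrightarrow> cst X 0 \<in> local_dimaps X Delta_D" "X \<in> Ob \<Longrightarrow> cst X 1 \<in> local_dimaps X Delta_D"
  by (simp_all add: cst_d local_dimaps_d_D)

lemma res_cst [simp]: "a \<in> Ar \<Longrightarrow> res (fn \<Delta>) a (cst (cd a) e) = cst (dm a) e"
  by (cases a) (auto simp: res_fn cst_def compose_def fun_eq_iff Ar_iff dest: dimap_carrier)

text \<open>Over a space without points there is only one function, so the two ends are disjoint
  except there.\<close>

lemma cst_eq_iff: "cst X a = cst X b \<longleftrightarrow> carrier X = {} \<or> a = b"
proof
  assume h: "cst X a = cst X b"
  show "carrier X = {} \<or> a = b"
  proof (cases "carrier X = {}")
    case False
    then obtain p where "p \<in> carrier X" by blast
    then show ?thesis using fun_cong[OF h, of p] by (simp add: cst_def)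
  qed simp
qed (auto simp: cst_def)

lemma subpsh_pt: "e \<in> {0, 1} \<Longrightarrow> subpsh (fn Delta_d) (pt e)" "e \<in> {0, 1} \<Longrightarrow> subpsh (fn Delta_D) (pt e)"
  and subpsh_ends: "subpsh (fn Delta_d) ends" "subpsh (fn Delta_D) ends"
  unfolding subpsh_def by auto

text \<open>A straight-line contraction of \<open>\<Delta>\<^sub>D\<close> to its end \<open>e\<close>. Being affine in \<open>t\<close> with slope
  \<open>s \<ge> 0\<close>, it is a dimap in \<open>(t, s)\<close> for both ends because the parameter \<open>s\<close> is discretely ordered.\<close>

definition con :: "epo \<Rightarrow> real \<Rightarrow> ((nat \<Rightarrow> real) \<Rightarrow> real) \<Rightarrow> ((nat \<Rightarrow> real) \<Rightarrow> real) \<Rightarrow> (nat \<Rightarrow> real) \<Rightarrow> real" where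
  "con X e t s = (\<lambda>p\<in>carrier X. e + (t p - e) * s p)"

lemma con_unit:
  assumes "0 \<le> t" "t \<le> 1" "0 \<le> s" "s \<le> 1" "e \<in> {0, 1 :: real}"
  shows "0 \<le> e + (t - e) * s" "e + (t - e) * s \<le> 1"
proof -
  \<comment> \<open>The expression is \<open>t * s\<close> for \<open>e = 0\<close> and
    \<open>1 - (1 - t) * s\<close> for \<open>e = 1\<close>.\<close>
  have "t * s \<le> 1" "0 \<le> t * s" "0 \<le> (1 - t) * s" "(1 - t) * s \<le> 1"
    using assms by (simp_all add: mult_le_one)
  then show "0 \<le> e + (t - e) * s" "e + (t - e) * s \<le> 1"
    using assms(5) by (auto simp: algebra_simps)
qed

lemma dimap_con:
  assumes t: "dimap Y Delta_D t" and s: "dimap Y Delta_d s" and e: "e \<in> {0, 1}"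
  shows "dimap Y Delta_D (\<lambda>p. e + (t p - e) * s p)"
proof -
  have "continuous_map (fst Y) euclidean (\<lambda>p. e + (t p - e) * s p)"
    using t s unfolding dimap_D dimap_d
    by (intro continuous_map_add continuous_map_real_mult continuous_map_diff continuous_map_const[THEN iffD2]) auto
  moreover have "0 \<le> e + (t x - e) * s x \<and> e + (t x - e) * s x \<le> e + (t y - e) * s y \<and> e + (t y - e) * s y \<le> 1"
    if "(x, y) \<in> snd Y" for x y
  proof -
    have h: "0 \<le> t x" "t x \<le> t y" "t y \<le> 1" "0 \<le> s x" "s x \<le> 1" "s y = s x"
      using t s that unfolding dimap_D dimap_d by auto
    have "(t x - e) * s x \<le> (t y - e) * s x" using h by (intro mult_right_mono) auto
    moreover have "0 \<le> e + (t x - e) * s x" "e + (t y - e) * s x \<le> 1"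
      using con_unit[of "t x" "s x" e] con_unit[of "t y" "s x" e] h e by auto
    ultimately show ?thesis by (simp add: h(6))
  qed
  ultimately show ?thesis
    using con_unit[OF _ _ _ _ e] t s unfolding dimap_D dimap_d by auto
qed

lemma dimap_smaller:
  assumes "dimap (sub_ospace X U) \<Delta> f" "V \<subseteq> U" "X \<in> Ob" "openin (fst X) U" "openin (fst X) V"
  shows "dimap (sub_ospace X V) \<Delta> f"
proof -
  have "dimap (sub_ospace (sub_ospace X U) V) \<Delta> f"
    using assms(1) unfolding dimap_def sub_ospace_def
    by (auto intro: continuous_map_from_subtopology)
  then show ?thesis by (simp add: sub_sub[OF assms(2)])
qed

lemma con_mem:
  assumes X: "X \<in> Ob" and t: "t \<in> local_dimaps X Delta_D" and s: "s \<in> local_dimaps X Delta_d" and e: "e \<in> {0, 1}"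
  shows "con X e t s \<in> local_dimaps X Delta_D"
proof -
  obtain \<C> where C: "open_dicover X \<C>" "\<And>U. U \<in> \<C> \<Longrightarrow> dimap (sub_ospace X U) Delta_D t"
    using t by (rule local_dimapsE) blast
  obtain \<D> where D: "open_dicover X \<D>" "\<And>U. U \<in> \<D> \<Longrightarrow> dimap (sub_ospace X U) Delta_d s"
    using s by (rule local_dimapsE) blast
  \<comment> \<open>The covers for \<open>t\<close> and \<open>s\<close> are unrelated; on pairwise
    intersections of their members both are dimaps.\<close>
  have cov: "open_dicover X {W. \<exists>U\<in>\<C>. \<exists>V\<in>\<D>. W = U \<inter> V}"
    unfolding open_dicover_def
  proof (intro conjI ballI)
    fix W assume "W \<in> {W. \<exists>U\<in>\<C>. \<exists>V\<in>\<D>. W = U \<inter> V}"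
    then show "openin (fst X) W" using cover_open[OF C(1)] cover_open[OF D(1)] by (auto intro: openin_Int)
  next
    have "\<Union>{W. \<exists>U\<in>\<C>. \<exists>V\<in>\<D>. W = U \<inter> V} = \<Union>\<C> \<inter> \<Union>\<D>" by blast
    then show "\<Union>{W. \<exists>U\<in>\<C>. \<exists>V\<in>\<D>. W = U \<inter> V} = carrier X"
      using C(1) D(1) by (simp add: open_dicover_def)
  qed
  show ?thesis
  proof (rule local_dimapsI[OF _ cov])
    fix W assume "W \<in> {W. \<exists>U\<in>\<C>. \<exists>V\<in>\<D>. W = U \<inter> V}"
    then obtain U V where W: "U \<in> \<C>" "V \<in> \<D>" "W = U \<inter> V" by blast
    have o: "openin (fst X) U" "openin (fst X) V" "openin (fst X) W"
      using W cover_open[OF C(1)] cover_open[OF D(1)] by (simp_all add: openin_Int)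
    have "dimap (sub_ospace X W) Delta_D t" "dimap (sub_ospace X W) Delta_d s"
      using dimap_smaller[OF C(2)[OF W(1)] _ X o(1,3)] dimap_smaller[OF D(2)[OF W(2)] _ X o(2,3)] W(3) by auto
    then have "dimap (sub_ospace X W) Delta_D (\<lambda>p. e + (t p - e) * s p)" using e by (rule dimap_con)
    moreover have "dimap (sub_ospace X W) Delta_D (con X e t s) \<longleftrightarrow>
        dimap (sub_ospace X W) Delta_D (\<lambda>p. e + (t p - e) * s p)"
      by (rule dimap_cong[OF _ Ob_order[OF sub_Ob[OF X o(3)]]])
        (use openin_subset[OF o(3)] o(3) in \<open>auto simp: con_def carrier_sub\<close>)
    ultimately show "dimap (sub_ospace X W) Delta_D (con X e t s)" by simp
  qed (simp add: con_def)
qed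

lemma res_con: "a \<in> Ar \<Longrightarrow> res (fn \<Delta>) a (con (cd a) e t s) = con (dm a) e (res (fn \<Delta>) a t) (res (fn \<Delta>') a s)"
  by (cases a) (auto simp: res_fn con_def compose_def fun_eq_iff Ar_iff dest: dimap_carrier)

lemma con_1 [simp]: "t \<in> local_dimaps X \<Delta> \<Longrightarrow> con X e t (cst X 1) = t"
  using local_dimaps_ext[of t X \<Delta>] by (auto simp: con_def cst_def fun_eq_iff extensional_def)

lemma con_0 [simp]: "con X e t (cst X 0) = cst X e"
  by (auto simp: con_def cst_def fun_eq_iff)

lemma con_end [simp]: "con X e (cst X e) s = cst X e"
  by (auto simp: con_def cst_def fun_eq_iff)

lemma con_other_end: "s \<in> local_dimaps X \<Delta> \<Longrightarrow> con X 0 (cst X 1) s = s"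
  using local_dimaps_ext[of s X \<Delta>] by (auto simp: con_def cst_def fun_eq_iff extensional_def)

section \<open>Consequences of the homotopy extension property\<close>

abbreviation fnd where "fnd \<equiv> fn Delta_d"
abbreviation fnD where "fnD \<equiv> fn Delta_D"

text \<open>Isomorphic to an object of the sheaf category. This lets objects over types other than
  \<open>'u\<close>, such as iterated products with intervals, be used in place of sheaves over
  \<open>'u\<close>.\<close>

definition small :: "'u set set \<Rightarrow> 'b presheaf \<Rightarrow> bool" where
  "small \<U> F \<longleftrightarrow> presheaf F \<and> (\<exists>(e :: 'b \<Rightarrow> 'u) d. decodes e d F \<and> is_sheaf \<U> (pres_enc e d F))"

text \<open>The end 0 of \<open>Delta_d\<close> is the time at which \<open>con\<close> has
  collapsed \<open>Delta_D\<close>, whichever end it collapses to, so this one form serves both ends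
  of the directed interval.\<close>

definition HEP :: "'u set set \<Rightarrow> 'c presheaf \<Rightarrow> bool" where
  "HEP \<U> T \<longleftrightarrow> (\<forall>(L :: 'u presheaf) K. is_sheaf \<U> L \<longrightarrow> subpsh L K \<longrightarrow>
     ext (pair L fnd) (pp L K fnd (pt 0)) T)"

lemma HEP_small:
  assumes T: "HEP \<U> T" and L: "small \<U> L" and K: "subpsh L K"
  shows "ext (pair L fnd) (pp L K fnd (pt 0)) T"
proof -
  obtain e :: "_ \<Rightarrow> 'a" and d where p: "presheaf L" and ed: "decodes e d L" and sh: "is_sheaf \<U> (pres_enc e d L)"
    using L unfolding small_def by blast
  have sK: "subpsh (pres_enc e d L) (\<lambda>X. e ` K X)" using p ed K by (rule subpsh_enc)
  have "ext (pair (pres_enc e d L) fnd) (pp (pres_enc e d L) (\<lambda>X. e ` K X) fnd (pt 0)) T"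
    using T sh sK unfolding HEP_def by blast
  moreover have "retr (pair (pres_enc e d L) fnd) (pp (pres_enc e d L) (\<lambda>X. e ` K X) fnd (pt 0))
      (pair L fnd) (pp L K fnd (pt 0))"
    by (intro retr_pair retr_enc(1) retr_id p ed presheaf_fn) (use subpshD[OF K] in blast)
  ultimately show ?thesis
    by (rule ext_retr) (intro subpsh_pp presheaf_enc presheaf_fn p ed sK K subpsh_pt; simp)+
qed

lemma natural_at_end:
  assumes "natural (pair L fnd) (sec (pair L fnd)) T \<zeta>"
  shows "natural L (sec L) T (\<lambda>X x. \<zeta> X (x, cst X 1))"
proof (rule naturalI)
  fix X x assume "X \<in> Ob" "x \<in> sec L X"
  then show "\<zeta> X (x, cst X 1) \<in> sec T X" using naturalD[OF assms, of X "(x, cst X 1)"] by simp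
next
  fix a x assume "a \<in> Ar" "x \<in> sec L (cd a)"
  then show "\<zeta> (dm a) (res L a x, cst (dm a) 1) = res T a (\<zeta> (cd a) (x, cst (cd a) 1))"
    using natural_res[OF assms, of a "(x, cst (cd a) 1)"] by simp
qed

text \<open>Precompose the given map with the contraction to \<open>e\<close>, extend it over the
  discrete time interval, and evaluate at time 1, where the contraction is the identity.\<close>

lemma ext_end_D:
  assumes hep: "ext (pair (pair B fnD) fnd) (pp (pair B fnD) (pp B A fnD (pt e)) fnd (pt 0)) T"
    and B: "presheaf B" and A: "subpsh B A" and e: "e \<in> {0, 1}"
  shows "ext (pair B fnD) (pp B A fnD (pt e)) T"
proof (rule extI)
  let ?K = "pp B A fnD (pt e)"
  let ?G = "\<lambda>X z. (fst (fst z), con X e (snd (fst z)) (snd z))"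
  fix \<eta> assume \<eta>: "natural (pair B fnD) ?K T \<eta>"
  \<comment> \<open>The contraction keeps the coordinate in \<open>B\<close>, fixes the end
    \<open>e\<close>, and at time 0 sends everything to \<open>e\<close>; these are the three ways
    of being in the domain of the extension problem.\<close>
  have mem: "?G X z \<in> ?K X" if "X \<in> Ob" "z \<in> pp (pair B fnD) ?K fnd (pt 0) X" for X z
    using that(2) cst_mem that(1) con_mem[OF that(1) _ _ e]
    by (elim mem_ppE) (use e in auto)
  have "natural (pair (pair B fnD) fnd) (pp (pair B fnD) ?K fnd (pt 0)) (pair B fnD) ?G"
  proof (rule naturalI)
    fix X z assume "X \<in> Ob" "z \<in> pp (pair B fnD) ?K fnd (pt 0) X"
    from mem[OF this] show "?G X z \<in> sec (pair B fnD) X" by simp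
  next
    fix a z assume a: "a \<in> Ar" and "z \<in> pp (pair B fnD) ?K fnd (pt 0) (cd a)"
    then obtain b t s where "z = ((b, t), s)" by (metis surj_pair)
    then show "?G (dm a) (res (pair (pair B fnD) fnd) a z) = res (pair B fnD) a (?G (cd a) z)"
      using a by (simp add: res_con[where \<Delta>' = Delta_d])
  qed
  then have "natural (pair (pair B fnD) fnd) (pp (pair B fnD) ?K fnd (pt 0)) T (\<lambda>X z. \<eta> X (?G X z))"
    using \<eta> mem by (rule natural_comp)
  then obtain \<zeta> where z: "natural (pair (pair B fnD) fnd) (sec (pair (pair B fnD) fnd)) T \<zeta>"
      "\<forall>X\<in>Ob. \<forall>z\<in>pp (pair B fnD) ?K fnd (pt 0) X. \<zeta> X z = \<eta> X (?G X z)"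
    using extD[OF hep] by blast
  have "\<zeta> X (x, cst X 1) = \<eta> X x" if X: "X \<in> Ob" and x: "x \<in> ?K X" for X x
  proof -
    obtain b t where bt: "x = (b, t)" "b \<in> sec B X" "t \<in> local_dimaps X Delta_D" using x by (elim mem_ppE) simp
    have "(x, cst X 1) \<in> pp (pair B fnD) ?K fnd (pt 0) X" using x X bt by simp
    then show ?thesis using z(2) X bt by simp
  qed
  then show "\<exists>\<zeta>. natural (pair B fnD) (sec (pair B fnD)) T \<zeta> \<and> (\<forall>X\<in>Ob. \<forall>x\<in>?K X. \<zeta> X x = \<eta> X x)"
    using natural_at_end[OF z(1)] by (intro exI conjI) auto
qed

lemma natural_d_of_D:
  assumes "natural (pair L fnD) S T \<eta>" "\<And>X. X \<in> Ob \<Longrightarrow> S' X \<subseteq> S X"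
  shows "natural (pair L fnd) S' T \<eta>"
proof -
  have "res (pair L fnd) = res (pair L fnD)" by (simp add: pair_def fn_def)
  then show ?thesis using natural_subset[OF assms] unfolding natural_def by simp
qed

text \<open>The straight-line contraction moves the end \<open>1\<close> along the interval, where \<open>\<kappa>\<close> takes over.\<close>

lemma extend_ends_D:
  assumes hep: "ext (pair (pair L fnD) fnd) (pp (pair L fnD) (pp L S fnD ends) fnd (pt 0)) T"
    and L: "presheaf L" and S: "subpsh L S" and T: "sheaf T"
    and \<eta>: "natural (pair L fnD) (pp L S fnD ends) T \<eta>"
    and \<kappa>: "natural (pair L fnd) (sec (pair L fnd)) T \<kappa>"
    and eq: "\<And>X z. X \<in> Ob \<Longrightarrow> z \<in> pp L S fnd ends X \<Longrightarrow> \<kappa> X z = \<eta> X z"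
  shows "\<exists>\<theta>. natural (pair L fnD) (sec (pair L fnD)) T \<theta> \<and> (\<forall>X\<in>Ob. \<forall>z\<in>pp L S fnD ends X. \<theta> X z = \<eta> X z)"
proof -
  let ?K = "pp L S fnD ends"
  let ?P = "pp (pair L fnD) ?K fnd (pt 0)"
  define G where "G = (\<lambda>X ((x, t), s). if t = cst X 1 then \<kappa> X (x, s) else \<eta> X (x, con X 0 t s))"
  have PE: "\<exists>x t s. z = ((x, t), s) \<and> x \<in> sec L X \<and> t \<in> local_dimaps X Delta_D \<and> s \<in> local_dimaps X Delta_d \<and>
      (t = cst X 1 \<or> (x \<in> S X \<or> t = cst X 0 \<or> s = cst X 0))" if "z \<in> ?P X" for X z
    using that by (elim mem_ppE) auto
  have G1: "G X ((x, cst X 1), s) = \<kappa> X (x, s)" for X x s by (simp add: G_def)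
  have K0: "(x, con X 0 t s) \<in> ?K X" if "X \<in> Ob" "x \<in> sec L X" "t \<in> local_dimaps X Delta_D" "s \<in> local_dimaps X Delta_d"
     "x \<in> S X \<or> t = cst X 0 \<or> s = cst X 0" for X x t s
    using that con_mem[of X t s 0] by auto
  \<comment> \<open>The case distinction in \<open>G\<close> is not stable under restriction, since
    \<open>t\<close> may become the constant 1 on a smaller space. Naturality therefore needs the
    second formula also at \<open>t = cst X 1\<close>, wherever it makes sense.\<close>
  have G0: "G X ((x, t), s) = \<eta> X (x, con X 0 t s)"
    if X: "X \<in> Ob" and x: "x \<in> sec L X" and t: "t \<in> local_dimaps X Delta_D" and s: "s \<in> local_dimaps X Delta_d"
     and c: "x \<in> S X \<or> t = cst X 0 \<or> s = cst X 0" for X x t s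
  proof (cases "t = cst X 1")
    case t1: True
    have cs: "con X 0 t s = s" using con_other_end[OF s] t1 by simp
    show ?thesis
    proof (cases "x \<in> S X \<or> s = cst X 0")
      case True
      then have "\<kappa> X (x, s) = \<eta> X (x, s)" using x s X by (intro eq) auto
      then show ?thesis using t1 cs by (simp add: G1)
    next
      case False
      \<comment> \<open>What remains is \<open>t\<close> being both ends at once, which forces a
        space without points, where \<open>T\<close> has only one section.\<close>
      then have "cst X 0 = cst X 1" using c t1 by simp
      then have e: "carrier X = {}" by (simp add: cst_eq_iff)
      have "G X ((x, t), s) \<in> sec T X" using naturalD[OF \<kappa> X, of "(x, s)"] x s t1 by (simp add: G1)
      moreover have "\<eta> X (x, con X 0 t s) \<in> sec T X" using naturalD[OF \<eta> X] K0 that by blast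
      ultimately show ?thesis using sec_empty_eq[OF T X e] by blast
    qed
  qed (simp add: G_def)
  have "natural (pair (pair L fnD) fnd) ?P T G"
  proof (rule naturalI)
    fix X z assume X: "X \<in> Ob" and "z \<in> ?P X"
    from PE[OF this(2)] obtain x t s where z: "z = ((x, t), s)" "x \<in> sec L X" "t \<in> local_dimaps X Delta_D"
        "s \<in> local_dimaps X Delta_d" and c: "t = cst X 1 \<or> (x \<in> S X \<or> t = cst X 0 \<or> s = cst X 0)" by blast
    from c show "G X z \<in> sec T X"
    proof
      assume "t = cst X 1"
      then show ?thesis using naturalD[OF \<kappa> X, of "(x, s)"] z by (simp add: G1)
    next
      assume "x \<in> S X \<or> t = cst X 0 \<or> s = cst X 0"
      then show ?thesis using naturalD[OF \<eta> X K0[OF X z(2-4)]] G0[OF X z(2-4)] z(1) by simp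
    qed
  next
    fix a z assume a: "a \<in> Ar" and "z \<in> ?P (cd a)"
    from PE[OF this(2)] obtain x t s where z: "z = ((x, t), s)" "x \<in> sec L (cd a)" "t \<in> local_dimaps (cd a) Delta_D"
        "s \<in> local_dimaps (cd a) Delta_d"
      and c: "t = cst (cd a) 1 \<or> (x \<in> S (cd a) \<or> t = cst (cd a) 0 \<or> s = cst (cd a) 0)" by blast
    have r: "res L a x \<in> sec L (dm a)" "res fnD a t \<in> local_dimaps (dm a) Delta_D" "res fnd a s \<in> local_dimaps (dm a) Delta_d"
      using z a L res_fn_sec by auto
    from c show "G (dm a) (res (pair (pair L fnD) fnd) a z) = res T a (G (cd a) z)"
    proof
      assume t1: "t = cst (cd a) 1"
      show ?thesis using natural_res[OF \<kappa> a, of "(x, s)"] z a by (simp add: G1 t1)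
    next
      assume c0: "x \<in> S (cd a) \<or> t = cst (cd a) 0 \<or> s = cst (cd a) 0"
      then have c1: "res L a x \<in> S (dm a) \<or> res fnD a t = cst (dm a) 0 \<or> res fnd a s = cst (dm a) 0"
        using subpsh_res[OF S a] a by auto
      have "G (dm a) (res (pair (pair L fnD) fnd) a z) = \<eta> (dm a) (res L a x, con (dm a) 0 (res fnD a t) (res fnd a s))"
        using G0[OF _ r c1] a z(1) by simp
      also have "\<dots> = \<eta> (dm a) (res (pair L fnD) a (x, con (cd a) 0 t s))"
        using a by (simp add: res_con[where \<Delta>' = Delta_d])
      also have "\<dots> = res T a (\<eta> (cd a) (x, con (cd a) 0 t s))"
        using natural_res[OF \<eta> a K0[OF _ z(2-4) c0]] a by simp
      also have "\<dots> = res T a (G (cd a) z)" using G0[OF _ z(2-4) c0] a z(1) by simp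
      finally show ?thesis .
    qed
  qed
  then obtain \<zeta> where \<zeta>: "natural (pair (pair L fnD) fnd) (sec (pair (pair L fnD) fnd)) T \<zeta>"
      "\<forall>X\<in>Ob. \<forall>z\<in>?P X. \<zeta> X z = G X z"
    using extD[OF hep] by blast
  have "\<zeta> X (z, cst X 1) = \<eta> X z" if X: "X \<in> Ob" and z: "z \<in> ?K X" for X z
  proof -
    obtain x t where xt: "z = (x, t)" "x \<in> sec L X" "t \<in> local_dimaps X Delta_D" "x \<in> S X \<or> t \<in> ends X"
      using z by (elim mem_ppE) simp
    have "(z, cst X 1) \<in> ?P X" using z X xt by simp
    then have e: "\<zeta> X (z, cst X 1) = G X (z, cst X 1)" using \<zeta>(2) X by blast
    show ?thesis
    proof (cases "t = cst X 1")
      case True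
      have "\<kappa> X (x, cst X 1) = \<eta> X (x, cst X 1)" using X xt by (intro eq) simp_all
      then show ?thesis using e xt True by (simp add: G1)
    next
      case False
      then have "x \<in> S X \<or> t = cst X 0 \<or> cst X 1 = cst X 0" using xt(4) by blast
      then show ?thesis using e G0[OF X xt(2,3), of "cst X 1"] X xt(1,3) by simp
    qed
  qed
  then show ?thesis using natural_at_end[OF \<zeta>(1)] by (intro exI conjI) auto
qed

section \<open>The sheaf category\<close>

definition arr :: "'u presheaf \<Rightarrow> (epo \<Rightarrow> 'u \<Rightarrow> 'u) \<Rightarrow> 'u presheaf \<Rightarrow> 'u presheaf_map" where
  "arr F \<eta> G = (F, \<lambda>X\<in>Ob. \<lambda>x\<in>sec F X. \<eta> X x, G)"

abbreviation ap :: "'u presheaf_map \<Rightarrow> epo \<Rightarrow> 'u \<Rightarrow> 'u" where "ap f \<equiv> fst (snd f)"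

definition im :: "'u presheaf_map \<Rightarrow> epo \<Rightarrow> 'u set" where
  "im f X = ap f X ` sec (fst f) X"

text \<open>Merges the two levels of encoding in \<open>prod_presheaf F (h_P \<Delta>)\<close>, so
  that a cylinder is a single \<open>pres_enc\<close> of a product.\<close>

definition cenc :: "'u \<times> ((nat \<Rightarrow> real) \<Rightarrow> real) \<Rightarrow> 'u" where
  "cenc = (\<lambda>(x, k). code (x, code k :: 'u))"
definition cdec :: "'u \<Rightarrow> 'u \<times> ((nat \<Rightarrow> real) \<Rightarrow> real)" where
  "cdec v = (case inv code v of (x, y :: 'u) \<Rightarrow> (x, inv code y))"

abbreviation cyl :: "'u presheaf \<Rightarrow> real ospace \<Rightarrow> 'u presheaf" where
  "cyl F \<Delta> \<equiv> pres_enc cenc cdec (pair F (fn \<Delta>))"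

lemma cyl_eq: "prod_presheaf F (h_P \<Delta>) = cyl F \<Delta>"
proof -
  have h: "res (h_P \<Delta>) a v = code (res (fn \<Delta>) a (inv code v))" for a v
    by (cases a) (simp add: h_P_def res_fn)
  have "res (prod_presheaf F (h_P \<Delta>)) a v = res (cyl F \<Delta>) a v" for a v
    by (simp add: prod_presheaf_def cdec_def cenc_def h split: prod.split)
  moreover have "sec (prod_presheaf F (h_P \<Delta>)) X = sec (cyl F \<Delta>) X" for X
    by (force simp: prod_presheaf_def cenc_def h_P_def)
  ultimately show ?thesis by (intro presheaf.equality ext) simp_all
qed

lemma h_P_eq: "h_P \<Delta> = pres_enc code (inv code) (fn \<Delta>)"
  by (rule presheaf.equality) (auto simp: h_P_def res_fn fun_eq_iff)

text \<open>An arrow of the sheaf category when \<open>S\<close> is a subpresheaf of a sheaf in the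
  universe and is closed under \<open>loc\<close>.\<close>

definition inc :: "'u presheaf \<Rightarrow> (epo \<Rightarrow> 'u set) \<Rightarrow> 'u presheaf_map" where
  "inc L S = arr (L\<lparr>sec := S\<rparr>) (\<lambda>X x. x) L"

locale universe =
  fixes \<U> :: "'u set set"
  assumes U: "set_universe \<U>"
begin

subsection \<open>Size\<close>

lemma U_lepoll: "A \<in> \<U> \<Longrightarrow> B \<lesssim> A \<Longrightarrow> (B :: 'u set) \<in> \<U>"
  using U unfolding set_universe_def by blast

lemma U_subset: "A \<in> \<U> \<Longrightarrow> B \<subseteq> A \<Longrightarrow> B \<in> \<U>"
  using U_lepoll subset_imp_lepoll by blast

lemma U_image: "A \<in> \<U> \<Longrightarrow> (f ` A :: 'u set) \<in> \<U>"
  using U_lepoll image_lepoll by blast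

lemma U_UN: "A \<in> \<U> \<Longrightarrow> (\<And>a. a \<in> A \<Longrightarrow> B a \<in> \<U>) \<Longrightarrow> (\<Union>a\<in>A. B a) \<in> \<U>"
  using U unfolding set_universe_def by blast

lemma U_epo_map:
  obtains A and i :: "epo_map \<Rightarrow> 'u" where "A \<in> \<U>" "inj i" "range i \<subseteq> A"
  using U unfolding set_universe_def lepoll_def by blast

text \<open>Spaces embed into \<open>epo_map\<close>, which embeds into a member of the universe;
  the image of \<open>I\<close> there serves as the index set.\<close>

lemma U_UN_epo:
  assumes "\<And>X :: epo. X \<in> I \<Longrightarrow> B X \<in> \<U>"
  shows "(\<Union>X\<in>I. B X) \<in> \<U>"
proof -
  obtain A and i :: "epo_map \<Rightarrow> 'u" where A: "A \<in> \<U>" "inj i" "range i \<subseteq> A" by (rule U_epo_map)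
  define j :: "epo \<Rightarrow> 'u" where "j X = i (X, undefined, undefined)" for X
  have j: "inj j" by (rule injI) (simp add: j_def inj_eq[OF A(2)])
  have "j ` I \<in> \<U>" by (rule U_subset[OF A(1)]) (use A(3) j_def in auto)
  then have "(\<Union>a\<in>j ` I. B (inv j a)) \<in> \<U>"
    by (rule U_UN) (use assms in \<open>auto simp: inv_f_f[OF j]\<close>)
  then show ?thesis by (simp add: inv_f_f[OF j])
qed

text \<open>A union indexed by spaces replaces a binary union: one index yields \<open>A\<close> and
  all others yield \<open>{u}\<close>, so a second space has to be exhibited.\<close>

lemma U_insert: "A \<in> \<U> \<Longrightarrow> insert u A \<in> \<U>"
proof -
  assume A: "A \<in> \<U>"
  obtain A0 and i :: "epo_map \<Rightarrow> 'u" where A0: "A0 \<in> \<U>" "inj i" "range i \<subseteq> A0" by (rule U_epo_map)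
  have "{u} \<in> \<U>"
    using U_image[OF U_subset[OF A0(1), of "{i undefined}"], of "\<lambda>_. u"] A0(3) by auto
  then have *: "(\<Union>X\<in>UNIV. if X = (undefined :: epo) then A else {u}) \<in> \<U>"
    using A by (intro U_UN_epo) simp
  have "\<exists>X :: epo. X \<noteq> undefined"
  proof (rule ccontr)
    assume "\<nexists>X :: epo. X \<noteq> undefined"
    then have "({} :: (nat \<Rightarrow> real) rel) = UNIV" by (metis snd_conv)
    then show False by blast
  qed
  then have "(\<Union>X\<in>UNIV. if X = (undefined :: epo) then A else {u}) = insert u A" by (auto split: if_splits)
  then show ?thesis using * by simp
qed

text \<open>Precomposition with \<open>inv e\<close> turns a function on \<open>'k\<close> into one
  on \<open>epo_map\<close> without loss, and powers indexed by \<open>epo_map\<close> exist in the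
  universe.\<close>

lemma U_fun:
  fixes e :: "'k \<Rightarrow> epo_map"
  assumes A: "A \<in> \<U>" and e: "inj e"
  obtains J :: "('k \<Rightarrow> 'u) \<Rightarrow> 'u" and B where "B \<in> \<U>" "inj_on J {\<psi>. range \<psi> \<subseteq> A}" "J ` {\<psi>. range \<psi> \<subseteq> A} \<subseteq> B"
proof -
  have "\<exists>B\<in>\<U>. (UNIV :: epo_map set) \<rightarrow>\<^sub>E A \<approx> B"
    using U A unfolding set_universe_def by (elim conjE) (rule bspec)
  then obtain B :: "'u set" where B: "B \<in> \<U>" "(UNIV :: epo_map set) \<rightarrow>\<^sub>E A \<approx> B" by blast
  then obtain j :: "(epo_map \<Rightarrow> 'u) \<Rightarrow> 'u" where j: "inj_on j (UNIV \<rightarrow>\<^sub>E A)" "j ` (UNIV \<rightarrow>\<^sub>E A) = B"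
    unfolding eqpoll_def bij_betw_def by blast
  let ?q = "\<lambda>\<psi>. \<psi> \<circ> inv e"
  have q: "?q \<psi> \<in> UNIV \<rightarrow>\<^sub>E A" if "range \<psi> \<subseteq> A" for \<psi>
    using that by (auto simp: PiE_def)
  have "inj_on (j \<circ> ?q) {\<psi>. range \<psi> \<subseteq> A}"
  proof (rule comp_inj_on)
    show "inj_on ?q {\<psi>. range \<psi> \<subseteq> A}"
    proof (rule inj_onI, rule ext)
      fix \<psi> \<phi> z assume "?q \<psi> = ?q \<phi>"
      from fun_cong[OF this, of "e z"] show "\<psi> z = \<phi> z" by (simp add: inv_f_f[OF e])
    qed
    show "inj_on j (?q ` {\<psi>. range \<psi> \<subseteq> A})"
      by (rule inj_on_subset[OF j(1)]) (use q in blast)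
  qed
  moreover have "(j \<circ> ?q) ` {\<psi>. range \<psi> \<subseteq> A} \<subseteq> B" using j(2) q by auto
  ultimately show ?thesis using that B(1) by blast
qed

lemma code_pair [simp]: "inv code (code (z :: 'u \<times> 'u) :: 'u) = z"
  using inj_code_pair[OF U] by (rule inv_f_f)

lemma code_fun [simp]: "inv code (code (k :: (nat \<Rightarrow> real) \<Rightarrow> real) :: 'u) = k"
  using inj_code_fun[OF U] by (rule inv_f_f)

lemma cdec_cenc [simp]: "cdec (cenc z :: 'u) = z"
  by (simp add: cdec_def cenc_def split: prod.split)

lemma decodes_cenc: "decodes (cenc :: _ \<Rightarrow> 'u) cdec F"
  by (simp add: decodes_def)

lemma U_code_fun: "(code ` (S :: ((nat \<Rightarrow> real) \<Rightarrow> real) set) :: 'u set) \<in> \<U>"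
proof -
  obtain A and i :: "epo_map \<Rightarrow> 'u" where A: "A \<in> \<U>" "inj i" "range i \<subseteq> A" by (rule U_epo_map)
  define r :: "real \<Rightarrow> 'u" where "r t = i (undefined, \<lambda>_ _. t, undefined)" for t
  have r: "inj r" by (rule injI) (simp add: r_def inj_eq[OF A(2)] fun_eq_iff)
  have "inj (\<lambda>p :: nat \<Rightarrow> real. (undefined, \<lambda>_. p, undefined) :: epo_map)"
    by (rule injI) (simp add: fun_eq_iff)
  then obtain J :: "((nat \<Rightarrow> real) \<Rightarrow> 'u) \<Rightarrow> 'u" and B where
    B: "B \<in> \<U>" "inj_on J {\<psi>. range \<psi> \<subseteq> A}" "J ` {\<psi>. range \<psi> \<subseteq> A} \<subseteq> B"
    by (rule U_fun[OF A(1)])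
  have rA: "range (r \<circ> f) \<subseteq> A" for f :: "(nat \<Rightarrow> real) \<Rightarrow> real" using A(3) by (auto simp: r_def)
  have i: "inj_on (\<lambda>f. J (r \<circ> f)) S"
  proof (rule inj_onI)
    fix f g assume "J (r \<circ> f) = J (r \<circ> g)"
    then have "r \<circ> f = r \<circ> g" using inj_onD[OF B(2)] rA by blast
    then show "f = g" by (simp add: fun_eq_iff inj_eq[OF r])
  qed
  have "(\<lambda>f. J (r \<circ> f)) ` S \<subseteq> B" using B(3) rA by auto
  then have "S \<lesssim> B" unfolding lepoll_def using i by blast
  then have "(code ` S :: 'u set) \<lesssim> B" using image_lepoll lepoll_trans by blast
  then show ?thesis by (rule U_lepoll[OF B(1)])
qed

lemma U_times: "A \<in> \<U> \<Longrightarrow> B \<in> \<U> \<Longrightarrow> (code ` (A \<times> B) :: 'u set) \<in> \<U>"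
proof -
  assume h: "A \<in> \<U>" "B \<in> \<U>"
  have "code ` (A \<times> B) = (\<Union>a\<in>A. (\<lambda>b. code (a, b) :: 'u) ` B)" by auto
  also have "\<dots> \<in> \<U>" by (rule U_UN[OF h(1)]) (rule U_image[OF h(2)])
  finally show ?thesis .
qed

lemma small_fn: "small \<U> (fn \<Delta>)"
  unfolding small_def is_sheaf_iff[of \<U>]
  using sheaf_enc[OF sheaf_fn decodes_inv[OF inj_code_fun[OF U]]] decodes_inv[OF inj_code_fun[OF U]]
  by (intro conjI exI[of _ "code :: _ \<Rightarrow> 'u"] exI[of _ "inv code"]) (auto simp: U_code_fun)

lemma small_sheaf: "is_sheaf \<U> F \<Longrightarrow> small \<U> F"
proof -
  assume F: "is_sheaf \<U> F"
  have "pres_enc (\<lambda>x. x) (\<lambda>x. x) F = F" by (intro presheaf.equality ext) simp_all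
  moreover have "decodes (\<lambda>x. x) (\<lambda>x. x) F" by (simp add: decodes_def)
  moreover have "presheaf F" using F is_sheaf_iff sheaf_presheaf by blast
  ultimately show ?thesis unfolding small_def using F by metis
qed

lemma is_sheaf_h_P: "is_sheaf \<U> (h_P \<Delta>)"
  unfolding is_sheaf_iff[of \<U>] h_P_eq
  using sheaf_enc[OF sheaf_fn decodes_inv[OF inj_code_fun[OF U]]] by (auto simp: U_code_fun)

lemma small_pair:
  assumes F: "small \<U> F" and G: "small \<U> G" and sF: "sheaf F" and sG: "sheaf G"
  shows "small \<U> (pair F G)"
proof -
  obtain e :: "_ \<Rightarrow> 'u" and d where e: "decodes e d F" "is_sheaf \<U> (pres_enc e d F)"
    using F unfolding small_def by blast
  obtain e' :: "_ \<Rightarrow> 'u" and d' where e': "decodes e' d' G" "is_sheaf \<U> (pres_enc e' d' G)"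
    using G unfolding small_def by blast
  define h :: "_ \<Rightarrow> 'u" where "h z = code (e (fst z), e' (snd z))" for z
  define k where "k v = (case inv code v of (x :: 'u, y :: 'u) \<Rightarrow> (d x, d' y))" for v :: 'u
  have dec: "decodes h k (pair F G)"
    unfolding decodes_def using decodesD[OF e(1)] decodesD[OF e'(1)] by (auto simp: h_def k_def)
  have "sec (pres_enc h k (pair F G)) X \<in> \<U>" if "X \<in> Ob" for X
  proof -
    have "e ` sec F X \<in> \<U>" "e' ` sec G X \<in> \<U>"
      using e(2) e'(2) that unfolding is_sheaf_iff[of \<U>] by auto
    moreover have "sec (pres_enc h k (pair F G)) X = code ` ((e ` sec F X) \<times> (e' ` sec G X))"
      by (force simp: h_def)
    ultimately show ?thesis using U_times by simp
  qed
  then have "is_sheaf \<U> (pres_enc h k (pair F G))"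
    unfolding is_sheaf_iff[of \<U>] using sheaf_enc[OF sheaf_pair[OF sF sG] dec] by blast
  then show ?thesis
    unfolding small_def using dec sheaf_presheaf[OF sF] sheaf_presheaf[OF sG] by auto
qed

lemma is_sheaf_cyl:
  assumes F: "is_sheaf \<U> F"
  shows "is_sheaf \<U> (cyl F \<Delta>)"
proof -
  have sF: "sheaf F" using F is_sheaf_iff by blast
  have "(cenc ` (sec F X \<times> local_dimaps X \<Delta>) :: 'u set) \<in> \<U>" if "X \<in> Ob" for X
  proof -
    have "sec F X \<in> \<U>" using F that unfolding is_sheaf_iff[of \<U>] by auto
    then have "(code ` (sec F X \<times> (code ` local_dimaps X \<Delta> :: 'u set)) :: 'u set) \<in> \<U>"
      using U_times U_code_fun by blast
    moreover have "cenc ` (sec F X \<times> local_dimaps X \<Delta>) = (code ` (sec F X \<times> (code ` local_dimaps X \<Delta> :: 'u set)) :: 'u set)"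
      by (force simp: cenc_def)
    ultimately show ?thesis by simp
  qed
  then show ?thesis
    unfolding is_sheaf_iff[of \<U>] using sheaf_enc[OF sheaf_pair[OF sF sheaf_fn] decodes_cenc] by simp
qed

lemma is_sheaf_sub:
  assumes "is_sheaf \<U> F" "subpsh F S" "\<And>X. X \<in> Ob \<Longrightarrow> loc F S X \<subseteq> S X"
  shows "is_sheaf \<U> (F\<lparr>sec := S\<rparr>)"
proof -
  have "sheaf (F\<lparr>sec := S\<rparr>)" by (rule sheaf_subsheaf[OF _ assms(2,3)]) (use assms(1) is_sheaf_iff in blast)
  moreover have "S X \<in> \<U>" if X: "X \<in> Ob" for X
    by (rule U_subset[of "sec F X"]) (use assms(1) X subpshD[OF assms(2) X] in \<open>auto simp: is_sheaf_iff[of \<U>]\<close>)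
  ultimately show ?thesis by (simp add: is_sheaf_iff[of \<U>])
qed

text \<open>An exponential fits into the universe because a pair of an arrow of the site and a local dimap
  on its domain can be stored in a single element of \<open>epo_map\<close>.\<close>

lemma expo_encoding:
  assumes T: "is_sheaf \<U> T"
  obtains J :: "_ \<Rightarrow> 'u" and J' where "decodes J J' (expo \<Delta> T)" "is_sheaf \<U> (pres_enc J J' (expo \<Delta> T))"
proof -
  have sT: "sheaf T" using T is_sheaf_iff by blast
  define A where "A = insert undefined (\<Union>X\<in>Ob. sec T X)"
  have AU: "A \<in> \<U>" unfolding A_def
    by (intro U_insert U_UN_epo) (use T in \<open>simp add: is_sheaf_iff[of \<U>]\<close>)
  \<comment> \<open>Coordinate 0 of the new map stores the real number \<open>k p\<close>, and the
    coordinates of \<open>f p\<close> move up by one.\<close>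
  define e :: "epo_map \<times> ((nat \<Rightarrow> real) \<Rightarrow> real) \<Rightarrow> epo_map"
    where "e = (\<lambda>((Y, f, X), k). (Y, \<lambda>p (n :: nat). case n of 0 \<Rightarrow> k p | Suc m \<Rightarrow> f p m, X))"
  have "inj e"
  proof (rule injI)
    fix z z' assume eq: "e z = e z'"
    obtain Y f X k where z: "z = ((Y, f, X), k)" by (metis surj_pair)
    obtain Y' f' X' k' where z': "z' = ((Y', f', X'), k')" by (metis surj_pair)
    have *: "(case n :: nat of 0 \<Rightarrow> k p | Suc m \<Rightarrow> f p m) = (case n of 0 \<Rightarrow> k' p | Suc m \<Rightarrow> f' p m)" for n p
      using eq by (simp add: z z' e_def fun_eq_iff)
    have "k = k'" "f = f'" using *[where n = 0] *[where n = "Suc m" for m] by (auto simp: fun_eq_iff)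
    then show "z = z'" using eq by (simp add: z z' e_def)
  qed
  then obtain J :: "(epo_map \<times> ((nat \<Rightarrow> real) \<Rightarrow> real) \<Rightarrow> 'u) \<Rightarrow> 'u" and B where
    B: "B \<in> \<U>" "inj_on J {\<psi>. range \<psi> \<subseteq> A}" "J ` {\<psi>. range \<psi> \<subseteq> A} \<subseteq> B"
    by (rule U_fun[OF AU])
  have rng: "range \<psi> \<subseteq> A" if "\<psi> \<in> sec (expo \<Delta> T) X" for \<psi> X
  proof
    fix y assume "y \<in> range \<psi>"
    then obtain a k where y: "y = \<psi> (a, k)" by auto
    show "y \<in> A"
    proof (cases "valid \<Delta> X a k")
      case True
      then have "a \<in> Ar" by (simp add: valid_def)
      then show ?thesis using expo_sec[OF that True] unfolding A_def y by (intro insertI2 UN_I[of "dm a"]) simp_all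
    qed (use expo_undefined[OF that] in \<open>simp add: A_def y\<close>)
  qed
  have dec: "decodes J (inv_into {\<psi>. range \<psi> \<subseteq> A} J) (expo \<Delta> T)"
    unfolding decodes_def using rng inv_into_f_f[OF B(2)] by blast
  have "J ` sec (expo \<Delta> T) X \<in> \<U>" for X
    by (rule U_subset[OF B(1)]) (use B(3) rng in blast)
  then have "is_sheaf \<U> (pres_enc J (inv_into {\<psi>. range \<psi> \<subseteq> A} J) (expo \<Delta> T))"
    unfolding is_sheaf_iff[of \<U>] using sheaf_enc[OF sheaf_expo[OF sT] dec] by simp
  then show ?thesis using that dec by blast
qed

subsection \<open>Arrows\<close>

abbreviation SC where "SC \<equiv> sheaf_cat \<U>"

lemma SC_Obj [simp]: "F \<in> Obj SC \<longleftrightarrow> is_sheaf \<U> F"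
  by (simp add: sheaf_cat_def)

lemma SC_dom_cod: "Dom SC f = fst f" "Cod SC f = snd (snd f)"
  by (simp_all add: sheaf_cat_def split: prod.split)

lemma Hom_Arr: "f \<in> Hom SC F G \<Longrightarrow> f \<in> Arr SC"
  by (simp add: Hom_def)

lemma Arr_Hom: "f \<in> Arr SC \<Longrightarrow> f \<in> Hom SC (Dom SC f) (Cod SC f)"
  by (simp add: Hom_def)

lemma Hom_iff: "f \<in> Hom SC F G \<longleftrightarrow> fst f = F \<and> snd (snd f) = G \<and> is_sheaf \<U> F \<and> is_sheaf \<U> G \<and>
    natural F (sec F) G (ap f) \<and> ap f \<in> (\<Pi>\<^sub>E X\<in>Ob. sec F X \<rightarrow>\<^sub>E sec G X)"
proof -
  obtain F' \<eta> G' where f: "f = (F', \<eta>, G')" by (rule prod_cases3)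
  have "\<eta> X x \<in> sec G' X" if "\<eta> \<in> (\<Pi>\<^sub>E X\<in>Ob. sec F' X \<rightarrow>\<^sub>E sec G' X)" "X \<in> Ob" "x \<in> sec F' X" for X x
    by (rule PiE_mem[OF PiE_mem[OF that(1,2)] that(3)])
  then show ?thesis
    unfolding Hom_def sheaf_cat_def f natural_def by auto
qed

lemma HomD:
  assumes "f \<in> Hom SC F G"
  shows "fst f = F" "Dom SC f = F" "Cod SC f = G" "is_sheaf \<U> F" "is_sheaf \<U> G" "natural F (sec F) G (ap f)"
  using assms by (auto simp: Hom_iff SC_dom_cod)

lemma Hom_sheaf:
  assumes "f \<in> Hom SC F G"
  shows "sheaf F" "sheaf G" "presheaf F" "presheaf G"
  using HomD(4,5)[OF assms] is_sheaf_iff sheaf_presheaf by blast+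

lemma arr_Hom: "is_sheaf \<U> F \<Longrightarrow> is_sheaf \<U> G \<Longrightarrow> natural F (sec F) G \<eta> \<Longrightarrow> arr F \<eta> G \<in> Hom SC F G"
proof -
  assume F: "is_sheaf \<U> F" and G: "is_sheaf \<U> G" and n: "natural F (sec F) G \<eta>"
  have p: "presheaf F" using F is_sheaf_iff sheaf_presheaf by blast
  have "natural F (sec F) G (ap (arr F \<eta> G))"
    by (rule natural_cong[OF n subpsh_sec[OF p]]) (simp add: arr_def)
  moreover have "ap (arr F \<eta> G) \<in> (\<Pi>\<^sub>E X\<in>Ob. sec F X \<rightarrow>\<^sub>E sec G X)"
    using naturalD[OF n] by (intro PiE_I) (simp_all add: arr_def)
  ultimately show ?thesis using F G by (simp add: Hom_iff arr_def)
qed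

lemma ap_arr [simp]: "X \<in> Ob \<Longrightarrow> x \<in> sec F X \<Longrightarrow> ap (arr F \<eta> G) X x = \<eta> X x"
  by (simp add: arr_def)

lemma Hom_eqI:
  assumes f: "f \<in> Hom SC F G" and g: "g \<in> Hom SC F G"
    and "\<And>X x. X \<in> Ob \<Longrightarrow> x \<in> sec F X \<Longrightarrow> ap f X x = ap g X x"
  shows "f = g"
proof -
  have pf: "ap f \<in> (\<Pi>\<^sub>E X\<in>Ob. sec F X \<rightarrow>\<^sub>E sec G X)" "ap g \<in> (\<Pi>\<^sub>E X\<in>Ob. sec F X \<rightarrow>\<^sub>E sec G X)"
    using f g by (simp_all add: Hom_iff)
  have "ap f = ap g"
  proof (rule PiE_ext[OF pf])
    fix X assume X: "X \<in> Ob"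
    show "ap f X = ap g X"
      by (rule PiE_ext[OF PiE_mem[OF pf(1) X] PiE_mem[OF pf(2) X]]) (rule assms(3)[OF X])
  qed
  then show ?thesis using f g by (auto simp: Hom_iff prod_eq_iff)
qed

lemma Cmp_eq: "f \<in> Hom SC F G \<Longrightarrow> g \<in> Hom SC G H \<Longrightarrow> Cmp SC g f = arr F (\<lambda>X x. ap g X (ap f X x)) H"
proof -
  assume f: "f \<in> Hom SC F G" and g: "g \<in> Hom SC G H"
  obtain F' \<alpha> G' where f': "f = (F', \<alpha>, G')" by (rule prod_cases3)
  obtain G'' \<beta> H' where g': "g = (G'', \<beta>, H')" by (rule prod_cases3)
  have "f = (F, \<alpha>, G)" "g = (G, \<beta>, H)" using f g by (simp_all add: Hom_iff f' g')
  then show ?thesis by (simp add: sheaf_cat_def arr_def compose_def)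
qed

lemma Cmp_Hom [simp]:
  assumes f: "f \<in> Hom SC F G" and g: "g \<in> Hom SC G H"
  shows "Cmp SC g f \<in> Hom SC F H"
  unfolding Cmp_eq[OF f g]
  by (rule arr_Hom[OF HomD(4)[OF f] HomD(5)[OF g] natural_comp[OF HomD(6)[OF f] HomD(6)[OF g]]])
    (rule naturalD[OF HomD(6)[OF f]])

lemma ap_Cmp: "f \<in> Hom SC F G \<Longrightarrow> g \<in> Hom SC G H \<Longrightarrow> X \<in> Ob \<Longrightarrow> x \<in> sec F X \<Longrightarrow>
    ap (Cmp SC g f) X x = ap g X (ap f X x)"
  by (simp add: Cmp_eq)

lemma Idn_eq: "Idn SC F = arr F (\<lambda>X x. x) F"
  by (simp add: sheaf_cat_def arr_def)

lemma Idn_Hom: "is_sheaf \<U> F \<Longrightarrow> Idn SC F \<in> Hom SC F F"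
  unfolding Idn_eq by (intro arr_Hom natural_id) (auto simp: is_sheaf_iff[of \<U>] sheaf_presheaf)

lemma Idn_Cmp: "f \<in> Hom SC F G \<Longrightarrow> Cmp SC f (Idn SC F) = f" "f \<in> Hom SC F G \<Longrightarrow> Cmp SC (Idn SC G) f = f"
proof -
  assume f: "f \<in> Hom SC F G"
  note F = Idn_Hom[OF HomD(4)[OF f]] and G = Idn_Hom[OF HomD(5)[OF f]]
  show "Cmp SC f (Idn SC F) = f"
    by (rule Hom_eqI[OF Cmp_Hom[OF F f] f]) (simp add: ap_Cmp[OF F f], simp add: Idn_eq)
  show "Cmp SC (Idn SC G) f = f"
    by (rule Hom_eqI[OF Cmp_Hom[OF f G] f])
      (use naturalD[OF HomD(6)[OF f]] in \<open>simp add: ap_Cmp[OF f G], simp add: Idn_eq\<close>)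
qed

section \<open>Images and monos\<close>

lemma im_eq: "f \<in> Hom SC F G \<Longrightarrow> im f X = ap f X ` sec F X"
  by (simp add: im_def HomD)

lemma im_Cmp: "f \<in> Hom SC F G \<Longrightarrow> g \<in> Hom SC G H \<Longrightarrow> X \<in> Ob \<Longrightarrow> im (Cmp SC g f) X \<subseteq> im g X"
proof -
  assume h: "f \<in> Hom SC F G" "g \<in> Hom SC G H" "X \<in> Ob"
  show ?thesis
    using naturalD[OF HomD(6)[OF h(1)] h(3)]
    by (auto simp: im_eq[OF Cmp_Hom[OF h(1,2)]] im_eq[OF h(2)] ap_Cmp[OF h])
qed

lemma subpsh_im:
  assumes f: "f \<in> Hom SC F G"
  shows "subpsh G (im f)"
  unfolding subpsh_def im_eq[OF f]
proof (intro conjI ballI)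
  fix X assume X: "X \<in> Ob"
  show "ap f X ` sec F X \<subseteq> sec G X" using naturalD[OF HomD(6)[OF f] X] by blast
next
  fix a y assume a: "a \<in> Ar" and "y \<in> ap f (cd a) ` sec F (cd a)"
  then obtain x where x: "x \<in> sec F (cd a)" "y = ap f (cd a) x" by blast
  show "res G a y \<in> ap f (dm a) ` sec F (dm a)"
    using natural_res[OF HomD(6)[OF f] a x(1)] presheaf_res[OF Hom_sheaf(3)[OF f] a x(1)] x(2) by (metis imageI)
qed

text \<open>Two parallel sections with the same image form a section of the kernel pair.\<close>

lemma mono_inj:
  assumes m: "m \<in> Monos SC" "m \<in> Hom SC A B" and X: "X \<in> Ob" and xy: "x \<in> sec A X" "y \<in> sec A X"
    and eq: "ap m X x = ap m X y"
  shows "x = y"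
proof -
  note nat = HomD(6)[OF m(2)]
  have pA: "presheaf A" and sA: "sheaf A" and sB: "sheaf B" using Hom_sheaf[OF m(2)] by simp_all
  define S where "S X = {z \<in> sec A X \<times> sec A X. ap m X (fst z) = ap m X (snd z)}" for X
  define K where "K = (pair A A)\<lparr>sec := S\<rparr>"
  have subS: "subpsh (pair A A) S"
    unfolding subpsh_def
  proof (intro conjI ballI)
    fix X show "S X \<subseteq> sec (pair A A) X" by (auto simp: S_def)
  next
    fix a z assume "a \<in> Ar" "z \<in> S (cd a)"
    then show "res (pair A A) a z \<in> S (dm a)"
      using pA natural_res[OF nat, of a] by (cases z) (simp add: S_def)
  qed
  have "sheaf K"
    unfolding K_def
  proof (rule sheaf_subsheaf[OF sheaf_pair[OF sA sA] subS])
    fix X assume X: "X \<in> Ob"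
    show "loc (pair A A) S X \<subseteq> S X"
    proof
      fix z assume z: "z \<in> loc (pair A A) S X"
      obtain u v where uv: "z = (u, v)" by (cases z)
      have s: "u \<in> sec A X" "v \<in> sec A X" using loc_sec[OF z] uv by auto
      obtain \<C> where C: "open_dicover X \<C>" "\<forall>U\<in>\<C>. rst (pair A A) X U z \<in> S (sub_ospace X U)"
        using z unfolding loc_def by blast
      have "ap m X u = ap m X v"
      proof (rule separated[OF sB X C(1) naturalD[OF nat X s(1)] naturalD[OF nat X s(2)]])
        fix U assume U: "U \<in> \<C>"
        have o: "openin (fst X) U" using cover_open[OF C(1) U] .
        show "rst B X U (ap m X u) = rst B X U (ap m X v)"
          using natural_rst[OF nat X o s(1)] natural_rst[OF nat X o s(2)] C(2) U uv by (auto simp: S_def)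
      qed
      then show "z \<in> S X" using uv s by (simp add: S_def)
    qed
  qed
  have dec: "decodes code (inv code :: 'u \<Rightarrow> 'u \<times> 'u) K" by (simp add: decodes_def)
  define K' :: "'u presheaf" where "K' = pres_enc code (inv code) K"
  have sK: "sec K X = S X" for X by (simp add: K_def)
  have AU: "sec A X \<in> \<U>" if "X \<in> Ob" for X using HomD(4)[OF m(2)] that by (simp add: is_sheaf_iff[of \<U>])
  have "sec K' X \<in> \<U>" if "X \<in> Ob" for X
    by (rule U_subset[OF U_times[OF AU[OF that] AU[OF that]]]) (auto simp: K'_def sK S_def)
  then have K'U: "is_sheaf \<U> K'"
    unfolding is_sheaf_iff[of \<U>] K'_def using sheaf_enc[OF \<open>sheaf K\<close> dec] by simp
  have n: "natural K' (sec K') A (\<lambda>X v. fst (inv code v :: 'u \<times> 'u))" "natural K' (sec K') A (\<lambda>X v. snd (inv code v :: 'u \<times> 'u))"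
    unfolding natural_def K'_def by (auto simp: sK S_def K_def)
  define p where "p = arr K' (\<lambda>X v. fst (inv code v :: 'u \<times> 'u)) A"
  define q where "q = arr K' (\<lambda>X v. snd (inv code v :: 'u \<times> 'u)) A"
  have pq: "p \<in> Hom SC K' A" "q \<in> Hom SC K' A"
    unfolding p_def q_def by (rule arr_Hom[OF K'U HomD(4)[OF m(2)]], rule n)+
  have "Cmp SC m p = Cmp SC m q"
  proof (rule Hom_eqI[OF Cmp_Hom[OF pq(1) m(2)] Cmp_Hom[OF pq(2) m(2)]])
    fix X v assume X: "X \<in> Ob" and v: "v \<in> sec K' X"
    have "ap p X v = fst (inv code v :: 'u \<times> 'u)" "ap q X v = snd (inv code v :: 'u \<times> 'u)"
      unfolding p_def q_def using X v by simp_all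
    moreover have "ap m X (fst (inv code v :: 'u \<times> 'u)) = ap m X (snd (inv code v :: 'u \<times> 'u))"
      using v by (auto simp: K'_def sK S_def)
    ultimately show "ap (Cmp SC m p) X v = ap (Cmp SC m q) X v"
      by (simp add: ap_Cmp[OF pq(1) m(2) X v] ap_Cmp[OF pq(2) m(2) X v])
  qed
  then have "p = q" using m pq unfolding Monos_def by (auto simp: HomD(2)[OF m(2)])
  moreover have "code (x, y) \<in> sec K' X" using xy eq by (auto simp: K'_def sK S_def)
  ultimately show ?thesis
    using ap_arr[OF X, of "code (x, y)" K' "\<lambda>X v. fst (inv code v :: 'u \<times> 'u)" A]
      ap_arr[OF X, of "code (x, y)" K' "\<lambda>X v. snd (inv code v :: 'u \<times> 'u)" A]
    by (simp add: p_def q_def)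
qed

lemma inj_mono:
  assumes m: "m \<in> Hom SC A B"
    and inj: "\<And>X x y. X \<in> Ob \<Longrightarrow> x \<in> sec A X \<Longrightarrow> y \<in> sec A X \<Longrightarrow> ap m X x = ap m X y \<Longrightarrow> x = y"
  shows "m \<in> Monos SC"
  unfolding Monos_def
proof (intro CollectI conjI allI ballI impI)
  show "m \<in> Arr SC" using m by (rule Hom_Arr)
  fix Z f g assume "f \<in> Hom SC Z (Dom SC m)" "g \<in> Hom SC Z (Dom SC m)" and eq: "Cmp SC m f = Cmp SC m g"
  then have fg: "f \<in> Hom SC Z A" "g \<in> Hom SC Z A" by (simp_all add: HomD(2)[OF m])
  show "f = g"
  proof (rule Hom_eqI[OF fg])
    fix X x assume X: "X \<in> Ob" and x: "x \<in> sec Z X"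
    show "ap f X x = ap g X x"
      by (rule inj[OF X naturalD[OF HomD(6)[OF fg(1)] X x] naturalD[OF HomD(6)[OF fg(2)] X x]])
        (use eq ap_Cmp[OF fg(1) m X x] ap_Cmp[OF fg(2) m X x] in simp)
  qed
qed

lemma Monos_Hom: "m \<in> Monos SC \<Longrightarrow> m \<in> Hom SC (Dom SC m) (Cod SC m)"
  by (simp add: Monos_def Arr_Hom)

text \<open>Monos are injective on sections, and the resulting sectionwise inverses commute with
  restriction because \<open>m\<close> does.\<close>

lemma mono_inverse:
  assumes m: "m \<in> Monos SC" "m \<in> Hom SC A B"
  obtains r where "natural B (im m) A r" "\<And>X x. X \<in> Ob \<Longrightarrow> x \<in> sec A X \<Longrightarrow> r X (ap m X x) = x"
proof -
  define r where "r X = inv_into (sec A X) (ap m X)" for X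
  have r: "r X (ap m X x) = x" if "X \<in> Ob" "x \<in> sec A X" for X x
    unfolding r_def by (rule inv_into_f_f[OF inj_onI that(2)]) (rule mono_inj[OF m that(1)])
  have "natural B (im m) A r"
    unfolding natural_def im_eq[OF m(2)]
  proof (intro conjI ballI)
    fix X y assume X: "X \<in> Ob" and "y \<in> ap m X ` sec A X"
    then show "r X y \<in> sec A X" using r[OF X] by auto
  next
    fix a y assume a: "a \<in> Ar" and "y \<in> ap m (cd a) ` sec A (cd a)"
    then obtain x where x: "x \<in> sec A (cd a)" "y = ap m (cd a) x" by blast
    show "r (dm a) (res B a y) = res A a (r (cd a) y)"
      using natural_res[OF HomD(6)[OF m(2)] a x(1), symmetric] r[OF _ x(1)]
        r[OF _ presheaf_res[OF Hom_sheaf(3)[OF m(2)] a x(1)]] a x(2) by simp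
  qed
  then show ?thesis using that r by blast
qed

text \<open>The inverse on the image extends to the closure because \<open>A\<close> is a sheaf.
  Composed with \<open>m\<close> it is the identity there, as it is on the image, so every section
  of the closure is a value of \<open>m\<close>.\<close>

lemma loc_im:
  assumes m: "m \<in> Monos SC" "m \<in> Hom SC A B" and X: "X \<in> Ob" and y: "y \<in> loc B (im m) X"
  shows "y \<in> im m X"
proof -
  note sub = subpsh_im[OF m(2)] and shs = Hom_sheaf[OF m(2)]
  obtain r where r: "natural B (im m) A r" "\<And>X x. X \<in> Ob \<Longrightarrow> x \<in> sec A X \<Longrightarrow> r X (ap m X x) = x"
    using mono_inverse[OF m] by blast
  obtain \<zeta> where z: "natural B (loc B (im m)) A \<zeta>" "\<forall>X\<in>Ob. \<forall>x\<in>im m X. \<zeta> X x = r X x"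
    by (rule natural_extend_loc[OF shs(4) shs(1) sub r(1)])
  have n1: "natural B (loc B (im m)) B (\<lambda>X y. ap m X (\<zeta> X y))"
    by (rule natural_comp[OF z(1) HomD(6)[OF m(2)]]) (rule naturalD[OF z(1)])
  have n2: "natural B (loc B (im m)) B (\<lambda>X y. y)"
    by (rule natural_subset[OF natural_id[OF shs(4)]]) (auto dest: loc_sec)
  have "ap m X (\<zeta> X y) = y"
  proof (rule natural_eq_loc[OF shs(4,2) n1 n2 _ X y y])
    fix X x assume X: "X \<in> Ob" and x: "x \<in> im m X"
    then show "ap m X (\<zeta> X x) = x" using z(2) r(2) by (auto simp: im_eq[OF m(2)])
  qed
  then show ?thesis using naturalD[OF z(1) X y] unfolding im_eq[OF m(2)] by (metis imageI)
qed

lemma sub_leD: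
  assumes "sub_le SC a w" "w \<in> Arr SC" "X \<in> Ob"
  shows "im a X \<subseteq> im w X"
proof -
  obtain k where k: "k \<in> Hom SC (Dom SC a) (Dom SC w)" "Cmp SC w k = a"
    using assms(1) unfolding sub_le_def by blast
  show ?thesis using im_Cmp[OF k(1) Arr_Hom[OF assms(2)] assms(3)] k(2) by simp
qed

text \<open>The factorization is \<open>a\<close> followed by the inverse of \<open>w\<close> on its
  image. Together with \<open>sub_leD\<close>, comparing subobjects becomes comparing
  images.\<close>

lemma sub_leI:
  assumes a: "a \<in> Hom SC A L" and w: "w \<in> Monos SC" "w \<in> Hom SC W L"
    and s: "\<And>X. X \<in> Ob \<Longrightarrow> im a X \<subseteq> im w X"
  shows "sub_le SC a w"
proof -
  obtain r where r: "natural L (im w) W r" "\<And>X x. X \<in> Ob \<Longrightarrow> x \<in> sec W X \<Longrightarrow> r X (ap w X x) = x"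
    using mono_inverse[OF w] by blast
  have aw: "ap a X x \<in> im w X" if "X \<in> Ob" "x \<in> sec A X" for X x
    using s[OF that(1)] that(2) by (auto simp: im_eq[OF a])
  define k where "k = arr A (\<lambda>X x. r X (ap a X x)) W"
  have k: "k \<in> Hom SC A W"
    unfolding k_def
    by (rule arr_Hom[OF HomD(4)[OF a] HomD(4)[OF w(2)] natural_comp[OF HomD(6)[OF a] r(1) aw]])
  have "Cmp SC w k = a"
  proof (rule Hom_eqI[OF Cmp_Hom[OF k w(2)] a])
    fix X x assume X: "X \<in> Ob" and x: "x \<in> sec A X"
    then obtain y where "y \<in> sec W X" "ap a X x = ap w X y" using aw[OF X x] by (auto simp: im_eq[OF w(2)])
    then show "ap (Cmp SC w k) X x = ap a X x"
      using r(2)[OF X] X x by (simp add: ap_Cmp[OF k w(2)]) (simp add: k_def)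
  qed
  then show ?thesis unfolding sub_le_def using k by (auto simp: HomD(2)[OF a] HomD(2)[OF w(2)])
qed

section \<open>Subsheaves and unions of subobjects\<close>

lemma inc:
  assumes L: "is_sheaf \<U> L" and S: "subpsh L S" and l: "\<forall>X\<in>Ob. loc L S X \<subseteq> S X"
  shows "inc L S \<in> Hom SC (L\<lparr>sec := S\<rparr>) L" "inc L S \<in> Monos SC" "X \<in> Ob \<Longrightarrow> im (inc L S) X = S X"
proof -
  have "natural (L\<lparr>sec := S\<rparr>) S L (\<lambda>X x. x)"
    by (rule naturalI) (simp_all add: subpshD[OF S])
  then show h: "inc L S \<in> Hom SC (L\<lparr>sec := S\<rparr>) L"
    unfolding inc_def by (intro arr_Hom is_sheaf_sub L S l[rule_format]) simp_all
  show "inc L S \<in> Monos SC"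
    by (rule inj_mono[OF h]) (simp add: inc_def)
  show "im (inc L S) X = S X" if "X \<in> Ob"
    using that by (simp add: im_eq[OF h]) (simp add: inc_def)
qed

text \<open>The inclusion of the closure of the sectionwise union is an upper bound of
  \<open>a\<close> and \<open>b\<close>, so any representative of the union factors through it. Its
  image is thereby enclosed between the sectionwise union and the closure.\<close>

lemma is_union_im:
  assumes u: "is_union SC u a b" and a: "a \<in> Hom SC A L" and b: "b \<in> Hom SC B L"
  shows "u \<in> Monos SC" "u \<in> Hom SC (Dom SC u) L" "X \<in> Ob \<Longrightarrow> im a X \<union> im b X \<subseteq> im u X"
    "X \<in> Ob \<Longrightarrow> im u X \<subseteq> loc L (\<lambda>X. im a X \<union> im b X) X"
proof -
  let ?S = "\<lambda>X. im a X \<union> im b X"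
  show uM: "u \<in> Monos SC" using u by (simp add: is_union_def)
  show uH: "u \<in> Hom SC (Dom SC u) L"
    using Monos_Hom[OF uM] u HomD(3)[OF a] by (simp add: is_union_def)
  have uA: "u \<in> Arr SC" using uH by (rule Hom_Arr)
  show "im a X \<union> im b X \<subseteq> im u X" if X: "X \<in> Ob"
    using u sub_leD[OF _ uA X] by (auto simp: is_union_def)
  have S: "subpsh L ?S"
    using subpsh_im[OF a] subpsh_im[OF b] unfolding subpsh_def by blast
  note pL = Hom_sheaf(4)[OF a]
  have l: "\<forall>X\<in>Ob. loc L (loc L ?S) X \<subseteq> loc L ?S X" using loc_loc[OF pL] by blast
  note w = inc[OF HomD(5)[OF a] subpsh_loc[OF pL S] l]
  have sub: "?S X \<subseteq> loc L ?S X" if "X \<in> Ob" for X using subset_loc[OF S that] .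
  have imw: "im (inc L (loc L ?S)) X = loc L ?S X" if "X \<in> Ob" for X by (rule w(3)[OF that])
  have "sub_le SC a (inc L (loc L ?S))" "sub_le SC b (inc L (loc L ?S))"
    by (rule sub_leI[OF a w(2,1)] sub_leI[OF b w(2,1)]; simp add: imw; use sub in blast)+
  then have "sub_le SC u (inc L (loc L ?S))"
    using u w(2) HomD(3)[OF w(1)] HomD(3)[OF uH] unfolding is_union_def by auto
  then show "im u X \<subseteq> loc L ?S X" if X: "X \<in> Ob"
    using sub_leD[OF _ Hom_Arr[OF w(1)] X] w(3)[OF X] by blast
qed

text \<open>Minimality holds because images of monos are closed under \<open>loc\<close>: a mono
  that contains both images contains the closure of their union. This provides concrete members of
  \<open>Lambda0\<close>.\<close>

lemma is_union_inc:
  assumes a: "a \<in> Hom SC A L" and b: "b \<in> Hom SC B L"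
  shows "is_union SC (inc L (loc L (\<lambda>X. im a X \<union> im b X))) a b"
proof -
  let ?S = "\<lambda>X. im a X \<union> im b X"
  have S: "subpsh L ?S"
    using subpsh_im[OF a] subpsh_im[OF b] unfolding subpsh_def by blast
  note pL = Hom_sheaf(4)[OF a]
  have l: "\<forall>X\<in>Ob. loc L (loc L ?S) X \<subseteq> loc L ?S X" using loc_loc[OF pL] by blast
  note w = inc[OF HomD(5)[OF a] subpsh_loc[OF pL S] l]
  have sub: "?S X \<subseteq> loc L ?S X" if "X \<in> Ob" for X using subset_loc[OF S that] .
  have imw: "im (inc L (loc L ?S)) X = loc L ?S X" if "X \<in> Ob" for X by (rule w(3)[OF that])
  have "sub_le SC a (inc L (loc L ?S))" "sub_le SC b (inc L (loc L ?S))"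
    by (rule sub_leI[OF a w(2,1)] sub_leI[OF b w(2,1)]; simp add: imw; use sub in blast)+
  moreover have "sub_le SC (inc L (loc L ?S)) v"
    if v: "v \<in> Monos SC" "Cod SC v = L" "sub_le SC a v" "sub_le SC b v" for v
  proof (rule sub_leI[OF w(1) v(1)])
    show vH: "v \<in> Hom SC (Dom SC v) L" using Monos_Hom[OF v(1)] v(2) by simp
    fix X assume X: "X \<in> Ob"
    have "?S X \<subseteq> im v X" if "X \<in> Ob" for X
      using sub_leD[OF v(3) Hom_Arr[OF vH] that] sub_leD[OF v(4) Hom_Arr[OF vH] that] by blast
    then have "loc L ?S X \<subseteq> loc L (im v) X" by (rule loc_mono[OF _ X])
    then show "im (inc L (loc L ?S)) X \<subseteq> im v X"
      using loc_im[OF v(1) vH X] w(3)[OF X] by blast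
  qed
  ultimately show ?thesis
    unfolding is_union_def using w(2) HomD(3)[OF w(1)] HomD(3)[OF a] HomD(3)[OF b] by simp
qed

section \<open>Lifting against maps to a terminal object\<close>

lemma terminal_Hom:
  assumes "terminal SC t" "is_sheaf \<U> F"
  shows "\<exists>f. f \<in> Hom SC F t" "f \<in> Hom SC F t \<Longrightarrow> g \<in> Hom SC F t \<Longrightarrow> f = g"
  using assms unfolding terminal_def by (metis SC_Obj)+

text \<open>Over a terminal object both the square and the lower triangle commute automatically, so
  only the upper triangle carries information.\<close>

lemma lifts_imp_ext:
  assumes u: "u \<in> Monos SC" "u \<in> Hom SC K L" and f: "f \<in> Hom SC T t" and t: "terminal SC t"
    and l: "lifts SC u f"
  shows "ext L (im u) T"
proof (rule extI)
  fix \<eta> assume \<eta>: "natural L (im u) T \<eta>"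
  have uim: "ap u X x \<in> im u X" if "X \<in> Ob" "x \<in> sec K X" for X x
    using that by (simp add: im_eq[OF u(2)])
  define g where "g = arr K (\<lambda>X x. \<eta> X (ap u X x)) T"
  have g: "g \<in> Hom SC K T"
    unfolding g_def
    by (rule arr_Hom[OF HomD(4)[OF u(2)] HomD(4)[OF f] natural_comp[OF HomD(6)[OF u(2)] \<eta> uim]])
  obtain v where v: "v \<in> Hom SC L t" using terminal_Hom(1)[OF t HomD(5)[OF u(2)]] by blast
  have "Cmp SC f g = Cmp SC v u"
    by (rule terminal_Hom(2)[OF t HomD(4)[OF u(2)] Cmp_Hom[OF g f] Cmp_Hom[OF u(2) v]])
  then obtain d where d: "d \<in> Hom SC L T" "Cmp SC d u = g"
    using l g v unfolding lifts_def HomD(2,3)[OF u(2)] HomD(2,3)[OF f] by blast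
  have "\<forall>X\<in>Ob. \<forall>y\<in>im u X. ap d X y = \<eta> X y"
  proof (intro ballI)
    fix X y assume X: "X \<in> Ob" and "y \<in> im u X"
    then obtain x where x: "x \<in> sec K X" "y = ap u X x" by (auto simp: im_eq[OF u(2)])
    show "ap d X y = \<eta> X y"
      using ap_Cmp[OF u(2) d(1) X x(1)] d(2) X x by (simp add: g_def)
  qed
  then show "\<exists>\<zeta>. natural L (sec L) T \<zeta> \<and> (\<forall>X\<in>Ob. \<forall>x\<in>im u X. \<zeta> X x = \<eta> X x)"
    using HomD(6)[OF d(1)] by blast
qed

lemma ext_imp_lifts:
  assumes u: "u \<in> Monos SC" "u \<in> Hom SC K L" and f: "f \<in> Hom SC T t" and t: "terminal SC t"
    and l: "ext L (im u) T"
  shows "lifts SC u f"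
  unfolding lifts_def HomD(2,3)[OF u(2)] HomD(2,3)[OF f]
proof (intro ballI impI)
  fix g v assume g: "g \<in> Hom SC K T" and v: "v \<in> Hom SC L t"
  obtain r where r: "natural L (im u) K r" "\<And>X x. X \<in> Ob \<Longrightarrow> x \<in> sec K X \<Longrightarrow> r X (ap u X x) = x"
    using mono_inverse[OF u] by blast
  have "natural L (im u) T (\<lambda>X y. ap g X (r X y))"
    by (rule natural_comp[OF r(1) HomD(6)[OF g]]) (rule naturalD[OF r(1)])
  then obtain \<zeta> where z: "natural L (sec L) T \<zeta>" "\<forall>X\<in>Ob. \<forall>x\<in>im u X. \<zeta> X x = ap g X (r X x)"
    using extD[OF l] by blast
  define d where "d = arr L \<zeta> T"
  have d: "d \<in> Hom SC L T" unfolding d_def by (rule arr_Hom[OF HomD(5)[OF u(2)] HomD(4)[OF f] z(1)])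
  have "Cmp SC d u = g"
  proof (rule Hom_eqI[OF Cmp_Hom[OF u(2) d] g])
    fix X x assume X: "X \<in> Ob" and x: "x \<in> sec K X"
    have "ap u X x \<in> im u X" "ap u X x \<in> sec L X"
      using x naturalD[OF HomD(6)[OF u(2)] X x] by (simp_all add: im_eq[OF u(2)])
    then show "ap (Cmp SC d u) X x = ap g X x"
      using z(2) r(2)[OF X x] X by (simp add: ap_Cmp[OF u(2) d X x]) (simp add: d_def)
  qed
  moreover have "Cmp SC f d = v"
    by (rule terminal_Hom(2)[OF t HomD(5)[OF u(2)] Cmp_Hom[OF d f] v])
  ultimately show "\<exists>d\<in>Hom SC L T. Cmp SC d u = g \<and> Cmp SC f d = v" using d by blast
qed

end

section \<open>Currying and the interval cylinders\<close>

text \<open>A map on \<open>S\<close> first extends to the closure, since \<open>T\<close> is a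
  sheaf, and its restriction to \<open>S'\<close> is then a datum for the assumed extension
  property.\<close>

lemma ext_to_sub:
  assumes "presheaf F" "sheaf T" "subpsh F S" "subpsh F S'"
    "\<And>X. X \<in> Ob \<Longrightarrow> S X \<subseteq> S' X" "\<And>X. X \<in> Ob \<Longrightarrow> S' X \<subseteq> loc F S X" "ext F S' T"
  shows "ext F S T"
proof (rule extI)
  fix \<eta> assume e: "natural F S T \<eta>"
  obtain \<zeta> where z: "natural F (loc F S) T \<zeta>" "\<forall>X\<in>Ob. \<forall>x\<in>S X. \<zeta> X x = \<eta> X x"
    by (rule natural_extend_loc[OF assms(1-3) e])
  have "natural F S' T \<zeta>" using z(1) assms(6) by (rule natural_subset)
  then obtain \<xi> where "natural F (sec F) T \<xi>" "\<forall>X\<in>Ob. \<forall>x\<in>S' X. \<xi> X x = \<zeta> X x"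
    using extD[OF assms(7)] by blast
  then show "\<exists>\<zeta>. natural F (sec F) T \<zeta> \<and> (\<forall>X\<in>Ob. \<forall>x\<in>S X. \<zeta> X x = \<eta> X x)"
    using z(2) assms(5) by (intro exI[of _ \<xi>]) (auto simp: subset_iff)
qed

text \<open>A section that belongs through its first coordinate inherits the cover of that
  coordinate; one that belongs through \<open>R\<close> is handled by the trivial cover.\<close>

lemma pp_loc:
  assumes F: "presheaf F" and G: "presheaf G" and R: "subpsh G R"
    and S: "\<And>X. X \<in> Ob \<Longrightarrow> S' X \<subseteq> loc F S X" and X: "X \<in> Ob"
  shows "pp F S' G R X \<subseteq> loc (pair F G) (pp F S G R) X"
proof
  fix z assume "z \<in> pp F S' G R X"
  then obtain x y where z: "z = (x, y)" "x \<in> sec F X" "y \<in> sec G X" and c: "x \<in> S' X \<or> y \<in> R X"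
    by (elim mem_ppE)
  have rs: "rst F X V x \<in> sec F (sub_ospace X V)" "rst G X V y \<in> sec G (sub_ospace X V)" if "openin (fst X) V" for V
    using that z X F G by simp_all
  obtain \<C> where C: "open_dicover X \<C>"
    "\<forall>V\<in>\<C>. rst F X V x \<in> S (sub_ospace X V) \<or> rst G X V y \<in> R (sub_ospace X V)"
  proof (cases "x \<in> S' X")
    case True
    then have "x \<in> loc F S X" using S[OF X] by blast
    then obtain \<C> where "open_dicover X \<C>" "\<forall>V\<in>\<C>. rst F X V x \<in> S (sub_ospace X V)"
      unfolding loc_def by blast
    then show ?thesis using that by blast
  next
    case False
    then have "y \<in> R X" using c by blast
    then have "rst G X V y \<in> R (sub_ospace X V)" if "openin (fst X) V" for V
      using subpsh_res[OF R, of "incl X V" y] that X by simp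
    then show ?thesis using that[OF self_cover[of X]] by simp
  qed
  then show "z \<in> loc (pair F G) (pp F S G R) X"
    unfolding loc_def using z rs[OF cover_open[OF C(1)]] by auto
qed

text \<open>The usual transpose for presheaves: evaluation at \<open>(a, k)\<close> restricts
  \<open>x\<close> along \<open>a\<close> first.\<close>

lemma natural_curry:
  assumes F: "presheaf F" and S: "subpsh F S"
    and G: "natural (pair F (fn \<Delta>)) (\<lambda>X. S X \<times> local_dimaps X \<Delta>) T G"
  shows "natural F S (expo \<Delta> T) (\<lambda>X x (a, k). if valid \<Delta> X a k then G (dm a) (res F a x, k) else undefined)"
    (is "natural F S _ ?c")
proof (rule naturalI)
  fix X x assume X: "X \<in> Ob" and x: "x \<in> S X"
  have ra: "res F a x \<in> S (dm a)" if "valid \<Delta> X a k" for a k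
    using subpsh_res[OF S, of a x] that x by (simp add: valid_def)
  show "?c X x \<in> sec (expo \<Delta> T) X"
  proof (rule sec_expoI)
    fix a k assume v: "valid \<Delta> X a k"
    then have a: "a \<in> Ar" "cd a = X" "k \<in> local_dimaps (dm a) \<Delta>" by (simp_all add: valid_def)
    show "?c X x (a, k) \<in> sec T (dm a)"
      using naturalD[OF G, of "dm a" "(res F a x, k)"] ra[OF v] a v by simp
    fix b assume b: "b \<in> Ar" "cd b = dm a"
    have "res F (a \<odot> b) x = res F b (res F a x)"
      using presheaf_cmp[OF F b(1) a(1) b(2)] a(2) subpshD[OF S X x] by simp
    then show "?c X x (a \<odot> b, res (fn \<Delta>) b k) = res T b (?c X x (a, k))"
      using natural_res[OF G b(1), of "(res F a x, k)"] ra[OF v] valid_res[OF v b] v a b by simp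
  qed simp
next
  fix c x assume c: "c \<in> Ar" and x: "x \<in> S (cd c)"
  have xs: "x \<in> sec F (cd c)" using subpshD[OF S _ x] c by simp
  show "?c (dm c) (res F c x) = res (expo \<Delta> T) c (?c (cd c) x)"
  proof (rule HOL.ext)
    fix z :: "epo_map \<times> ((nat \<Rightarrow> real) \<Rightarrow> real)"
    obtain a k where z: "z = (a, k)" by (cases z)
    show "?c (dm c) (res F c x) z = res (expo \<Delta> T) c (?c (cd c) x) z"
    proof (cases "valid \<Delta> (dm c) a k")
      case True
      then have a: "a \<in> Ar" "cd a = dm c" by (simp_all add: valid_def)
      then show ?thesis
        using True valid_cmp[OF True c] c presheaf_cmp[OF F a(1) c a(2) xs] by (simp add: res_expo z)
    qed (simp add: res_expo z)
  qed
qed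

lemma natural_uncurry:
  assumes S: "subpsh F S" and g: "natural F S (expo \<Delta> T) \<gamma>"
  shows "natural (pair F (fn \<Delta>)) (\<lambda>X. S X \<times> local_dimaps X \<Delta>) T (\<lambda>X z. \<gamma> X (fst z) (idm X, snd z))"
proof (rule naturalI)
  fix X z assume X: "X \<in> Ob" and "z \<in> S X \<times> local_dimaps X \<Delta>"
  then obtain x k where z: "z = (x, k)" "x \<in> S X" "k \<in> local_dimaps X \<Delta>" by auto
  show "\<gamma> X (fst z) (idm X, snd z) \<in> sec T X"
    using expo_sec[OF naturalD[OF g X z(2)] valid_idm[OF X z(3)]] X z(1) by simp
next
  fix a z assume a: "a \<in> Ar" and "z \<in> S (cd a) \<times> local_dimaps (cd a) \<Delta>"
  then obtain x k where z: "z = (x, k)" "x \<in> S (cd a)" "k \<in> local_dimaps (cd a) \<Delta>" by auto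
  have X: "cd a \<in> Ob" using a by simp
  have v: "valid \<Delta> (dm a) (idm (dm a)) (res (fn \<Delta>) a k)"
    using valid_idm[of "dm a" "res (fn \<Delta>) a k"] res_fn_sec[OF a z(3)] a by simp
  have "\<gamma> (dm a) (res F a x) (idm (dm a), res (fn \<Delta>) a k) = \<gamma> (cd a) x (a, res (fn \<Delta>) a k)"
    using natural_res[OF g a z(2)] v a by (simp add: res_expo)
  also have "\<dots> = res T a (\<gamma> (cd a) x (idm (cd a), k))"
    using expo_res[OF naturalD[OF g X z(2)] valid_idm[OF X z(3)] a] a X by simp
  finally show "\<gamma> (dm a) (fst (res (pair F (fn \<Delta>)) a z)) (idm (dm a), snd (res (pair F (fn \<Delta>)) a z)) =
    res T a (\<gamma> (cd a) (fst z) (idm (cd a), snd z))"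
    using z by simp
qed

text \<open>Naturality along \<open>a\<close> reduces the value at \<open>(a, k)\<close> to one at
  an identity, so uncurrying loses no information.\<close>

lemma uncurry_eval:
  assumes g: "natural F S (expo \<Delta> T) \<gamma>" and X: "X \<in> Ob" "x \<in> S X" and v: "valid \<Delta> X a k"
  shows "\<gamma> (dm a) (res F a x) (idm (dm a), k) = \<gamma> X x (a, k)"
proof -
  have a: "a \<in> Ar" "cd a = X" "k \<in> local_dimaps (dm a) \<Delta>" using v by (simp_all add: valid_def)
  show ?thesis
    using natural_res[OF g a(1), of x] a X valid_idm[of "dm a" k \<Delta>] by (simp add: res_expo)
qed

text \<open>The extension problem along the pushout product with the end \<open>0\<close>, transposed: a lifting
  problem for \<open>S \<subseteq> L\<close> against evaluation at \<open>0\<close>.\<close>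

definition ev_ext :: "'b presheaf \<Rightarrow> (epo \<Rightarrow> 'b set) \<Rightarrow> 'c presheaf \<Rightarrow> bool" where
  "ev_ext L S T \<longleftrightarrow> (\<forall>\<gamma> g. natural L S (expo Delta_d T) \<gamma> \<longrightarrow> natural L (sec L) T g \<longrightarrow>
     (\<forall>X\<in>Ob. \<forall>x\<in>S X. \<gamma> X x (idm X, cst X 0) = g X x) \<longrightarrow>
     (\<exists>\<Gamma>. natural L (sec L) (expo Delta_d T) \<Gamma> \<and> (\<forall>X\<in>Ob. \<forall>x\<in>S X. \<Gamma> X x = \<gamma> X x) \<and>
        (\<forall>X\<in>Ob. \<forall>x\<in>sec L X. \<Gamma> X x (idm X, cst X 0) = g X x)))"

lemma ev_ext_iff:
  assumes L: "presheaf L" and S: "subpsh L S"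
  shows "ev_ext L S T \<longleftrightarrow> ext (pair L fnd) (pp L S fnd (pt 0)) T"
proof
  assume e: "ev_ext L S T"
  show "ext (pair L fnd) (pp L S fnd (pt 0)) T"
  proof (rule extI)
    fix \<eta> assume \<eta>: "natural (pair L fnd) (pp L S fnd (pt 0)) T \<eta>"
    let ?c = "\<lambda>X x (a, k). if valid Delta_d X a k then \<eta> (dm a) (res L a x, k) else undefined"
    have "natural (pair L fnd) (\<lambda>X. S X \<times> local_dimaps X Delta_d) T \<eta>"
      using \<eta> by (rule natural_subset) (use subpshD[OF S] in auto)
    then have c: "natural L S (expo Delta_d T) ?c" by (rule natural_curry[OF L S])
    have g: "natural L (sec L) T (\<lambda>X x. \<eta> X (x, cst X 0))"
    proof (rule naturalI)
      fix X x assume "X \<in> Ob" "x \<in> sec L X"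
      then show "\<eta> X (x, cst X 0) \<in> sec T X" using naturalD[OF \<eta>, of X "(x, cst X 0)"] by simp
    next
      fix a x assume "a \<in> Ar" "x \<in> sec L (cd a)"
      then show "\<eta> (dm a) (res L a x, cst (dm a) 0) = res T a (\<eta> (cd a) (x, cst (cd a) 0))"
        using natural_res[OF \<eta>, of a "(x, cst (cd a) 0)"] by simp
    qed
    have cg: "\<forall>X\<in>Ob. \<forall>x\<in>S X. ?c X x (idm X, cst X 0) = \<eta> X (x, cst X 0)"
      using L subpshD[OF S] by (simp add: valid_idm)
    obtain \<Gamma> where \<Gamma>: "natural L (sec L) (expo Delta_d T) \<Gamma>" "\<forall>X\<in>Ob. \<forall>x\<in>S X. \<Gamma> X x = ?c X x"
        "\<forall>X\<in>Ob. \<forall>x\<in>sec L X. \<Gamma> X x (idm X, cst X 0) = \<eta> X (x, cst X 0)"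
      using e c g cg unfolding ev_ext_def by blast
    have "natural (pair L fnd) (sec (pair L fnd)) T (\<lambda>X z. \<Gamma> X (fst z) (idm X, snd z))"
      using natural_uncurry[OF subpsh_sec[OF L] \<Gamma>(1)] by (simp add: natural_def)
    moreover have "\<Gamma> X (fst z) (idm X, snd z) = \<eta> X z" if X: "X \<in> Ob" and z: "z \<in> pp L S fnd (pt 0) X" for X z
    proof -
      obtain x k where xk: "z = (x, k)" "x \<in> sec L X" "k \<in> local_dimaps X Delta_d" "x \<in> S X \<or> k \<in> pt 0 X"
        using z by (elim mem_ppE) simp
      from xk(4) show ?thesis
      proof
        assume "x \<in> S X"
        then show ?thesis using \<Gamma>(2) X xk L by (simp add: valid_idm)
      next
        assume "k \<in> pt 0 X"
        then show ?thesis using \<Gamma>(3) X xk by simp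
      qed
    qed
    ultimately show "\<exists>\<zeta>. natural (pair L fnd) (sec (pair L fnd)) T \<zeta> \<and>
        (\<forall>X\<in>Ob. \<forall>x\<in>pp L S fnd (pt 0) X. \<zeta> X x = \<eta> X x)" by blast
  qed
next
  assume e: "ext (pair L fnd) (pp L S fnd (pt 0)) T"
  show "ev_ext L S T"
    unfolding ev_ext_def
  proof (intro allI impI)
    fix \<gamma> g
    assume \<gamma>: "natural L S (expo Delta_d T) \<gamma>" and g: "natural L (sec L) T g"
      and eq: "\<forall>X\<in>Ob. \<forall>x\<in>S X. \<gamma> X x (idm X, cst X 0) = g X x"
    \<comment> \<open>The clauses agree by \<open>eq\<close> when \<open>k\<close> is the constant
      0. This also yields naturality when a restriction moves \<open>x\<close> into
      \<open>S\<close>.\<close>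
    define \<eta> where "\<eta> = (\<lambda>X (x, k). if x \<in> S X then \<gamma> X x (idm X, k) else g X x)"
    have n: "natural (pair L fnd) (\<lambda>X. S X \<times> local_dimaps X Delta_d) T (\<lambda>X z. \<gamma> X (fst z) (idm X, snd z))"
      by (rule natural_uncurry[OF S \<gamma>])
    have \<eta>S: "\<eta> X (x, k) = \<gamma> X x (idm X, k)" if "x \<in> S X" for X x k using that by (simp add: \<eta>_def)
    have \<eta>0: "\<eta> X (x, cst X 0) = g X x" if "X \<in> Ob" "x \<in> sec L X" for X x
      using that eq by (simp add: \<eta>_def)
    have "natural (pair L fnd) (pp L S fnd (pt 0)) T \<eta>"
    proof (rule naturalI)
      fix X z assume X: "X \<in> Ob" and "z \<in> pp L S fnd (pt 0) X"
      then obtain x k where xk: "z = (x, k)" "x \<in> sec L X" "k \<in> local_dimaps X Delta_d" and c: "x \<in> S X \<or> k \<in> pt 0 X"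
        by (elim mem_ppE) simp
      from c show "\<eta> X z \<in> sec T X"
      proof
        assume "x \<in> S X"
        then show ?thesis using naturalD[OF n X, of z] xk by (simp add: \<eta>S)
      next
        assume "k \<in> pt 0 X"
        then show ?thesis using naturalD[OF g X] xk X by (simp add: \<eta>0)
      qed
    next
      fix a z assume a: "a \<in> Ar" and "z \<in> pp L S fnd (pt 0) (cd a)"
      then obtain x k where xk: "z = (x, k)" "x \<in> sec L (cd a)" "k \<in> local_dimaps (cd a) Delta_d"
          and c: "x \<in> S (cd a) \<or> k \<in> pt 0 (cd a)"
        by (elim mem_ppE) simp
      from c show "\<eta> (dm a) (res (pair L fnd) a z) = res T a (\<eta> (cd a) z)"
      proof
        assume x: "x \<in> S (cd a)"
        show ?thesis using natural_res[OF n a, of z] xk subpsh_res[OF S a x] x by (simp add: \<eta>S)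
      next
        assume "k \<in> pt 0 (cd a)"
        then show ?thesis using natural_res[OF g a xk(2)] xk a L by (simp add: \<eta>0)
      qed
    qed
    then obtain \<zeta> where \<zeta>: "natural (pair L fnd) (sec (pair L fnd)) T \<zeta>"
        "\<forall>X\<in>Ob. \<forall>z\<in>pp L S fnd (pt 0) X. \<zeta> X z = \<eta> X z"
      using extD[OF e] by blast
    let ?c = "\<lambda>X x (a, k). if valid Delta_d X a k then \<zeta> (dm a) (res L a x, k) else undefined"
    have "natural (pair L fnd) (\<lambda>X. sec L X \<times> local_dimaps X Delta_d) T \<zeta>"
      using \<zeta>(1) by (simp add: natural_def)
    then have c: "natural L (sec L) (expo Delta_d T) ?c" by (rule natural_curry[OF L subpsh_sec[OF L]])
    have cS: "?c X x = \<gamma> X x" if X: "X \<in> Ob" and x: "x \<in> S X" for X x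
    proof (rule HOL.ext)
      fix z :: "epo_map \<times> ((nat \<Rightarrow> real) \<Rightarrow> real)"
      obtain a k where z: "z = (a, k)" by (cases z)
      show "?c X x z = \<gamma> X x z"
      proof (cases "valid Delta_d X a k")
        case v: True
        then have a: "a \<in> Ar" "cd a = X" "k \<in> local_dimaps (dm a) Delta_d" by (simp_all add: valid_def)
        have r: "res L a x \<in> S (dm a)" using subpsh_res[OF S a(1)] a(2) x by simp
        have "(res L a x, k) \<in> pp L S fnd (pt 0) (dm a)" using r a subpshD[OF S _ r] by simp
        then show ?thesis using \<zeta>(2) a v r uncurry_eval[OF \<gamma> X x v] by (simp add: \<eta>S z)
      next
        case False
        then show ?thesis using expo_undefined[OF naturalD[OF \<gamma> X x]] by (simp add: z)
      qed
    qed
    have c0: "?c X x (idm X, cst X 0) = g X x" if "X \<in> Ob" "x \<in> sec L X" for X x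
      using that \<zeta>(2) L by (simp add: valid_idm \<eta>0)
    show "\<exists>\<Gamma>. natural L (sec L) (expo Delta_d T) \<Gamma> \<and> (\<forall>X\<in>Ob. \<forall>x\<in>S X. \<Gamma> X x = \<gamma> X x) \<and>
        (\<forall>X\<in>Ob. \<forall>x\<in>sec L X. \<Gamma> X x (idm X, cst X 0) = g X x)"
      by (rule exI[of _ ?c], intro conjI ballI c) (rule cS c0; assumption)+
  qed
qed

section \<open>The interval cylinders on sections\<close>

lemma cylO_eq: "cylO (interval_of \<Delta>) F = cyl F \<Delta>"
  by (simp add: interval_of_def cyl_eq)

lemma face_eq: "face (interval_of \<Delta>) e F = arr F (\<lambda>X x. cenc (x, cst X (real e))) (cyl F \<Delta>)"
  by (simp add: interval_of_def arr_def cyl_eq cenc_def const_section_def cst_def)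

context universe
begin

lemma cylA_eq: "f \<in> Hom SC F G \<Longrightarrow>
    cylA (interval_of \<Delta>) f = arr (cyl F \<Delta>) (\<lambda>X v. case inv code v of (x, k :: 'u) \<Rightarrow> code (ap f X x, k)) (cyl G \<Delta>)"
  by (cases f) (simp add: interval_of_def arr_def cyl_eq Hom_iff)

lemma face_Hom:
  assumes F: "is_sheaf \<U> F" and \<Delta>: "\<Delta> \<in> {Delta_d, Delta_D}" and e: "e \<in> {0, 1}"
  shows "face (interval_of \<Delta>) e F \<in> Hom SC F (cyl F \<Delta>)"
  unfolding face_eq
proof (rule arr_Hom[OF F is_sheaf_cyl[OF F]], rule naturalI)
  fix X x assume "X \<in> Ob" "x \<in> sec F X"
  then show "cenc (x, cst X (real e)) \<in> sec (cyl F \<Delta>) X" using \<Delta> e by auto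
next
  fix a x assume "a \<in> Ar" "x \<in> sec F (cd a)"
  then show "cenc (res F a x, cst (dm a) (real e)) = res (cyl F \<Delta>) a (cenc (x, cst (cd a) (real e)))"
    by simp
qed

lemma im_face:
  assumes "is_sheaf \<U> F" "\<Delta> \<in> {Delta_d, Delta_D}" "e \<in> {0, 1}" "X \<in> Ob"
  shows "im (face (interval_of \<Delta>) e F) X = cenc ` (sec F X \<times> pt (real e) X)"
proof -
  have "im (face (interval_of \<Delta>) e F) X = (\<lambda>x. cenc (x, cst X (real e))) ` sec F X"
    unfolding im_eq[OF face_Hom[OF assms(1-3)]] unfolding face_eq
    by (rule image_cong) (simp_all add: assms(4))
  then show ?thesis by auto
qed

lemma cylA_Hom:
  assumes f: "f \<in> Hom SC F G"
  shows "cylA (interval_of \<Delta>) f \<in> Hom SC (cyl F \<Delta>) (cyl G \<Delta>)"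
    "X \<in> Ob \<Longrightarrow> im (cylA (interval_of \<Delta>) f) X = cenc ` (im f X \<times> local_dimaps X \<Delta>)"
proof -
  let ?a = "\<lambda>X v. case inv code v of (x, k :: 'u) \<Rightarrow> code (ap f X x, k)"
  have a: "?a X (cenc (x, k)) = cenc (ap f X x, k)" for X x k
    by (simp add: cenc_def)
  have n: "natural (cyl F \<Delta>) (sec (cyl F \<Delta>)) (cyl G \<Delta>) ?a"
  proof (rule naturalI; elim mem_encE)
    fix X v z assume h: "X \<in> Ob" "v = cenc z" "z \<in> sec (pair F (fn \<Delta>)) X"
    then show "?a X v \<in> sec (cyl G \<Delta>) X"
      using naturalD[OF HomD(6)[OF f] h(1)] by (cases z) (simp add: a)
  next
    fix b v z assume h: "b \<in> Ar" "v = cenc z" "z \<in> sec (pair F (fn \<Delta>)) (cd b)"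
    then show "?a (dm b) (res (cyl F \<Delta>) b v) = res (cyl G \<Delta>) b (?a (cd b) v)"
      using natural_res[OF HomD(6)[OF f] h(1)] by (cases z) (simp add: a)
  qed
  show H: "cylA (interval_of \<Delta>) f \<in> Hom SC (cyl F \<Delta>) (cyl G \<Delta>)"
    unfolding cylA_eq[OF f]
    by (rule arr_Hom[OF is_sheaf_cyl[OF HomD(4)[OF f]] is_sheaf_cyl[OF HomD(5)[OF f]] n])
  assume X: "X \<in> Ob"
  have "im (cylA (interval_of \<Delta>) f) X = ?a X ` cenc ` (sec F X \<times> local_dimaps X \<Delta>)"
    unfolding im_eq[OF H] unfolding cylA_eq[OF f] by (rule image_cong) (simp_all add: X)
  also have "\<dots> = cenc ` (im f X \<times> local_dimaps X \<Delta>)"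
    by (auto simp: image_iff a im_eq[OF f]; force simp: a)
  finally show "im (cylA (interval_of \<Delta>) f) X = cenc ` (im f X \<times> local_dimaps X \<Delta>)" .
qed

lemma im_cylA_face:
  assumes m: "m \<in> Hom SC A B" and \<Delta>: "\<Delta> \<in> {Delta_d, Delta_D}" and e: "e \<in> {0, 1}" and X: "X \<in> Ob"
  shows "im (cylA (interval_of \<Delta>) m) X \<union> im (face (interval_of \<Delta>) e B) X =
    cenc ` pp B (im m) (fn \<Delta>) (pt (real e)) X"
proof -
  have "im m X \<subseteq> sec B X" using subpshD[OF subpsh_im[OF m] X] by blast
  moreover have "cst X (real e) \<in> local_dimaps X \<Delta>" using \<Delta> e X by auto
  ultimately have "im m X \<times> local_dimaps X \<Delta> \<union> sec B X \<times> pt (real e) X = pp B (im m) (fn \<Delta>) (pt (real e)) X"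
    by (auto simp: pp_def)
  then show ?thesis
    unfolding cylA_Hom(2)[OF m X] im_face[OF HomD(5)[OF m] \<Delta> e X] image_Un[symmetric] by simp
qed

subsection \<open>Naively fibrant objects have the homotopy extension property\<close>

text \<open>The closure of the sectionwise union is a representative of the union in
  \<open>Lambda0\<close> with \<open>e = 0\<close>. The lift it provides gives extension from the
  closure, which descends to the pushout product and then passes through the encoding of the
  cylinder.\<close>

lemma fibrant_cellular_ext:
  assumes T: "is_sheaf \<U> T" and t: "terminal SC t" and f: "f \<in> Hom SC T t"
    and fi: "f \<in> inj_class SC (Lambda SC M (interval_of Delta_d))" and m: "m \<in> M" "m \<in> Hom SC A B"
  shows "ext (pair B fnd) (pp B (im m) fnd (pt 0)) T"
proof -
  let ?I = "interval_of Delta_d"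
  have B: "is_sheaf \<U> B" using HomD(5)[OF m(2)] .
  have pB: "presheaf B" and sT: "sheaf T" using Hom_sheaf[OF m(2)] Hom_sheaf[OF f] by auto
  have c: "cylA ?I m \<in> Hom SC (cyl A Delta_d) (cyl B Delta_d)" by (rule cylA_Hom(1)[OF m(2)])
  have fc: "face ?I 0 B \<in> Hom SC B (cyl B Delta_d)" by (rule face_Hom[OF B]) simp_all
  let ?S = "\<lambda>X. im (cylA ?I m) X \<union> im (face ?I 0 B) X"
  let ?Q = "\<lambda>X. cenc ` pp B (im m) fnd (pt 0) X"
  let ?u = "inc (cyl B Delta_d) (loc (cyl B Delta_d) ?S)"
  have u: "is_union SC ?u (cylA ?I m) (face ?I 0 B)" by (rule is_union_inc[OF c fc])
  then have "?u \<in> Lambda0 SC M ?I" unfolding Lambda0_def using m(1) HomD(3)[OF m(2)] by blast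
  then have "?u \<in> (sat SC ?I ^^ 0) (Lambda0 SC M ?I)" by simp
  then have "?u \<in> Lambda SC M ?I" unfolding Lambda_def by blast
  then have l: "lifts SC ?u f" using fi unfolding inj_class_def by blast
  have SQ: "?S X = ?Q X" if "X \<in> Ob" for X
    using im_cylA_face[OF m(2) _ _ that, of Delta_d 0] by simp
  have pcyl: "presheaf (cyl B Delta_d)" using is_sheaf_cyl[OF B] is_sheaf_iff sheaf_presheaf by blast
  have subS: "subpsh (cyl B Delta_d) ?S"
    using subpsh_im[OF c] subpsh_im[OF fc] unfolding subpsh_def by blast
  have subpp: "subpsh (pair B fnd) (pp B (im m) fnd (pt 0))"
    by (rule subpsh_pp[OF pB presheaf_fn subpsh_im[OF m(2)] subpsh_pt(1)]) simp
  have subQ: "subpsh (cyl B Delta_d) ?Q"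
    by (rule subpsh_enc[OF presheaf_pair[OF pB presheaf_fn] decodes_cenc subpp])
  have uH: "?u \<in> Monos SC" "?u \<in> Hom SC (Dom SC ?u) (cyl B Delta_d)"
    by (rule is_union_im(1,2)[OF u c fc])+
  have "ext (cyl B Delta_d) (im ?u) T" by (rule lifts_imp_ext[OF uH f t l])
  then have "ext (cyl B Delta_d) ?Q T"
  proof (rule ext_to_sub[OF pcyl sT subQ subpsh_im[OF uH(2)], rotated 2])
    fix X assume X: "X \<in> Ob"
    show "?Q X \<subseteq> im ?u X" using is_union_im(3)[OF u c fc X] SQ[OF X] by simp
    have "loc (cyl B Delta_d) ?S X \<subseteq> loc (cyl B Delta_d) ?Q X"
      by (rule loc_mono[OF _ X]) (simp add: SQ)
    then show "im ?u X \<subseteq> loc (cyl B Delta_d) ?Q X" using is_union_im(4)[OF u c fc X] by blast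
  qed
  moreover have "retr (cyl B Delta_d) ?Q (pair B fnd) (pp B (im m) fnd (pt 0))"
    by (rule retr_enc(1)[OF presheaf_pair[OF pB presheaf_fn] decodes_cenc]) (use subpshD[OF subpp] in blast)
  ultimately show ?thesis using subQ subpp by (rule ext_retr)
qed

end

section \<open>Evaluation at the end 0 as an arrow of the category\<close>

lemma natural_eval: "natural (expo Delta_d T) (sec (expo Delta_d T)) T (\<lambda>X \<psi>. \<psi> (idm X, cst X 0))"
proof (rule naturalI)
  fix X \<psi> assume X: "X \<in> Ob" and \<psi>: "\<psi> \<in> sec (expo Delta_d T) X"
  show "\<psi> (idm X, cst X 0) \<in> sec T X"
    using expo_sec[OF \<psi> valid_idm, of "cst X 0"] X by simp
next
  fix a \<psi> assume a: "a \<in> Ar" and \<psi>: "\<psi> \<in> sec (expo Delta_d T) (cd a)"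
  have "\<psi> (idm (cd a) \<odot> a, res fnd a (cst (cd a) 0)) = res T a (\<psi> (idm (cd a), cst (cd a) 0))"
    using expo_res[OF \<psi> valid_idm a, of "cst (cd a) 0"] a by simp
  then show "res (expo Delta_d T) a \<psi> (idm (dm a), cst (dm a) 0) = res T a (\<psi> (idm (cd a), cst (cd a) 0))"
    using a by (simp add: res_expo valid_idm)
qed

context universe
begin

context
  fixes T E :: "'u presheaf" and J J' and ev :: "'u presheaf_map"
  assumes T: "is_sheaf \<U> T" and dec: "decodes J J' (expo Delta_d T)"
    and E: "is_sheaf \<U> E" "E = pres_enc J J' (expo Delta_d T)"
    and ev_def: "ev = arr E (\<lambda>X v. J' v (idm X, cst X 0)) T"
begin

lemma presheaf_expo_T: "presheaf (expo Delta_d T)"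
  by (rule presheaf_expo)

lemma E_natural:
  "natural (expo Delta_d T) (sec (expo Delta_d T)) E (\<lambda>X. J)" "natural E (sec E) (expo Delta_d T) (\<lambda>X. J')"
  unfolding E(2) by (rule enc_natural[OF presheaf_expo_T dec])+

lemma ev_Hom: "ev \<in> Hom SC E T"
  unfolding ev_def
proof (rule arr_Hom[OF E(1) T])
  show "natural E (sec E) T (\<lambda>X v. J' v (idm X, cst X 0))"
    by (rule natural_comp[OF E_natural(2) natural_eval]) (rule naturalD[OF E_natural(2)])
qed

lemma ap_ev: "X \<in> Ob \<Longrightarrow> v \<in> sec E X \<Longrightarrow> ap ev X v = J' v (idm X, cst X 0)"
  by (simp add: ev_def)

lemma E_decode:
  assumes "X \<in> Ob" "v \<in> sec E X"
  shows "J (J' v) = v"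
  using assms decodesD[OF dec assms(1)] by (auto simp: E(2))

text \<open>The top arrow of a square is moved from \<open>A\<close> to the image of
  \<open>m\<close> by the inverse of \<open>m\<close>; commutativity of the square is then the
  compatibility at the constant 0.\<close>

lemma ev_ext_imp_lifts:
  assumes m: "m \<in> Monos SC" "m \<in> Hom SC A B" and e: "ev_ext B (im m) T"
  shows "lifts SC m ev"
  unfolding lifts_def HomD(2,3)[OF m(2)] HomD(2,3)[OF ev_Hom]
proof (intro ballI impI)
  fix u v assume u: "u \<in> Hom SC A E" and v: "v \<in> Hom SC B T" and eq: "Cmp SC ev u = Cmp SC v m"
  obtain r where r: "natural B (im m) A r" "\<And>X x. X \<in> Ob \<Longrightarrow> x \<in> sec A X \<Longrightarrow> r X (ap m X x) = x"
    using mono_inverse[OF m] by blast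
  have n: "natural A (sec A) (expo Delta_d T) (\<lambda>X x. J' (ap u X x))"
    by (rule natural_comp[OF HomD(6)[OF u] E_natural(2)]) (rule naturalD[OF HomD(6)[OF u]])
  have \<gamma>: "natural B (im m) (expo Delta_d T) (\<lambda>X y. J' (ap u X (r X y)))"
    by (rule natural_comp[OF r(1) n]) (rule naturalD[OF r(1)])
  have eq': "\<forall>X\<in>Ob. \<forall>y\<in>im m X. J' (ap u X (r X y)) (idm X, cst X 0) = ap v X y"
  proof (intro ballI)
    fix X y assume X: "X \<in> Ob" and "y \<in> im m X"
    then obtain x where x: "x \<in> sec A X" "y = ap m X x" by (auto simp: im_eq[OF m(2)])
    show "J' (ap u X (r X y)) (idm X, cst X 0) = ap v X y"
      using ap_Cmp[OF u ev_Hom X x(1)] ap_Cmp[OF m(2) v X x(1)] eq r(2)[OF X x(1)]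
        ap_ev[OF X naturalD[OF HomD(6)[OF u] X x(1)]] x(2) by simp
  qed
  obtain \<Gamma> where \<Gamma>: "natural B (sec B) (expo Delta_d T) \<Gamma>" "\<forall>X\<in>Ob. \<forall>y\<in>im m X. \<Gamma> X y = J' (ap u X (r X y))"
      "\<forall>X\<in>Ob. \<forall>y\<in>sec B X. \<Gamma> X y (idm X, cst X 0) = ap v X y"
    using e \<gamma> HomD(6)[OF v] eq' unfolding ev_ext_def by blast
  define d where "d = arr B (\<lambda>X y. J (\<Gamma> X y)) E"
  have d: "d \<in> Hom SC B E"
    unfolding d_def
  proof (rule arr_Hom[OF HomD(4)[OF v] E(1)])
    show "natural B (sec B) E (\<lambda>X y. J (\<Gamma> X y))"
      by (rule natural_comp[OF \<Gamma>(1) E_natural(1)]) (rule naturalD[OF \<Gamma>(1)])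
  qed
  have "Cmp SC d m = u"
  proof (rule Hom_eqI[OF Cmp_Hom[OF m(2) d] u])
    fix X x assume X: "X \<in> Ob" and x: "x \<in> sec A X"
    have y: "ap m X x \<in> im m X" "ap m X x \<in> sec B X"
      using x naturalD[OF HomD(6)[OF m(2)] X x] by (simp_all add: im_eq[OF m(2)])
    have "ap (Cmp SC d m) X x = J (\<Gamma> X (ap m X x))"
      using X y by (simp add: ap_Cmp[OF m(2) d X x]) (simp add: d_def)
    also have "\<dots> = J (J' (ap u X x))" using \<Gamma>(2) X y r(2)[OF X x] by simp
    also have "\<dots> = ap u X x" by (rule E_decode[OF X naturalD[OF HomD(6)[OF u] X x]])
    finally show "ap (Cmp SC d m) X x = ap u X x" .
  qed
  moreover have "Cmp SC ev d = v"
  proof (rule Hom_eqI[OF Cmp_Hom[OF d ev_Hom] v])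
    fix X y assume X: "X \<in> Ob" and y: "y \<in> sec B X"
    have "ap d X y = J (\<Gamma> X y)" using X y by (simp add: d_def)
    then have "ap (Cmp SC ev d) X y = J' (J (\<Gamma> X y)) (idm X, cst X 0)"
      using ap_ev[OF X naturalD[OF HomD(6)[OF d] X y]] by (simp add: ap_Cmp[OF d ev_Hom X y])
    then show "ap (Cmp SC ev d) X y = ap v X y"
      using decodesD[OF dec X naturalD[OF \<Gamma>(1) X y]] \<Gamma>(3) X y by simp
  qed
  ultimately show "\<exists>d\<in>Hom SC B E. Cmp SC d m = u \<and> Cmp SC ev d = v" using d by blast
qed

lemma lifts_imp_ev_ext:
  assumes m: "m \<in> Monos SC" "m \<in> Hom SC A B" and l: "lifts SC m ev"
  shows "ev_ext B (im m) T"
  unfolding ev_ext_def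
proof (intro allI impI)
  fix \<gamma> g
  assume \<gamma>: "natural B (im m) (expo Delta_d T) \<gamma>" and g: "natural B (sec B) T g"
    and eq: "\<forall>X\<in>Ob. \<forall>y\<in>im m X. \<gamma> X y (idm X, cst X 0) = g X y"
  have mim: "ap m X x \<in> im m X" "ap m X x \<in> sec B X" if "X \<in> Ob" "x \<in> sec A X" for X x
    using that naturalD[OF HomD(6)[OF m(2)] that] by (simp_all add: im_eq[OF m(2)])
  have n: "natural A (sec A) (expo Delta_d T) (\<lambda>X x. \<gamma> X (ap m X x))"
    by (rule natural_comp[OF HomD(6)[OF m(2)] \<gamma> mim(1)])
  define u where "u = arr A (\<lambda>X x. J (\<gamma> X (ap m X x))) E"
  have u: "u \<in> Hom SC A E"
    unfolding u_def
  proof (rule arr_Hom[OF HomD(4)[OF m(2)] E(1)])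
    show "natural A (sec A) E (\<lambda>X x. J (\<gamma> X (ap m X x)))"
      by (rule natural_comp[OF n E_natural(1)]) (rule naturalD[OF n])
  qed
  define v where "v = arr B g T"
  have v: "v \<in> Hom SC B T" unfolding v_def by (rule arr_Hom[OF HomD(5)[OF m(2)] T g])
  have "Cmp SC ev u = Cmp SC v m"
  proof (rule Hom_eqI[OF Cmp_Hom[OF u ev_Hom] Cmp_Hom[OF m(2) v]])
    fix X x assume X: "X \<in> Ob" and x: "x \<in> sec A X"
    have "ap u X x = J (\<gamma> X (ap m X x))" using X x by (simp add: u_def)
    then have "ap (Cmp SC ev u) X x = J' (J (\<gamma> X (ap m X x))) (idm X, cst X 0)"
      using ap_ev[OF X naturalD[OF HomD(6)[OF u] X x]] by (simp add: ap_Cmp[OF u ev_Hom X x])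
    also have "\<dots> = g X (ap m X x)"
      using decodesD[OF dec X naturalD[OF \<gamma> X mim(1)[OF X x]]] eq X mim(1)[OF X x] by simp
    also have "\<dots> = ap (Cmp SC v m) X x"
      using X mim(2)[OF X x] by (simp add: ap_Cmp[OF m(2) v X x]) (simp add: v_def)
    finally show "ap (Cmp SC ev u) X x = ap (Cmp SC v m) X x" .
  qed
  then obtain d where d: "d \<in> Hom SC B E" "Cmp SC d m = u" "Cmp SC ev d = v"
    using l u v unfolding lifts_def HomD(2,3)[OF m(2)] HomD(2,3)[OF ev_Hom] by blast
  have n2: "natural B (sec B) (expo Delta_d T) (\<lambda>X y. J' (ap d X y))"
    by (rule natural_comp[OF HomD(6)[OF d(1)] E_natural(2)]) (rule naturalD[OF HomD(6)[OF d(1)]])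
  have c1: "J' (ap d X y) = \<gamma> X y" if X: "X \<in> Ob" and y: "y \<in> im m X" for X y
  proof -
    obtain x where x: "x \<in> sec A X" "y = ap m X x" using y by (auto simp: im_eq[OF m(2)])
    have "ap d X y = ap u X x" using ap_Cmp[OF m(2) d(1) X x(1)] d(2) x(2) by simp
    also have "\<dots> = J (\<gamma> X y)" using X x by (simp add: u_def)
    finally show ?thesis using decodesD[OF dec X naturalD[OF \<gamma> X y]] by simp
  qed
  have c2: "J' (ap d X y) (idm X, cst X 0) = g X y" if X: "X \<in> Ob" and y: "y \<in> sec B X" for X y
    using ap_Cmp[OF d(1) ev_Hom X y] ap_ev[OF X naturalD[OF HomD(6)[OF d(1)] X y]] d(3) X y
    by (simp add: v_def)
  show "\<exists>\<Gamma>. natural B (sec B) (expo Delta_d T) \<Gamma> \<and> (\<forall>X\<in>Ob. \<forall>x\<in>im m X. \<Gamma> X x = \<gamma> X x) \<and>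
        (\<forall>X\<in>Ob. \<forall>x\<in>sec B X. \<Gamma> X x (idm X, cst X 0) = g X x)"
    by (rule exI[of _ "\<lambda>X y. J' (ap d X y)"], intro conjI ballI n2) (rule c1 c2; assumption)+
qed

end

lemma fibrant_sheaf: "naively_fibrant SC M I T \<Longrightarrow> is_sheaf \<U> T"
  by (simp add: naively_fibrant_def)

text \<open>Fibrancy concerns only members of \<open>M\<close>. Read as a property of the one arrow
  \<open>ev\<close>, it says that \<open>ev\<close> is in \<open>inj_class SC M\<close>, and then
  the cellular model makes all monos lift against \<open>ev\<close>.\<close>

lemma fibrant_HEP:
  assumes M: "cellular_model SC M" and fib: "naively_fibrant SC M (interval_of Delta_d) T"
  shows "HEP \<U> T"
proof -
  have T: "is_sheaf \<U> T" using fib by (rule fibrant_sheaf)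
  have sT: "sheaf T" using T is_sheaf_iff by blast
  obtain t f where t: "terminal SC t" and f: "f \<in> Hom SC T t"
    and fi: "f \<in> inj_class SC (Lambda SC M (interval_of Delta_d))"
    using fib unfolding naively_fibrant_def by blast
  obtain J :: "_ \<Rightarrow> 'u" and J' where J: "decodes J J' (expo Delta_d T)" "is_sheaf \<U> (pres_enc J J' (expo Delta_d T))"
    using expo_encoding[OF T] by blast
  define E where "E = pres_enc J J' (expo Delta_d T)"
  define ev where "ev = arr E (\<lambda>X v. J' v (idm X, cst X 0)) T"
  have EU: "is_sheaf \<U> E" using J(2) by (simp add: E_def)
  note ctx = T J(1) EU E_def ev_def
  have "ev \<in> inj_class SC M"
    unfolding inj_class_def
  proof (intro CollectI conjI ballI)
    show "ev \<in> Arr SC" by (rule Hom_Arr[OF ev_Hom[OF ctx]])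
    fix m assume m: "m \<in> M"
    then have mm: "m \<in> Monos SC" using M unfolding cellular_model_def by blast
    note mH = Monos_Hom[OF mm]
    have "ext (pair (Cod SC m) fnd) (pp (Cod SC m) (im m) fnd (pt 0)) T"
      by (rule fibrant_cellular_ext[OF T t f fi m mH])
    then have "ev_ext (Cod SC m) (im m) T"
      using ev_ext_iff[OF Hom_sheaf(4)[OF mH] subpsh_im[OF mH]] by blast
    then show "lifts SC m ev" by (rule ev_ext_imp_lifts[OF ctx mm mH])
  qed
  then have lift: "lifts SC l ev" if "l \<in> Monos SC" for l
    using M that unfolding cellular_model_def cof_class_def by blast
  show ?thesis
    unfolding HEP_def
  proof (intro allI impI)
    fix L :: "'u presheaf" and K assume L: "is_sheaf \<U> L" and K: "subpsh L K"
    have pL: "presheaf L" using L is_sheaf_iff sheaf_presheaf by blast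
    have l: "\<forall>X\<in>Ob. loc L (loc L K) X \<subseteq> loc L K X" using loc_loc[OF pL] by blast
    note w = inc[OF L subpsh_loc[OF pL K] l]
    \<comment> \<open>The subpresheaf \<open>K\<close> need not be the image of a mono; its closure
      is, and extension from the closure descends to \<open>K\<close>.\<close>
    let ?w = "inc L (loc L K)"
    have "ev_ext L (im ?w) T" by (rule lifts_imp_ev_ext[OF ctx w(2,1) lift[OF w(2)]])
    then have e: "ext (pair L fnd) (pp L (im ?w) fnd (pt 0)) T"
      using ev_ext_iff[OF pL subpsh_im[OF w(1)]] by blast
    show "ext (pair L fnd) (pp L K fnd (pt 0)) T"
    proof (rule ext_to_sub[OF presheaf_pair[OF pL presheaf_fn] sT _ _ _ _ e])
      show "subpsh (pair L fnd) (pp L K fnd (pt 0))" "subpsh (pair L fnd) (pp L (im ?w) fnd (pt 0))"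
        by (intro subpsh_pp pL presheaf_fn K subpsh_im[OF w(1)] subpsh_pt(1); simp)+
      fix X assume X: "X \<in> Ob"
      show "pp L K fnd (pt 0) X \<subseteq> pp L (im ?w) fnd (pt 0) X"
        using subset_loc[OF K X] w(3)[OF X] by (auto simp: pp_def)
      show "pp L (im ?w) fnd (pt 0) X \<subseteq> loc (pair L fnd) (pp L K fnd (pt 0)) X"
        by (rule pp_loc[OF pL presheaf_fn _ _ X]) (simp_all add: subpsh_pt w(3))
    qed
  qed
qed

subsection \<open>Fibrancy for the directed interval\<close>

text \<open>Quantifying over all subobjects \<open>A \<subseteq> B\<close> makes this class of subobjects \<open>S \<subseteq> L\<close> stable under
  pushout products, so that the cylinder over \<open>\<Delta>\<^sub>D\<close> can be traded for one over \<open>\<Delta>\<^sub>d\<close>.\<close>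

definition stably_ext :: "'u presheaf \<Rightarrow> 'u presheaf \<Rightarrow> (epo \<Rightarrow> 'u set) \<Rightarrow> bool" where
  "stably_ext T L S \<longleftrightarrow> (\<forall>B A. is_sheaf \<U> B \<longrightarrow> subpsh B A \<longrightarrow> ext (pair L B) (pp L S B A) T)"

text \<open>The factor \<open>B\<close> is removed by choosing one with a global section and pairing
  it with its least subsheaf, which exhibits \<open>L\<close> with \<open>S\<close> as a retract of
  the product.\<close>

lemma stably_ext_imp_ext:
  assumes g: "stably_ext T L S" and L: "presheaf L" and S: "subpsh L S"
    and l: "\<And>X x. X \<in> Ob \<Longrightarrow> x \<in> loc L S X \<Longrightarrow> x \<in> S X"
  shows "ext L S T"
proof -
  let ?H = "h_P Delta_d :: 'u presheaf"
  \<comment> \<open>The closure of the empty subpresheaf: over a space without points the empty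
    cover admits every section. There the closedness of \<open>S\<close> puts every section of
    \<open>L\<close> into \<open>S\<close> as well.\<close>
  define A where "A = (\<lambda>X. if carrier X = {} then sec ?H X else {})"
  have pH: "presheaf ?H" using is_sheaf_h_P[of Delta_d] is_sheaf_iff sheaf_presheaf by blast
  have A: "subpsh ?H A"
    unfolding subpsh_def
  proof (intro conjI ballI)
    fix X show "A X \<subseteq> sec ?H X" by (simp add: A_def)
  next
    fix a x assume a: "a \<in> Ar" and x: "x \<in> A (cd a)"
    then have e: "carrier (cd a) = {}" and xs: "x \<in> sec ?H (cd a)"
      unfolding A_def by (metis empty_iff)+
    have "carrier (dm a) = {}" using pre_carrier[OF a] unfolding e pre_def by blast
    then show "res ?H a x \<in> A (dm a)"
      unfolding A_def using presheaf_res[OF pH a xs] by (simp only: if_True simp_thms)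
  qed
  have cH: "(code (cst X 0) :: 'u) \<in> sec ?H X" if "X \<in> Ob" for X using that by (simp add: h_P_eq)
  have cr: "res ?H a (code (cst (cd a) 0)) = (code (cst (dm a) 0) :: 'u)" if "a \<in> Ar" for a
    using that by (simp add: h_P_eq)
  have i: "natural L (sec L) (pair L ?H) (\<lambda>X x. (x, code (cst X 0)))"
    by (rule naturalI) (simp_all add: cH cr)
  have r: "natural (pair L ?H) (sec (pair L ?H)) L (\<lambda>X. fst)"
    by (rule naturalI; elim mem_pair_secE) simp_all
  have inS: "x \<in> S X" if X: "X \<in> Ob" and "(x, y) \<in> pp L S ?H A X" for X x y
  proof -
    have x: "x \<in> sec L X" and c: "x \<in> S X \<or> y \<in> A X" using that by auto
    from c show ?thesis
    proof
      assume "y \<in> A X"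
      then have "carrier X = {}" unfolding A_def by (metis empty_iff)
      then have "x \<in> loc L S X" unfolding loc_def using x empty_cover by blast
      then show ?thesis by (rule l[OF X])
    qed
  qed
  have rt: "retr (pair L ?H) (pp L S ?H A) L S"
  proof (rule retrI[OF i r])
    fix X x assume "X \<in> Ob" "x \<in> S X"
    then show "(x, code (cst X 0)) \<in> pp L S ?H A X" using subpshD[OF S] cH by simp
  next
    fix X z assume "X \<in> Ob" "z \<in> pp L S ?H A X"
    then show "fst z \<in> S X" using inS[of X "fst z" "snd z"] by simp
  qed simp
  have "ext (pair L ?H) (pp L S ?H A) T" using g A is_sheaf_h_P unfolding stably_ext_def by blast
  then show ?thesis using rt subpsh_pp[OF L pH S A] S by (rule ext_retr)
qed

text \<open>Swapping factors moves \<open>B\<close> next to \<open>L\<close>, so the interval comes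
  last and the contraction can act on it. The sandwich for \<open>W\<close> is what is known about
  representatives of a union.\<close>

lemma stably_ext_cyl:
  assumes L: "is_sheaf \<U> L" and S: "subpsh L S" and R: "subpsh fnD R" and T: "sheaf T"
    and e: "\<And>B A. is_sheaf \<U> B \<Longrightarrow> subpsh B A \<Longrightarrow>
      ext (pair (pair L B) fnD) (pp (pair L B) (pp L S B A) fnD R) T"
    and W: "subpsh (cyl L Delta_D) W"
    and W1: "\<And>X. X \<in> Ob \<Longrightarrow> cenc ` pp L S fnD R X \<subseteq> W X"
    and W2: "\<And>X. X \<in> Ob \<Longrightarrow> W X \<subseteq> loc (cyl L Delta_D) (\<lambda>X. cenc ` pp L S fnD R X) X"
  shows "stably_ext T (cyl L Delta_D) W"
  unfolding stably_ext_def
proof (intro allI impI)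
  fix B :: "'u presheaf" and A assume B: "is_sheaf \<U> B" and A: "subpsh B A"
  have p: "presheaf L" "presheaf B" using L B is_sheaf_iff sheaf_presheaf by blast+
  let ?Q = "\<lambda>X. cenc ` pp L S fnD R X"
  have sp: "subpsh (pair L fnD) (pp L S fnD R)" by (rule subpsh_pp[OF p(1) presheaf_fn S R])
  have sQ: "subpsh (cyl L Delta_D) ?Q"
    by (rule subpsh_enc[OF presheaf_pair[OF p(1) presheaf_fn] decodes_cenc sp])
  have pc: "presheaf (cyl L Delta_D)"
    by (rule presheaf_enc[OF presheaf_pair[OF p(1) presheaf_fn] decodes_cenc])
  have "ext (pair (pair L fnD) B) (pp (pair L fnD) (pp L S fnD R) B A) T"
    by (rule ext_retr[OF e[OF B A] retr_swap]) (intro subpsh_pp presheaf_pair p presheaf_fn S R A)+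
  moreover have "retr (pair (pair L fnD) B) (pp (pair L fnD) (pp L S fnD R) B A)
      (pair (cyl L Delta_D) B) (pp (cyl L Delta_D) ?Q B A)"
    by (intro retr_pair retr_enc(2) retr_id presheaf_pair p presheaf_fn decodes_cenc) (use subpshD[OF sp] in blast)
  ultimately have "ext (pair (cyl L Delta_D) B) (pp (cyl L Delta_D) ?Q B A) T"
    by (rule ext_retr) (intro subpsh_pp presheaf_pair p presheaf_fn S R A pc sQ)+
  then show "ext (pair (cyl L Delta_D) B) (pp (cyl L Delta_D) W B A) T"
  proof (rule ext_to_loc[OF presheaf_pair[OF pc p(2)] T])
    show "subpsh (pair (cyl L Delta_D) B) (pp (cyl L Delta_D) W B A)" by (rule subpsh_pp[OF pc p(2) W A])
    fix X assume X: "X \<in> Ob"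
    show "pp (cyl L Delta_D) ?Q B A X \<subseteq> pp (cyl L Delta_D) W B A X"
      using W1[OF X] by (auto simp: pp_def)
    show "pp (cyl L Delta_D) W B A X \<subseteq> loc (pair (cyl L Delta_D) B) (pp (cyl L Delta_D) ?Q B A) X"
      by (rule pp_loc[OF pc p(2) A W2 X])
  qed
qed

text \<open>The pair \<open>A\<close>, \<open>B\<close> is absorbed into the base: the pushout
  product of \<open>im m\<close> with \<open>A\<close> is again a subpresheaf, and homotopy
  extension holds for all of them. Contracting to the end \<open>e\<close> then solves the
  problem.\<close>

lemma Lambda0_stably_ext:
  assumes hep: "HEP \<U> T" and T: "sheaf T" and M: "M \<subseteq> Monos SC"
    and u: "u \<in> Lambda0 SC M (interval_of Delta_D)"
  shows "u \<in> Monos SC" "stably_ext T (Cod SC u) (im u)"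
proof -
  let ?I = "interval_of Delta_D"
  obtain m e where m: "m \<in> M" and e: "e \<in> {0, 1}" and un: "is_union SC u (cylA ?I m) (face ?I e (Cod SC m))"
    using u unfolding Lambda0_def by blast
  define L where "L = Cod SC m"
  have mH: "m \<in> Hom SC (Dom SC m) L" unfolding L_def by (rule Monos_Hom) (use m M in blast)
  have L: "is_sheaf \<U> L" and pL: "presheaf L" and sL: "sheaf L" using HomD(5)[OF mH] Hom_sheaf[OF mH] by auto
  have D: "Delta_D \<in> {Delta_d, Delta_D}" by simp
  have c: "cylA ?I m \<in> Hom SC (cyl (Dom SC m) Delta_D) (cyl L Delta_D)" by (rule cylA_Hom(1)[OF mH])
  have fc: "face ?I e L \<in> Hom SC L (cyl L Delta_D)" by (rule face_Hom[OF L D e])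
  note iu = is_union_im[OF un[folded L_def] c fc]
  show "u \<in> Monos SC" by (rule iu(1))
  have e': "real e \<in> {0, 1}" using e by auto
  have SQ: "im (cylA ?I m) X \<union> im (face ?I e L) X = cenc ` pp L (im m) fnD (pt (real e)) X" if "X \<in> Ob" for X
    by (rule im_cylA_face[OF mH D e that])
  have "stably_ext T (cyl L Delta_D) (im u)"
  proof (rule stably_ext_cyl[OF L subpsh_im[OF mH] subpsh_pt(2)[OF e'] T _ subpsh_im[OF iu(2)]])
    fix B :: "'u presheaf" and A assume B: "is_sheaf \<U> B" and A: "subpsh B A"
    have pB: "presheaf B" and sB: "sheaf B" using B is_sheaf_iff sheaf_presheaf by blast+
    let ?S = "pp L (im m) B A"
    have sS: "subpsh (pair L B) ?S" by (rule subpsh_pp[OF pL pB subpsh_im[OF mH] A])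
    have "small \<U> (pair (pair L B) fnD)"
      by (intro small_pair sheaf_pair small_sheaf L B small_fn sheaf_fn sL sB)
    then have "ext (pair (pair (pair L B) fnD) fnd) (pp (pair (pair L B) fnD) (pp (pair L B) ?S fnD (pt (real e))) fnd (pt 0)) T"
      by (rule HEP_small[OF hep]) (intro subpsh_pp presheaf_pair pL pB presheaf_fn sS subpsh_pt(2) e')
    then show "ext (pair (pair L B) fnD) (pp (pair L B) ?S fnD (pt (real e))) T"
      by (rule ext_end_D[OF _ presheaf_pair[OF pL pB] sS e'])
  next
    fix X assume X: "X \<in> Ob"
    show "cenc ` pp L (im m) fnD (pt (real e)) X \<subseteq> im u X" using iu(3)[OF X] SQ[OF X] by simp
    have "loc (cyl L Delta_D) (\<lambda>X. im (cylA ?I m) X \<union> im (face ?I e L) X) X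
      \<subseteq> loc (cyl L Delta_D) (\<lambda>X. cenc ` pp L (im m) fnD (pt (real e)) X) X"
      by (rule loc_mono[OF _ X]) (simp add: SQ)
    then show "im u X \<subseteq> loc (cyl L Delta_D) (\<lambda>X. cenc ` pp L (im m) fnD (pt (real e)) X) X"
      using iu(4)[OF X] by blast
  qed
  then show "stably_ext T (Cod SC u) (im u)" by (simp add: HomD(3)[OF iu(2)])
qed

text \<open>Both arrows factor through the inclusion of the closure of their images. By the
  universal property so does the copairing, hence its image is bounded without describing the
  coproduct.\<close>

lemma copairing_im:
  assumes c: "is_copairing SC c f g" and f: "f \<in> Hom SC L N" and g: "g \<in> Hom SC L N"
  shows "c \<in> Hom SC (Dom SC c) N" "X \<in> Ob \<Longrightarrow> im f X \<union> im g X \<subseteq> im c X"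
    "X \<in> Ob \<Longrightarrow> im c X \<subseteq> loc N (\<lambda>X. im f X \<union> im g X) X"
proof -
  let ?S = "\<lambda>X. im f X \<union> im g X"
  obtain i j where cp: "is_coproduct SC L L (Dom SC c) i j" and ci: "Cmp SC c i = f" and cj: "Cmp SC c j = g"
    and cA: "c \<in> Arr SC"
    using c unfolding is_copairing_def HomD(2)[OF f] HomD(2)[OF g] by blast
  have ij: "i \<in> Hom SC L (Dom SC c)" "j \<in> Hom SC L (Dom SC c)" using cp unfolding is_coproduct_def by auto
  have "Cod SC c = N"
    using HomD(3)[OF Cmp_Hom[OF ij(1) Arr_Hom[OF cA]]] HomD(3)[OF f] ci by simp
  then show cH: "c \<in> Hom SC (Dom SC c) N" using Arr_Hom[OF cA] by simp
  show "?S X \<subseteq> im c X" if "X \<in> Ob"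
    using im_Cmp[OF ij(1) cH that] im_Cmp[OF ij(2) cH that] ci cj by simp
  have S: "subpsh N ?S" using subpsh_im[OF f] subpsh_im[OF g] unfolding subpsh_def by blast
  note pN = Hom_sheaf(4)[OF f]
  have l: "\<forall>X\<in>Ob. loc N (loc N ?S) X \<subseteq> loc N ?S X" using loc_loc[OF pN] by blast
  note w = inc[OF HomD(5)[OF f] subpsh_loc[OF pN S] l]
  let ?w = "inc N (loc N ?S)" and ?W = "N\<lparr>sec := loc N ?S\<rparr>"
  have sub: "?S X \<subseteq> im ?w X" if "X \<in> Ob" for X using subset_loc[OF S that] w(3)[OF that] by simp
  have "sub_le SC f ?w" "sub_le SC g ?w"
    by (rule sub_leI[OF f w(2,1)] sub_leI[OF g w(2,1)]; use sub in blast)+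
  then obtain f' g' where f': "f' \<in> Hom SC L ?W" "Cmp SC ?w f' = f" and g': "g' \<in> Hom SC L ?W" "Cmp SC ?w g' = g"
    unfolding sub_le_def HomD(2)[OF f] HomD(2)[OF g] HomD(2)[OF w(1)] by blast
  have univ: "\<exists>!r. r \<in> Hom SC (Dom SC c) Z \<and> Cmp SC r i = p \<and> Cmp SC r j = q"
    if "is_sheaf \<U> Z" "p \<in> Hom SC L Z" "q \<in> Hom SC L Z" for Z p q
  proof -
    have "Z \<in> Obj SC" using that(1) by simp
    then show ?thesis using cp that(2,3) unfolding is_coproduct_def by blast
  qed
  obtain r where r: "r \<in> Hom SC (Dom SC c) ?W" "Cmp SC r i = f'" "Cmp SC r j = g'"
    using univ[OF HomD(4)[OF w(1)] f'(1) g'(1)] by blast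
  have assoc: "Cmp SC (Cmp SC ?w r) k = Cmp SC ?w (Cmp SC r k)" if k: "k \<in> Hom SC L (Dom SC c)" for k
    by (rule Hom_eqI[OF Cmp_Hom[OF k Cmp_Hom[OF r(1) w(1)]] Cmp_Hom[OF Cmp_Hom[OF k r(1)] w(1)]])
      (simp add: ap_Cmp[OF k Cmp_Hom[OF r(1) w(1)]] ap_Cmp[OF Cmp_Hom[OF k r(1)] w(1)] ap_Cmp[OF k r(1)]
        ap_Cmp[OF r(1) w(1)] naturalD[OF HomD(6)[OF k]])
  have "c = Cmp SC ?w r"
  proof -
    have "\<exists>!q. q \<in> Hom SC (Dom SC c) N \<and> Cmp SC q i = f \<and> Cmp SC q j = g"
      by (rule univ[OF HomD(5)[OF f] f g])
    moreover have "Cmp SC ?w r \<in> Hom SC (Dom SC c) N \<and> Cmp SC (Cmp SC ?w r) i = f \<and> Cmp SC (Cmp SC ?w r) j = g"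
      using Cmp_Hom[OF r(1) w(1)] assoc[OF ij(1)] assoc[OF ij(2)] r(2,3) f'(2) g'(2) by simp
    ultimately show ?thesis using cH ci cj by blast
  qed
  then show "im c X \<subseteq> loc N ?S X" if "X \<in> Ob"
    using im_Cmp[OF r(1) w(1) that] w(3)[OF that] by simp
qed

text \<open>After reduction to \<open>Delta_d\<close>, reassociating turns the boundary of the
  interval into part of the test pair: it becomes the pushout product of \<open>l\<close> with
  \<open>A \<times> Delta_d \<union> B \<times> {0, 1}\<close> inside
  \<open>B \<times> Delta_d\<close>. This is a case of the assumption on \<open>l\<close>.\<close>

lemma sat_stably_ext:
  assumes hep: "HEP \<U> T" and T: "sheaf T"
    and Z: "\<And>l. l \<in> Z \<Longrightarrow> l \<in> Monos SC \<and> stably_ext T (Cod SC l) (im l)"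
    and u: "u \<in> sat SC (interval_of Delta_D) Z"
  shows "u \<in> Monos SC" "stably_ext T (Cod SC u) (im u)"
proof -
  let ?I = "interval_of Delta_D"
  obtain l c where lZ: "l \<in> Z" and cp: "is_copairing SC c (face ?I 0 (Cod SC l)) (face ?I 1 (Cod SC l))"
    and un: "is_union SC u (cylA ?I l) c"
    using u unfolding sat_def by blast
  define L where "L = Cod SC l"
  have lH: "l \<in> Hom SC (Dom SC l) L" unfolding L_def by (rule Monos_Hom) (use Z[OF lZ] in blast)
  have gl: "stably_ext T L (im l)" using Z[OF lZ] by (simp add: L_def)
  have L: "is_sheaf \<U> L" and pL: "presheaf L" and sL: "sheaf L" using HomD(5)[OF lH] Hom_sheaf[OF lH] by auto
  have D: "Delta_D \<in> {Delta_d, Delta_D}" and e01: "0 \<in> {0, 1 :: nat}" "1 \<in> {0, 1 :: nat}" by simp_all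
  have cy: "cylA ?I l \<in> Hom SC (cyl (Dom SC l) Delta_D) (cyl L Delta_D)" by (rule cylA_Hom(1)[OF lH])
  note fc = face_Hom[OF L D e01(1)] face_Hom[OF L D e01(2)]
  note ci = copairing_im[OF cp[folded L_def] fc]
  note iu = is_union_im[OF un cy ci(1)]
  show "u \<in> Monos SC" by (rule iu(1))
  let ?N = "cyl L Delta_D"
  let ?F = "\<lambda>X. im (face ?I 0 L) X \<union> im (face ?I 1 L) X"
  let ?Q = "\<lambda>X. cenc ` pp L (im l) fnD ends X"
  have SQ: "im (cylA ?I l) X \<union> ?F X = ?Q X" if "X \<in> Ob" for X
  proof -
    have "im (cylA ?I l) X \<union> ?F X = (im (cylA ?I l) X \<union> im (face ?I 0 L) X) \<union> (im (cylA ?I l) X \<union> im (face ?I 1 L) X)"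
      by blast
    also have "\<dots> = cenc ` (pp L (im l) fnD (pt 0) X \<union> pp L (im l) fnD (pt 1) X)"
      by (simp only: im_cylA_face[OF lH D e01(1) that] im_cylA_face[OF lH D e01(2) that] image_Un of_nat_0 of_nat_1)
    also have "pp L (im l) fnD (pt 0) X \<union> pp L (im l) fnD (pt 1) X = pp L (im l) fnD ends X"
      by (auto simp: pp_def)
    finally show ?thesis .
  qed
  have pN: "presheaf ?N" using Hom_sheaf(4)[OF cy] .
  have subF: "subpsh ?N ?F" using subpsh_im[OF fc(1)] subpsh_im[OF fc(2)] unfolding subpsh_def by blast
  have "stably_ext T ?N (im u)"
  proof (rule stably_ext_cyl[OF L subpsh_im[OF lH] subpsh_ends(2) T _ subpsh_im[OF iu(2)]])
    fix B :: "'u presheaf" and A assume B: "is_sheaf \<U> B" and A: "subpsh B A"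
    have pB: "presheaf B" and sB: "sheaf B" using B is_sheaf_iff sheaf_presheaf by blast+
    let ?S = "pp L (im l) B A"
    have sS: "subpsh (pair L B) ?S" by (rule subpsh_pp[OF pL pB subpsh_im[OF lH] A])
    have "small \<U> (pair (pair L B) fnD)"
      by (intro small_pair sheaf_pair small_sheaf L B small_fn sheaf_fn sL sB)
    then have h: "ext (pair (pair (pair L B) fnD) fnd) (pp (pair (pair L B) fnD) (pp (pair L B) ?S fnD ends) fnd (pt 0)) T"
      by (rule HEP_small[OF hep]) (intro subpsh_pp presheaf_pair pL pB presheaf_fn sS subpsh_ends)
    have sBA: "subpsh (pair B fnd) (pp B A fnd ends)" by (rule subpsh_pp[OF pB presheaf_fn A subpsh_ends(1)])
    \<comment> \<open>The assumption on \<open>l\<close> is used with the discrete cylinder of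
      \<open>B\<close> in the role of \<open>B\<close>; encoded into \<open>'u\<close>, it is again
      an object of the category.\<close>
    have "ext (pair L (cyl B Delta_d)) (pp L (im l) (cyl B Delta_d) (\<lambda>X. cenc ` pp B A fnd ends X)) T"
      using gl is_sheaf_cyl[OF B] subpsh_enc[OF presheaf_pair[OF pB presheaf_fn] decodes_cenc sBA]
      unfolding stably_ext_def by blast
    moreover have "retr (pair L (cyl B Delta_d)) (pp L (im l) (cyl B Delta_d) (\<lambda>X. cenc ` pp B A fnd ends X))
       (pair L (pair B fnd)) (pp L (im l) (pair B fnd) (pp B A fnd ends))"
      by (intro retr_pair retr_enc(1) retr_id pL presheaf_pair pB presheaf_fn decodes_cenc) (use subpshD[OF sBA] in blast)
    ultimately have "ext (pair L (pair B fnd)) (pp L (im l) (pair B fnd) (pp B A fnd ends)) T"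
      by (rule ext_retr) (intro subpsh_pp presheaf_enc presheaf_pair pL pB presheaf_fn decodes_cenc
        subpsh_enc subpsh_im[OF lH] sBA)+
    then have d: "ext (pair (pair L B) fnd) (pp (pair L B) ?S fnd ends) T"
      by (rule ext_retr[OF _ retr_assoc[OF pL pB presheaf_fn]])
        (intro subpsh_pp presheaf_pair pL pB presheaf_fn subpsh_im[OF lH] A subpsh_ends)+
    show "ext (pair (pair L B) fnD) (pp (pair L B) ?S fnD ends) T"
    proof (rule extI)
      fix \<eta> assume \<eta>: "natural (pair (pair L B) fnD) (pp (pair L B) ?S fnD ends) T \<eta>"
      have "natural (pair (pair L B) fnd) (pp (pair L B) ?S fnd ends) T \<eta>"
        by (rule natural_d_of_D[OF \<eta>]) (auto simp: pp_def local_dimaps_d_D)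
      then obtain \<kappa> where \<kappa>: "natural (pair (pair L B) fnd) (sec (pair (pair L B) fnd)) T \<kappa>"
          "\<forall>X\<in>Ob. \<forall>z\<in>pp (pair L B) ?S fnd ends X. \<kappa> X z = \<eta> X z"
        using extD[OF d] by blast
      show "\<exists>\<zeta>. natural (pair (pair L B) fnD) (sec (pair (pair L B) fnD)) T \<zeta> \<and>
          (\<forall>X\<in>Ob. \<forall>x\<in>pp (pair L B) ?S fnD ends X. \<zeta> X x = \<eta> X x)"
        by (rule extend_ends_D[OF h presheaf_pair[OF pL pB] sS T \<eta> \<kappa>(1)]) (use \<kappa>(2) in blast)
    qed
  next
    fix X assume X: "X \<in> Ob"
    show "?Q X \<subseteq> im u X" using iu(3)[OF X] ci(2)[OF X] SQ[OF X] by blast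
    have subC: "subpsh ?N (im (cylA ?I l))" by (rule subpsh_im[OF cy])
    \<comment> \<open>The image of the copairing is known only up to closure, so two closures are
      nested here and collapse by \<open>loc_loc\<close>.\<close>
    have "im (cylA ?I l) Y \<union> im c Y \<subseteq> loc ?N ?Q Y" if Y: "Y \<in> Ob" for Y
    proof -
      have "loc ?N ?F Y \<subseteq> loc ?N ?Q Y" by (rule loc_mono[OF _ Y]) (use SQ in blast)
      moreover have "subpsh ?N ?Q"
        by (rule subpsh_enc[OF presheaf_pair[OF pL presheaf_fn] decodes_cenc
              subpsh_pp[OF pL presheaf_fn subpsh_im[OF lH] subpsh_ends(2)]])
      ultimately show ?thesis using ci(3)[OF Y] SQ[OF Y] subset_loc[of ?N ?Q, OF _ Y] by blast
    qed
    then have "loc ?N (\<lambda>X. im (cylA ?I l) X \<union> im c X) X \<subseteq> loc ?N (loc ?N ?Q) X" by (rule loc_mono[OF _ X])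
    then show "im u X \<subseteq> loc ?N ?Q X" using iu(4)[OF X] loc_loc[OF pN X] by blast
  qed
  then show "stably_ext T (Cod SC u) (im u)" by (simp add: HomD(3)[OF iu(2)])
qed

lemma fibrant_D:
  assumes M: "cellular_model SC M" and fib: "naively_fibrant SC M (interval_of Delta_d) T"
  shows "naively_fibrant SC M (interval_of Delta_D) T"
proof -
  let ?I = "interval_of Delta_D"
  have hep: "HEP \<U> T" using M fib by (rule fibrant_HEP)
  have T: "is_sheaf \<U> T" using fib by (rule fibrant_sheaf)
  have sT: "sheaf T" using T is_sheaf_iff by blast
  obtain t f where t: "terminal SC t" and f: "f \<in> Hom SC T t"
    using fib unfolding naively_fibrant_def by blast
  have MM: "M \<subseteq> Monos SC" using M by (simp add: cellular_model_def)
  \<comment> \<open>The induction carries stable extension instead of lifting against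
    \<open>f\<close>, because the step tests \<open>l\<close> on larger pairs. Lifting is recovered
    at the end.\<close>
  have "\<forall>u\<in>(sat SC ?I ^^ n) (Lambda0 SC M ?I). u \<in> Monos SC \<and> stably_ext T (Cod SC u) (im u)" for n
  proof (induction n)
    case 0
    show ?case using Lambda0_stably_ext[OF hep sT MM] by simp
  next
    case (Suc n)
    show ?case
    proof
      fix u assume "u \<in> (sat SC ?I ^^ Suc n) (Lambda0 SC M ?I)"
      then have u: "u \<in> sat SC ?I ((sat SC ?I ^^ n) (Lambda0 SC M ?I))" by simp
      show "u \<in> Monos SC \<and> stably_ext T (Cod SC u) (im u)"
        using sat_stably_ext[OF hep sT _ u] Suc by blast
    qed
  qed
  then have gd: "u \<in> Monos SC" "stably_ext T (Cod SC u) (im u)" if "u \<in> Lambda SC M ?I" for u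
    using that unfolding Lambda_def by blast+
  have "lifts SC u f" if u: "u \<in> Lambda SC M ?I" for u
  proof -
    note uH = Monos_Hom[OF gd(1)[OF u]]
    have "ext (Cod SC u) (im u) T"
      by (rule stably_ext_imp_ext[OF gd(2)[OF u] Hom_sheaf(4)[OF uH] subpsh_im[OF uH]])
        (rule loc_im[OF gd(1)[OF u] uH])
    then show ?thesis by (rule ext_imp_lifts[OF gd(1)[OF u] uH f t])
  qed
  then have "f \<in> inj_class SC (Lambda SC M ?I)" unfolding inj_class_def using Hom_Arr[OF f] by blast
  then show ?thesis unfolding naively_fibrant_def using T t f by auto
qed

subsection \<open>Comparison of the homotopy relations\<close>

lemma ap_face: "X \<in> Ob \<Longrightarrow> x \<in> sec F X \<Longrightarrow> ap (face (interval_of \<Delta>) e F) X x = cenc (x, cst X (real e))"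
  unfolding face_eq by simp

lemma Cmp_face:
  assumes h: "h \<in> Hom SC (cyl F \<Delta>) T" and F: "is_sheaf \<U> F" and \<Delta>: "\<Delta> \<in> {Delta_d, Delta_D}" and e: "e \<in> {0, 1}"
    and f: "f \<in> Hom SC F T"
  shows "Cmp SC h (face (interval_of \<Delta>) e F) = f \<longleftrightarrow>
    (\<forall>X\<in>Ob. \<forall>x\<in>sec F X. ap h X (cenc (x, cst X (real e))) = ap f X x)"
proof
  note fc = face_Hom[OF F \<Delta> e]
  assume "Cmp SC h (face (interval_of \<Delta>) e F) = f"
  then show "\<forall>X\<in>Ob. \<forall>x\<in>sec F X. ap h X (cenc (x, cst X (real e))) = ap f X x"
    using ap_Cmp[OF fc h] by (auto simp: ap_face)
next
  note fc = face_Hom[OF F \<Delta> e]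
  assume a: "\<forall>X\<in>Ob. \<forall>x\<in>sec F X. ap h X (cenc (x, cst X (real e))) = ap f X x"
  show "Cmp SC h (face (interval_of \<Delta>) e F) = f"
    by (rule Hom_eqI[OF Cmp_Hom[OF fc h] f]) (simp add: ap_Cmp[OF fc h] ap_face a)
qed

text \<open>The relations themselves coincide, not just the equivalences they generate, so quotients
  and induced maps can be rewritten literally.\<close>

lemma homotopic_eq:
  assumes hep: "HEP \<U> T"
  shows "homotopic SC (interval_of Delta_D) F T = homotopic SC (interval_of Delta_d) F T"
proof -
  let ?hom = "\<lambda>\<Delta> f0 f1 h. h \<in> Hom SC (cyl F \<Delta>) T \<and>
     (\<forall>X\<in>Ob. \<forall>x\<in>sec F X. ap h X (cenc (x, cst X 0)) = ap f0 X x \<and> ap h X (cenc (x, cst X 1)) = ap f1 X x)"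
  have iff: "(f0, f1) \<in> homotopic SC (interval_of \<Delta>) F T \<longleftrightarrow>
      f0 \<in> Hom SC F T \<and> f1 \<in> Hom SC F T \<and> (\<exists>h. ?hom \<Delta> f0 f1 h)" if \<Delta>: "\<Delta> \<in> {Delta_d, Delta_D}" for f0 f1 \<Delta>
  proof (cases "f0 \<in> Hom SC F T \<and> f1 \<in> Hom SC F T")
    case True
    then have f: "f0 \<in> Hom SC F T" "f1 \<in> Hom SC F T" and F: "is_sheaf \<U> F" using HomD(4) by blast+
    have "(h \<in> Hom SC (cyl F \<Delta>) T \<and> Cmp SC h (face (interval_of \<Delta>) 0 F) = f0 \<and>
       Cmp SC h (face (interval_of \<Delta>) 1 F) = f1) \<longleftrightarrow> ?hom \<Delta> f0 f1 h" for h
    proof (cases "h \<in> Hom SC (cyl F \<Delta>) T")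
      case h: True
      show ?thesis using Cmp_face[OF h F \<Delta> _ f(1), of 0] Cmp_face[OF h F \<Delta> _ f(2), of 1] h by auto
    qed simp
    then have "(\<exists>h\<in>Hom SC (cyl F \<Delta>) T. Cmp SC h (face (interval_of \<Delta>) 0 F) = f0 \<and>
       Cmp SC h (face (interval_of \<Delta>) 1 F) = f1) \<longleftrightarrow> (\<exists>h. ?hom \<Delta> f0 f1 h)" by blast
    then show ?thesis using f by (simp add: homotopic_def cylO_eq)
  qed (auto simp: homotopic_def)
  have d_of_D: "\<exists>h. ?hom Delta_d f0 f1 h" if h: "?hom Delta_D f0 f1 h" and F: "is_sheaf \<U> F" for f0 f1 h
  proof -
    have hH: "h \<in> Hom SC (cyl F Delta_D) T" using h by blast
    \<comment> \<open>A directed homotopy restricts to a discrete one as it stands, since the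
      discrete cylinder is a subpresheaf with the same restriction maps.\<close>
    have "res (cyl F Delta_d) = res (cyl F Delta_D)" by (intro HOL.ext) (simp add: pair_def fn_def)
    moreover have "sec (cyl F Delta_d) X \<subseteq> sec (cyl F Delta_D) X" for X
      using local_dimaps_d_D[of _ X] by auto
    ultimately have n: "natural (cyl F Delta_d) (sec (cyl F Delta_d)) T (ap h)"
      using natural_subset[OF HomD(6)[OF hH], of "sec (cyl F Delta_d)"] unfolding natural_def by simp
    have "arr (cyl F Delta_d) (ap h) T \<in> Hom SC (cyl F Delta_d) T"
      by (rule arr_Hom[OF is_sheaf_cyl[OF F] HomD(5)[OF hH] n])
    then show ?thesis using h by (intro exI[of _ "arr (cyl F Delta_d) (ap h) T"]) simp
  qed
  have D_of_d: "\<exists>h. ?hom Delta_D f0 f1 h" if h: "?hom Delta_d f0 f1 h" and F: "is_sheaf \<U> F" for f0 f1 h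
  proof -
    have hH: "h \<in> Hom SC (cyl F Delta_d) T" using h by blast
    have T: "is_sheaf \<U> T" "sheaf T" using HomD(5)[OF hH] Hom_sheaf(2)[OF hH] by auto
    have pF: "presheaf F" and sF: "sheaf F" using F is_sheaf_iff sheaf_presheaf by blast+
    let ?\<kappa> = "\<lambda>X z. ap h X (cenc z)"
    note en = enc_natural[OF presheaf_pair[OF pF presheaf_fn] decodes_cenc]
    have \<kappa>: "natural (pair F fnd) (sec (pair F fnd)) T ?\<kappa>"
      by (rule natural_comp[OF en(1) HomD(6)[OF hH]]) simp
    \<comment> \<open>With the empty subpresheaf only the ends are prescribed, and the discrete
      homotopy \<open>h\<close> supplies both these values and the filling over
      \<open>Delta_d\<close>.\<close>
    have e0: "subpsh F (\<lambda>_. {})" by (simp add: subpsh_def)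
    have "pp F (\<lambda>_. {}) fnD ends X \<subseteq> sec (pair F fnd) X" if "X \<in> Ob" for X using that by (auto simp: pp_def)
    moreover have "res (pair F fnD) = res (pair F fnd)" by (simp add: pair_def fn_def)
    ultimately have \<eta>: "natural (pair F fnD) (pp F (\<lambda>_. {}) fnD ends) T ?\<kappa>"
      using natural_subset[OF \<kappa>, of "pp F (\<lambda>_. {}) fnD ends"] unfolding natural_def by simp
    have "small \<U> (pair F fnD)" by (intro small_pair small_sheaf F small_fn sheaf_fn sF)
    then have hx: "ext (pair (pair F fnD) fnd) (pp (pair F fnD) (pp F (\<lambda>_. {}) fnD ends) fnd (pt 0)) T"
      by (rule HEP_small[OF hep]) (intro subpsh_pp pF presheaf_fn e0 subpsh_ends)
    obtain \<theta> where \<theta>: "natural (pair F fnD) (sec (pair F fnD)) T \<theta>"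
        "\<forall>X\<in>Ob. \<forall>z\<in>pp F (\<lambda>_. {}) fnD ends X. \<theta> X z = ?\<kappa> X z"
      using extend_ends_D[OF hx pF e0 T(2) \<eta> \<kappa> refl] by blast
    define k where "k = arr (cyl F Delta_D) (\<lambda>X v. \<theta> X (cdec v)) T"
    have "natural (cyl F Delta_D) (sec (cyl F Delta_D)) T (\<lambda>X v. \<theta> X (cdec v))"
      by (rule natural_comp[OF en(2) \<theta>(1)]) (rule naturalD[OF en(2)])
    then have "k \<in> Hom SC (cyl F Delta_D) T" unfolding k_def by (rule arr_Hom[OF is_sheaf_cyl[OF F] T(1)])
    moreover have "ap k X (cenc (x, cst X e)) = ?\<kappa> X (x, cst X e)" if "X \<in> Ob" "x \<in> sec F X" "e \<in> {0, 1}" for X x e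
      using that \<theta>(2) by (auto simp: k_def)
    ultimately show ?thesis using h by (intro exI[of _ k]) simp
  qed
  show ?thesis
  proof (rule set_eqI)
    fix z :: "'u presheaf_map \<times> 'u presheaf_map"
    obtain f0 f1 where z: "z = (f0, f1)" by (cases z)
    have "(\<exists>h. ?hom Delta_D f0 f1 h) \<longleftrightarrow> (\<exists>h. ?hom Delta_d f0 f1 h)" if f: "f0 \<in> Hom SC F T"
    proof (rule iffI; elim exE)
      fix h assume "?hom Delta_D f0 f1 h" then show "\<exists>h. ?hom Delta_d f0 f1 h" using HomD(4)[OF f] by (rule d_of_D)
    next
      fix h assume "?hom Delta_d f0 f1 h" then show "\<exists>h. ?hom Delta_D f0 f1 h" using HomD(4)[OF f] by (rule D_of_d)
    qed
    then show "z \<in> homotopic SC (interval_of Delta_D) F T \<longleftrightarrow> z \<in> homotopic SC (interval_of Delta_d) F T"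
      unfolding z iff[of Delta_D f0 f1, simplified] iff[of Delta_d f0 f1, simplified] by blast
  qed
qed

text \<open>Unit and counit are identities. The categories are given through their fields so that
  the result applies to the model categories, which extend the record \<open>SC\<close>.\<close>

lemma id_left_adjoint:
  fixes N P :: "('u presheaf, 'u presheaf_map, 'm) category_scheme"
  assumes N: "Obj N = Obj SC" "Arr N = Arr SC" "Dom N = Dom SC" "Cod N = Cod SC" "Idn N = Idn SC" "Cmp N = Cmp SC"
    and P: "Obj P = Obj SC" "Arr P = Arr SC" "Dom P = Dom SC" "Cod P = Cod SC" "Idn P = Idn SC" "Cmp P = Cmp SC"
  shows "is_left_adjoint N P id_functor"
proof -
  have idH: "Idn SC F \<in> Hom SC F F" if "is_sheaf \<U> F" for F using Idn_Hom[OF that] .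
  have II: "Cmp SC (Idn SC F) (Idn SC F) = Idn SC F" if "is_sheaf \<U> F" for F
    using Idn_Cmp(1)[OF idH[OF that]] .
  have fn: "is_functor N P id_functor" "is_functor P N id_functor"
    unfolding is_functor_def id_functor_def Hom_def by (auto simp: N P)
  have nt: "is_nat_trans N N id_functor (comp_functor id_functor id_functor) (Idn SC)"
    "is_nat_trans P P (comp_functor id_functor id_functor) id_functor (Idn SC)"
    unfolding is_nat_trans_def id_functor_def comp_functor_def
    using idH Idn_Cmp[OF Arr_Hom] by (auto simp: N P Hom_def)
  show ?thesis
    unfolding is_left_adjoint_def
    using fn nt II by (intro conjI exI[of _ id_functor] exI[of _ "Idn SC"]) (auto simp: N P id_functor_def)
qed

end

theorem theorem4:
  fixes \<U> :: "'u set set" and M :: "'u presheaf_map set"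
  assumes "set_universe \<U>"
    and "cellular_model (sheaf_cat \<U>) M"
  shows "weak_equivalences (sheaf_cat \<U>) M (interval_of Delta_D)
           \<subseteq> weak_equivalences (sheaf_cat \<U>) M (interval_of Delta_d) \<and>
         left_quillen (cisinski_model (sheaf_cat \<U>) M (interval_of Delta_D))
           (cisinski_model (sheaf_cat \<U>) M (interval_of Delta_d)) id_functor"
proof -
  interpret universe \<U> using assms(1) by (rule universe.intro)
  have W: "weak_equivalences SC M (interval_of Delta_D) \<subseteq> weak_equivalences SC M (interval_of Delta_d)"
    unfolding weak_equivalences_def
  proof (intro Collect_mono impI conjI allI; elim conjE)
    fix f T
    assume D: "\<forall>T. naively_fibrant SC M (interval_of Delta_D) T \<longrightarrow>
      bij_betw (\<lambda>c. homotopic SC (interval_of Delta_D) (Dom SC f) T `` ((\<lambda>g. Cmp SC g f) ` c))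
       (Hom SC (Cod SC f) T // homotopic SC (interval_of Delta_D) (Cod SC f) T)
       (Hom SC (Dom SC f) T // homotopic SC (interval_of Delta_D) (Dom SC f) T)"
      and T: "naively_fibrant SC M (interval_of Delta_d) T"
    show "bij_betw (\<lambda>c. homotopic SC (interval_of Delta_d) (Dom SC f) T `` ((\<lambda>g. Cmp SC g f) ` c))
       (Hom SC (Cod SC f) T // homotopic SC (interval_of Delta_d) (Cod SC f) T)
       (Hom SC (Dom SC f) T // homotopic SC (interval_of Delta_d) (Dom SC f) T)"
      \<comment> \<open>\<open>T\<close> is an admissible test object for the directed interval, and
        after rewriting the homotopy relations the bijection for it is the goal.\<close>
      using D[rule_format, OF fibrant_D[OF assms(2) T]]
      unfolding homotopic_eq[OF fibrant_HEP[OF assms(2) T]] .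
  qed
  \<comment> \<open>Both structures have the same cofibrations, so trivial cofibrations are
    preserved by the inclusion \<open>W\<close>.\<close>
  have "left_quillen (cisinski_model SC M (interval_of Delta_D)) (cisinski_model SC M (interval_of Delta_d)) id_functor"
    unfolding left_quillen_def
  proof (intro conjI)
    show "is_left_adjoint (cisinski_model SC M (interval_of Delta_D)) (cisinski_model SC M (interval_of Delta_d)) id_functor"
      by (rule id_left_adjoint) (simp_all add: cisinski_model_def category.defs)
  qed (use W in \<open>auto simp: cisinski_model_def category.defs id_functor_def\<close>)
  with W show ?thesis by blast
qed

end
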